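(* Let $k$ be any field and let $G$ be a transitive solvable subgroup of the symmetric group $S_{11}$. Let $G$ act on the rational function field $k(x_1,\ldots,x_{11})$ in $11$ variables via $k$-automorphisms defined by $\sigma\cdot x_i = x_{\sigma(i)}$ for any $\sigma\in G$ and any $1\le i\le 11$. Then the fixed field $k(x_1,\ldots,x_{11})^G$ is $k$-rational.
   Context: A finitely generated field extension $L$ of a field $k$ is called $k$-rational if $L$ is purely transcendental over $k$. For a group $G$ acting on a field $F$ by automorphisms, $F^G=\{f\in F : \sigma(f)=f \text{ for all } \sigma\in G\}$. *)

theory Defs
  imports
    "HOL-Library.Poly_Mapping"
    "HOL-Computational_Algebra.Normalized_Fraction"
    "HOL-Algebra.Sym_Groups"
    "HOL-Algebra.Generated_Fields"
    "HOL-Algebra.Algebraic_Closure_Type"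
begin

section \<open>Multivariate polynomials and rational functions\<close>

text \<open>
  A polynomial with coefficients in \<^typ>\<open>'a\<close> and variables indexed by \<^typ>\<open>'v\<close> is a finitely
  supported map from exponent vectors to coefficients.
\<close>

type_synonym ('v, 'a) mvpoly = "('v \<Rightarrow>\<^sub>0 nat) \<Rightarrow>\<^sub>0 'a"

type_synonym 'a ratfun = "(nat, 'a) mvpoly fract"

definition mvconst :: "'a::zero \<Rightarrow> ('v, 'a) mvpoly" where
  "mvconst c = Poly_Mapping.single 0 c"

definition mvvar :: "'v \<Rightarrow> ('v, 'a::zero_neq_one) mvpoly" where
  "mvvar i = Poly_Mapping.single (Poly_Mapping.single i 1) 1"

definition mveval :: "('a \<Rightarrow> 'b) \<Rightarrow> ('v \<Rightarrow> 'b) \<Rightarrow> ('v, 'a::zero) mvpoly \<Rightarrow> 'b::comm_ring_1" where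
  "mveval \<iota> v p =
    (\<Sum>m\<in>Poly_Mapping.keys p. \<iota> (Poly_Mapping.lookup p m) *
       (\<Prod>i\<in>Poly_Mapping.keys m. v i ^ Poly_Mapping.lookup m i))"

definition rf_const :: "'a::field \<Rightarrow> 'a ratfun" where
  "rf_const c = to_fract (mvconst c)"

definition rf_var :: "nat \<Rightarrow> 'a::field ratfun" where
  "rf_var i = to_fract (mvvar i)"


section \<open>Field extensions inside an ambient field\<close>

definition field_adjoin :: "'b::field set \<Rightarrow> 'b set \<Rightarrow> 'b set" where
  "field_adjoin K S = generate_field ring_of_type_algebra (K \<union> S)"

text \<open>
  Every polynomial relation over \<open>K\<close> between elements of \<open>B\<close> is trivial. The elements of the ambient
  field serve as their own variable indices, so a relation between elements of \<open>B\<close> is a polynomial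
  in which only indices from \<open>B\<close> occur.
\<close>

definition algebraically_independent :: "'b::field set \<Rightarrow> 'b set \<Rightarrow> bool" where
  "algebraically_independent K B \<longleftrightarrow>
    (\<forall>p :: ('b, 'b) mvpoly.
       (\<forall>m\<in>Poly_Mapping.keys p. Poly_Mapping.lookup p m \<in> K \<and> Poly_Mapping.keys m \<subseteq> B) \<and>
       mveval (\<lambda>c. c) (\<lambda>b. b) p = 0 \<longrightarrow> p = 0)"

definition purely_transcendental :: "'b::field set \<Rightarrow> 'b set \<Rightarrow> bool" where
  "purely_transcendental K L \<longleftrightarrow> (\<exists>B. algebraically_independent K B \<and> L = field_adjoin K B)"

definition finitely_generated_extension :: "'b::field set \<Rightarrow> 'b set \<Rightarrow> bool" where
  "finitely_generated_extension K L \<longleftrightarrow> (\<exists>S. finite S \<and> L = field_adjoin K S)"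

definition rational_extension :: "'b::field set \<Rightarrow> 'b set \<Rightarrow> bool" where
  "rational_extension K L \<longleftrightarrow> finitely_generated_extension K L \<and> purely_transcendental K L"

definition fixed_field :: "('g \<Rightarrow> 'b \<Rightarrow> 'b) \<Rightarrow> 'g set \<Rightarrow> 'b set \<Rightarrow> 'b set" where
  "fixed_field act G F = {f \<in> F. \<forall>\<sigma>\<in>G. act \<sigma> f = f}"


section \<open>The rational function field in \<open>n\<close> variables and the permutation action\<close>

definition rf_constants :: "'a::field ratfun set" where
  "rf_constants = range rf_const"

text \<open>
  \<open>k(x\<^sub>1, \<dots>, x\<^sub>n)\<close> is realised inside the field \<^typ>\<open>'a ratfun\<close> of rational functions in countably many
  variables, so that it can be indexed by \<open>{1..n}\<close> as \<^const>\<open>sym_group\<close> is.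
\<close>

definition rf_field :: "nat \<Rightarrow> 'a::field ratfun set" where
  "rf_field n = field_adjoin rf_constants (rf_var ` {1..n})"

text \<open>
  The substitution \<open>x\<^sub>i \<mapsto> x\<^bsub>\<sigma> i\<^esub>\<close> on polynomials and its extension to fractions. It is the \<open>k\<close>-automorphism
  determined by \<open>\<sigma> \<cdot> x\<^sub>i = x\<^bsub>\<sigma> i\<^esub>\<close>; the lemmas below show this for bijective \<open>\<sigma>\<close>, the only case that is used.
\<close>

definition mvperm :: "('v \<Rightarrow> 'v) \<Rightarrow> ('v, 'a::comm_ring_1) mvpoly \<Rightarrow> ('v, 'a) mvpoly" where
  "mvperm \<sigma> = mveval mvconst (\<lambda>i. mvvar (\<sigma> i))"

definition rf_act :: "(nat \<Rightarrow> nat) \<Rightarrow> 'a::field ratfun \<Rightarrow> 'a ratfun" where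
  "rf_act \<sigma> f =
    (THE g. \<exists>p q. q \<noteq> 0 \<and> f = Fract p q \<and> g = Fract (mvperm \<sigma> p) (mvperm \<sigma> q))"


subsection \<open>Well-definedness of the action\<close>

definition mvmon :: "('v \<Rightarrow> 'b) \<Rightarrow> ('v \<Rightarrow>\<^sub>0 nat) \<Rightarrow> 'b::comm_ring_1" where
  "mvmon v m = (\<Prod>i\<in>Poly_Mapping.keys m. v i ^ Poly_Mapping.lookup m i)"

lemma mvmon_superset:
  assumes "finite A" "Poly_Mapping.keys m \<subseteq> A"
  shows "mvmon v m = (\<Prod>i\<in>A. v i ^ Poly_Mapping.lookup m i)"
  unfolding mvmon_def using assms by (intro prod.mono_neutral_left) (auto simp: in_keys_iff)

lemma mvmon_add: "mvmon v (m + n) = mvmon v m * mvmon v n"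
proof -
  let ?A = "Poly_Mapping.keys m \<union> Poly_Mapping.keys n"
  have "mvmon v (m + n) = (\<Prod>i\<in>?A. v i ^ Poly_Mapping.lookup (m + n) i)"
    by (rule mvmon_superset) (auto simp: keys_add)
  also have "\<dots> = (\<Prod>i\<in>?A. v i ^ Poly_Mapping.lookup m i) * (\<Prod>i\<in>?A. v i ^ Poly_Mapping.lookup n i)"
    by (simp add: lookup_add power_add prod.distrib)
  also have "\<dots> = mvmon v m * mvmon v n"
    by (subst (1 2) mvmon_superset[of ?A]) auto
  finally show ?thesis .
qed

lemma mveval_superset:
  assumes "finite A" "Poly_Mapping.keys p \<subseteq> A" "\<iota> 0 = 0"
  shows "mveval \<iota> v p = (\<Sum>m\<in>A. \<iota> (Poly_Mapping.lookup p m) * mvmon v m)"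
  unfolding mveval_def mvmon_def[symmetric] using assms
  by (intro sum.mono_neutral_left) (auto simp: in_keys_iff)

lemma mvpoly_induct [case_names zero add]:
  fixes p :: "('v, 'a::comm_ring_1) mvpoly"
  assumes "P 0" "\<And>p m c. P p \<Longrightarrow> P (p + Poly_Mapping.single m c)"
  shows "P p"
proof (induction p rule: Poly_Mapping.update_induct)
  case const
  show ?case by (fact assms)
next
  case (update f a b)
  have "Poly_Mapping.update a b f = f + Poly_Mapping.single a b"
    using update(1)
    by (intro poly_mapping_eqI) (auto simp: lookup_update lookup_add lookup_single in_keys_iff when_def)
  then show ?case using assms(2)[OF update(3)] by metis
qed

lemma mveval_single:
  assumes "\<iota> 0 = 0"
  shows "mveval \<iota> v (Poly_Mapping.single m c) = \<iota> c * mvmon v m"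
  by (subst mveval_superset[of "{m}"]) (use assms in auto)

context
  fixes \<iota> :: "'a::comm_ring_1 \<Rightarrow> 'b::comm_ring_1"
  assumes \<iota>_add: "\<And>a b. \<iota> (a + b) = \<iota> a + \<iota> b"
    and \<iota>_mult: "\<And>a b. \<iota> (a * b) = \<iota> a * \<iota> b"
    and \<iota>_zero: "\<iota> 0 = 0"
begin

lemma mveval_add: "mveval \<iota> v (p + q) = mveval \<iota> v p + mveval \<iota> v q"
proof -
  let ?A = "Poly_Mapping.keys p \<union> Poly_Mapping.keys q"
  have *: "Poly_Mapping.keys (p + q) \<subseteq> ?A" by (rule keys_add)
  show ?thesis
    using * by (subst (1 2 3) mveval_superset[of ?A])
      (auto simp: \<iota>_zero lookup_add \<iota>_add distrib_right sum.distrib)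
qed

lemma mveval_mult: "mveval \<iota> v (p * q) = mveval \<iota> v p * mveval \<iota> v q"
proof (induction p rule: mvpoly_induct)
  case zero
  show ?case by (simp add: mveval_def)
next
  case (add p m c)
  have "mveval \<iota> v (Poly_Mapping.single m c * q) = \<iota> c * mvmon v m * mveval \<iota> v q"
  proof (induction q rule: mvpoly_induct)
    case zero
    show ?case by (simp add: mveval_def)
  next
    case (add q n d)
    then show ?case
      by (simp add: distrib_left mult_single mveval_add mveval_single \<iota>_zero \<iota>_mult mvmon_add mult_ac)
  qed
  then show ?case
    by (simp add: add distrib_right mveval_add mveval_single \<iota>_zero)
qed

end

lemma mvconst_hom:
  fixes a b :: "'a::comm_ring_1"
  shows "mvconst (a + b) = (mvconst a + mvconst b :: ('v, 'a) mvpoly)"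
    and "mvconst (a * b) = (mvconst a * mvconst b :: ('v, 'a) mvpoly)"
    and "mvconst 0 = (0 :: ('v, 'a) mvpoly)"
    and "mvconst 1 = (1 :: ('v, 'a) mvpoly)"
  by (simp_all add: mvconst_def single_add mult_single)

lemma mvperm_hom:
  shows mvperm_add: "mvperm \<sigma> (p + q) = mvperm \<sigma> p + mvperm \<sigma> q"
    and mvperm_mult: "mvperm \<sigma> (p * q) = mvperm \<sigma> p * mvperm \<sigma> q"
    and mvperm_zero: "mvperm \<sigma> 0 = 0"
  unfolding mvperm_def by (rule mveval_add mveval_mult mvconst_hom | simp add: mveval_def)+

lemma mvperm_const: "mvperm \<sigma> (mvconst c :: ('v, 'a::comm_ring_1) mvpoly) = mvconst c"
proof -
  have "mvperm \<sigma> (Poly_Mapping.single 0 c :: ('v, 'a) mvpoly) = mvconst c"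
    unfolding mvperm_def by (subst mveval_single) (simp_all add: mvconst_hom mvmon_def)
  then show ?thesis by (simp add: mvconst_def)
qed

lemma mvperm_one: "mvperm \<sigma> 1 = 1"
  using mvperm_const[of \<sigma> 1] by (simp add: mvconst_hom)

lemma mvperm_var: "mvperm \<sigma> (mvvar i) = mvvar (\<sigma> i)"
  unfolding mvperm_def by (subst (2) mvvar_def, subst mveval_single) (simp_all add: mvconst_hom mvmon_def)

lemma mvperm_prod: "mvperm \<sigma> (prod f A) = (\<Prod>i\<in>A. mvperm \<sigma> (f i))"
  by (induction A rule: infinite_finite_induct) (auto simp: mvperm_one mvperm_mult)

lemma mvperm_power: "mvperm \<sigma> (p ^ n) = mvperm \<sigma> p ^ n"
  by (induction n) (auto simp: mvperm_one mvperm_mult)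

lemma mvperm_single: "mvperm \<sigma> (Poly_Mapping.single m c) = mvconst c * mvmon (\<lambda>i. mvvar (\<sigma> i)) m"
  unfolding mvperm_def by (rule mveval_single) (simp add: mvconst_hom)

lemma mvperm_comp: "mvperm \<sigma> (mvperm \<tau> p) = mvperm (\<sigma> \<circ> \<tau>) p"
proof (induction p rule: mvpoly_induct)
  case zero
  show ?case by (simp add: mvperm_zero)
next
  case (add p m c)
  then show ?case
    by (simp add: mvperm_add mvperm_single mvperm_mult mvperm_const mvmon_def mvperm_prod mvperm_power mvperm_var)
qed

lemma mvvar_power: "mvvar i ^ n = Poly_Mapping.single (Poly_Mapping.single i n) (1 :: 'a::comm_ring_1)"
  by (induction n) (simp_all add: mvvar_def mult_single single_add[symmetric])

lemma mvmon_mvvar: "mvmon mvvar m = Poly_Mapping.single m (1 :: 'a::comm_ring_1)"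
proof (induction m rule: Poly_Mapping.update_induct)
  case const
  show ?case by (simp add: mvmon_def)
next
  case (update f a b)
  have "Poly_Mapping.update a b f = f + Poly_Mapping.single a b"
    using update(1)
    by (intro poly_mapping_eqI) (auto simp: lookup_update lookup_add lookup_single in_keys_iff when_def)
  moreover have "mvmon mvvar (Poly_Mapping.single a b) =
      (Poly_Mapping.single (Poly_Mapping.single a b) (1 :: 'a))"
    using update(2) by (simp add: mvmon_def mvvar_power)
  ultimately show ?case
    by (simp add: mvmon_add update(3) mult_single)
qed

lemma mvperm_id: "mvperm id p = p"
proof (induction p rule: mvpoly_induct)
  case zero
  show ?case by (simp add: mvperm_zero)
next
  case (add p m c)
  have "mvperm id (Poly_Mapping.single m c) = Poly_Mapping.single m c"
    by (simp add: mvperm_single mvmon_mvvar mvconst_def mult_single)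
  then show ?case by (simp only: mvperm_add add)
qed

lemma mvperm_eq_0_iff:
  assumes "bij \<sigma>"
  shows "mvperm \<sigma> p = 0 \<longleftrightarrow> p = 0"
proof
  assume "mvperm \<sigma> p = 0"
  then have "mvperm (inv' \<sigma> \<circ> \<sigma>) p = 0"
    by (simp add: mvperm_comp[symmetric] mvperm_zero)
  moreover have "inv' \<sigma> \<circ> \<sigma> = id" using assms by (simp add: bij_is_inj)
  ultimately show "p = 0" by (simp add: mvperm_id)
qed (simp add: mvperm_zero)

lemma rf_act_Fract:
  assumes "bij \<sigma>" "q \<noteq> 0"
  shows "rf_act \<sigma> (Fract p q) = Fract (mvperm \<sigma> p) (mvperm \<sigma> q)"
  unfolding rf_act_def
proof (rule the_equality)
  fix g
  assume "\<exists>p' q'. q' \<noteq> 0 \<and> Fract p q = Fract p' q' \<and> g = Fract (mvperm \<sigma> p') (mvperm \<sigma> q')"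
  then obtain p' q' where *: "q' \<noteq> 0" "Fract p q = Fract p' q'"
    "g = Fract (mvperm \<sigma> p') (mvperm \<sigma> q')" by blast
  then have "p * q' = p' * q" using assms by (simp add: eq_fract)
  then have "mvperm \<sigma> p * mvperm \<sigma> q' = mvperm \<sigma> p' * mvperm \<sigma> q"
    by (metis mvperm_mult)
  then show "g = Fract (mvperm \<sigma> p) (mvperm \<sigma> q)"
    using * assms by (simp add: eq_fract mvperm_eq_0_iff)
qed (use assms in blast)

lemma rf_act_const: "bij \<sigma> \<Longrightarrow> rf_act \<sigma> (rf_const c) = rf_const c"
  by (simp add: rf_const_def to_fract_def rf_act_Fract mvperm_const mvperm_one)

lemma rf_act_var: "bij \<sigma> \<Longrightarrow> rf_act \<sigma> (rf_var i) = rf_var (\<sigma> i)"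
  by (simp add: rf_var_def to_fract_def rf_act_Fract mvperm_var mvperm_one)

lemma rf_act_add: "bij \<sigma> \<Longrightarrow> rf_act \<sigma> (f + g) = rf_act \<sigma> f + rf_act \<sigma> g"
  by (cases f, cases g) (simp add: rf_act_Fract mvperm_add mvperm_mult mvperm_eq_0_iff)

lemma rf_act_mult: "bij \<sigma> \<Longrightarrow> rf_act \<sigma> (f * g) = rf_act \<sigma> f * rf_act \<sigma> g"
  by (cases f, cases g) (simp add: rf_act_Fract mvperm_mult)

lemma rf_act_comp: "bij \<sigma> \<Longrightarrow> bij \<tau> \<Longrightarrow> rf_act \<sigma> (rf_act \<tau> f) = rf_act (\<sigma> \<circ> \<tau>) f"
  by (cases f) (simp add: rf_act_Fract mvperm_comp mvperm_eq_0_iff bij_comp)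

lemma rf_act_id: "rf_act id f = f"
  by (cases f) (simp add: rf_act_Fract mvperm_id)

end

theory Submission
  imports Defs "HOL-Number_Theory.Cong"
begin

text \<open>
  The fixed field is generated by eleven explicit elements; a generating set of that size is
  algebraically independent because the \<open>x\<^sub>i\<close> are algebraic over it.

  A transitive solvable group of degree 11 consists of affine maps \<open>j \<mapsto> c j + b\<close> of \<open>\<int>/11\<close>, so it is
  generated by the 11-cycle \<open>\<tau>\<close> and one multiplication \<open>\<kappa>\<close> by \<open>r \<in> {1, 4, 7, 10}\<close>.
  Away from characteristic \<open>p = 11\<close>, put \<open>Y = \<Sum>\<^sub>i x\<^sub>i t\<^sup>i\<close> in \<open>F[t] / (1 + t + \<dots> + t\<^bsup>p - 1\<^esup>)\<close>. On the
  conjugates \<open>Y(t\<^sup>s)\<close> the cycle acts by powers of \<open>t\<close>, so the invariant monomials in them form the ideal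
  \<open>(p, t - g)\<close> of \<open>\<int>[\<int>/(p - 1)]\<close>. Following Lenstra, this ideal is principal for \<open>p = 5, 11\<close>. The
  coefficients \<open>w\<^sub>s\<close> of the corresponding monomial \<open>Z = \<Sum>\<^sub>s w\<^sub>s t\<^sup>s\<close> generate, together with \<open>\<Sum>\<^sub>i x\<^sub>i\<close>,
  the invariants of \<open>\<tau>\<close>, and \<open>\<kappa>\<close> permutes them by \<open>w\<^sub>s \<mapsto> w\<^bsub>r s\<^esub>\<close>. What remains is a pairwise swap
  and two parallel 5-cycles; after linearising one 5-cycle over the other, the same construction with
  \<open>p = 5\<close> applies. In characteristic \<open>p\<close> the cycle is unipotent and \<open>\<theta> = \<Sum>\<^sub>i i x\<^sub>i / \<Sum>\<^sub>i x\<^sub>i\<close> satisfies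
  \<open>\<tau> \<theta> = \<theta> - 1\<close>, which again gives explicit generators.
\<close>

section \<open>Subfields, algebraicity and transcendence bases\<close>

text \<open>The field may lack p-th roots of unity, and \<open>cyc p\<close> may factor over it, so
  the quotient ring that contains Y may have zero divisors. Divisions therefore happen only among
  scalars: the norm of Y is shown to be a nonzero scalar \<nu>, exponents are kept nonnegative by
  adding norm elements, and statements descend to the field by comparing coordinates. The
  coordinates refer to t, ..., t^(p-1), a basis that t -> t^r permutes; this is why
  \<open>\<kappa>\<close> permutes the new generators instead of mixing them linearly. Principality
  of the ideal is the arithmetic input: it makes every invariant monomial a product of conjugates of
  a single one. It fails for p = 47, Swan's non-rational example over the rationals. The multipliers
  1, 10, 4, 7 generate the subgroups of orders 1, 2, 5, 10 of the units modulo 11. The two 5-cycles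
  are the squares and the non-squares: 4 rotates both, 10 = -1 swaps them, and 7 does both. Each
  reduction yields at most eleven generators, so that freeness can be restored by exchange whenever
  a later step needs it.\<close>

definition sring :: "'f::field set \<Rightarrow> bool" where
  "sring A \<longleftrightarrow> 1 \<in> A \<and> (\<forall>x\<in>A. \<forall>y\<in>A. x + y \<in> A \<and> x * y \<in> A) \<and> (\<forall>x\<in>A. - x \<in> A)"

definition sfield :: "'f::field set \<Rightarrow> bool" where
  "sfield A \<longleftrightarrow> sring A \<and> (\<forall>x\<in>A. inverse x \<in> A)"

lemma sringD:
  assumes "sring A"
  shows sring_1: "1 \<in> A"
    and sring_add: "x \<in> A \<Longrightarrow> y \<in> A \<Longrightarrow> x + y \<in> A"
    and sring_mult: "x \<in> A \<Longrightarrow> y \<in> A \<Longrightarrow> x * y \<in> A"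
    and sring_uminus: "x \<in> A \<Longrightarrow> - x \<in> A"
  using assms by (auto simp: sring_def)

lemma sring_0: "sring A \<Longrightarrow> 0 \<in> A"
  using sring_1[of A] sring_uminus[of A 1] sring_add[of A 1 "-1"] by auto

lemma sring_diff: "sring A \<Longrightarrow> x \<in> A \<Longrightarrow> y \<in> A \<Longrightarrow> x - y \<in> A"
  using sring_add[of A x "- y"] sring_uminus[of A y] by auto

lemma sring_sum: "sring A \<Longrightarrow> (\<And>i. i \<in> I \<Longrightarrow> f i \<in> A) \<Longrightarrow> sum f I \<in> A"
  by (induction I rule: infinite_finite_induct) (auto simp: sring_0 sring_add)

lemma sring_prod: "sring A \<Longrightarrow> (\<And>i. i \<in> I \<Longrightarrow> f i \<in> A) \<Longrightarrow> prod f I \<in> A"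
  by (induction I rule: infinite_finite_induct) (auto simp: sring_1 sring_mult)

lemma sring_power: "sring A \<Longrightarrow> x \<in> A \<Longrightarrow> x ^ n \<in> A"
  by (induction n) (auto simp: sring_1 sring_mult)

lemma sring_of_nat: "sring A \<Longrightarrow> of_nat n \<in> A"
  by (induction n) (auto simp: sring_0 sring_1 sring_add)

lemmas sring_closed = sring_0 sring_1 sring_add sring_mult sring_uminus sring_diff sring_sum
  sring_prod sring_power sring_of_nat

lemma sfield_sring: "sfield A \<Longrightarrow> sring A"
  by (simp add: sfield_def)

lemma sfield_inverse: "sfield A \<Longrightarrow> x \<in> A \<Longrightarrow> inverse x \<in> A"
  by (simp add: sfield_def)

lemma sfield_divide: "sfield A \<Longrightarrow> x \<in> A \<Longrightarrow> y \<in> A \<Longrightarrow> x / y \<in> A"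
  by (simp add: sfield_def sring_def divide_inverse)

lemmas sfield_closed = sring_closed[OF sfield_sring] sfield_inverse sfield_divide

lemma sring_poly: "sring A \<Longrightarrow> (\<And>i. coeff p i \<in> A) \<Longrightarrow> x \<in> A \<Longrightarrow> poly p x \<in> A"
  unfolding poly_altdef by (intro sring_closed) auto

section \<open>Subfields as closed sets, and field adjunction\<close>

lemma ring_of_type_simps:
  "carrier ring_of_type_algebra = UNIV"
  "x \<oplus>\<^bsub>ring_of_type_algebra\<^esub> y = x + y"
  "x \<otimes>\<^bsub>ring_of_type_algebra\<^esub> y = x * y"
  "\<zero>\<^bsub>ring_of_type_algebra\<^esub> = 0"
  "\<one>\<^bsub>ring_of_type_algebra\<^esub> = 1"
  by (simp_all add: ring_of_type_algebra_def)

lemma ring_of_type_uminus: "\<ominus>\<^bsub>ring_of_type_algebra\<^esub> x = - (x :: 'f::field)"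
proof -
  interpret R: field "ring_of_type_algebra :: 'f ring" by rule
  show ?thesis by (rule R.minus_equality) (simp_all add: ring_of_type_simps)
qed

lemma ring_of_type_inv: "x \<noteq> 0 \<Longrightarrow> inv\<^bsub>ring_of_type_algebra\<^esub> x = inverse (x :: 'f::field)"
proof -
  interpret R: field "ring_of_type_algebra :: 'f ring" by rule
  assume "x \<noteq> 0"
  then show ?thesis by (intro R.comm_inv_char) (simp_all add: ring_of_type_simps)
qed

text \<open>Makes the theory of carrier-based fields available for plain sets. Since
  \<open>inverse 0 = 0\<close>, closure under \<open>inverse\<close> says nothing extra at
  zero.\<close>

lemma subfield_ring_of_type_iff: "subfield A (ring_of_type_algebra :: 'f::field ring) \<longleftrightarrow> sfield A"
proof
  interpret R: field "ring_of_type_algebra :: 'f ring" by rule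
  show "sfield A" if "subfield A (ring_of_type_algebra :: 'f ring)"
  proof -
    note A = subfieldE[OF that] subringE[OF subfieldE(1)[OF that]]
    have "inverse x \<in> A" if "x \<in> A" for x
      using R.subfield_m_inv(1)[OF \<open>subfield A _\<close>, of x] that
      by (cases "x = 0") (auto simp: ring_of_type_simps ring_of_type_inv)
    then show ?thesis
      using A by (auto simp: sfield_def sring_def ring_of_type_simps ring_of_type_uminus)
  qed
  show "subfield A (ring_of_type_algebra :: 'f ring)" if "sfield A"
    using that by (intro R.subfieldI' R.subringI)
      (auto simp: ring_of_type_simps ring_of_type_uminus ring_of_type_inv sfield_closed)
qed

lemma sfield_adjoin: "sfield (field_adjoin K (S :: 'f::field set))"
proof -
  interpret R: field "ring_of_type_algebra :: 'f ring" by rule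
  show ?thesis
    unfolding field_adjoin_def subfield_ring_of_type_iff[symmetric]
    by (rule R.generate_field_is_subfield) (simp add: ring_of_type_simps)
qed

lemma adjoin_base: "K \<subseteq> field_adjoin K S" and adjoin_gens: "S \<subseteq> field_adjoin K S"
  unfolding field_adjoin_def by (auto intro: generate_field.incl)

lemma adjoin_least: "sfield (L :: 'f::field set) \<Longrightarrow> K \<subseteq> L \<Longrightarrow> S \<subseteq> L \<Longrightarrow> field_adjoin K S \<subseteq> L"
proof -
  interpret R: field "ring_of_type_algebra :: 'f ring" by rule
  assume "sfield L" "K \<subseteq> L" "S \<subseteq> L"
  then show ?thesis
    unfolding field_adjoin_def
    by (intro R.generate_field_min_subfield1) (auto simp: ring_of_type_simps subfield_ring_of_type_iff)
qed

lemma adjoin_mono: "K \<subseteq> K' \<Longrightarrow> S \<subseteq> S' \<Longrightarrow> field_adjoin K S \<subseteq> field_adjoin K' S'"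
  using adjoin_base[of K' S'] adjoin_gens[of S' K'] by (intro adjoin_least sfield_adjoin) auto

lemma adjoin_adjoin: "field_adjoin (field_adjoin K S) T = field_adjoin K (S \<union> T)"
proof
  show "field_adjoin (field_adjoin K S) T \<subseteq> field_adjoin K (S \<union> T)"
    using adjoin_gens[of "S \<union> T" K] by (intro adjoin_least sfield_adjoin adjoin_mono) auto
  show "field_adjoin K (S \<union> T) \<subseteq> field_adjoin (field_adjoin K S) T"
    using adjoin_base[of "field_adjoin K S" T] adjoin_base[of K S] adjoin_gens[of S K]
      adjoin_gens[of T "field_adjoin K S"]
    by (intro adjoin_least sfield_adjoin) auto
qed

section \<open>Fractions over a ring and common denominators\<close>

lemma sfield_fractions:
  assumes A: "sring A"
  shows "sfield {a / b |a b. a \<in> A \<and> b \<in> A \<and> b \<noteq> 0}" (is "sfield ?F")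
proof -
  have frac: "a / b \<in> ?F" if "a \<in> A" "b \<in> A" "b \<noteq> 0" for a b using that by blast
  have "x + y \<in> ?F \<and> x * y \<in> ?F" if xy: "x \<in> ?F" "y \<in> ?F" for x y
  proof -
    obtain a b c d where *: "x = a / b" "y = c / d" "a \<in> A" "b \<in> A" "b \<noteq> 0" "c \<in> A" "d \<in> A" "d \<noteq> 0"
      using xy by blast
    have "x + y = (a * d + c * b) / (b * d)" "x * y = (a * c) / (b * d)"
      using * by (simp_all add: field_simps)
    moreover have "(a * d + c * b) / (b * d) \<in> ?F" "(a * c) / (b * d) \<in> ?F"
      by (rule frac; use * A in \<open>simp add: sring_closed\<close>)+
    ultimately show ?thesis by simp
  qed
  moreover have "- x \<in> ?F" "inverse x \<in> ?F" if x: "x \<in> ?F" for x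
  proof -
    obtain a b where *: "x = a / b" "a \<in> A" "b \<in> A" "b \<noteq> 0" using x by blast
    have "- x = (- a) / b" using * by simp
    moreover have "(- a) / b \<in> ?F" by (rule frac; use * A in \<open>simp add: sring_closed\<close>)
    ultimately show "- x \<in> ?F" by simp
    show "inverse x \<in> ?F"
    proof (cases "a = 0")
      case True
      then show ?thesis using * frac[of 0 1] A by (simp add: sring_closed)
    next
      case False
      then have "inverse x = b / a" using * by simp
      then show ?thesis using * False by (auto intro!: frac)
    qed
  qed
  moreover have "1 \<in> ?F" using frac[of 1 1] A by (simp add: sring_closed)
  ultimately show ?thesis by (auto simp: sfield_def sring_def)
qed

text \<open>Gives elements of an adjoined field a concrete shape. Together with
  \<open>common_denominator\<close> it turns an equation over the field into one over a chosen ring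
  that contains K and S.\<close>

lemma adjoin_fractions:
  assumes "sring A" "K \<subseteq> A" "S \<subseteq> A"
  shows "field_adjoin K S \<subseteq> {a / b |a b. a \<in> A \<and> b \<in> A \<and> b \<noteq> 0}"
proof (rule adjoin_least[OF sfield_fractions[OF assms(1)]])
  have "a \<in> {a / b |a b. a \<in> A \<and> b \<in> A \<and> b \<noteq> 0}" if "a \<in> A" for a
    using that sring_1[OF assms(1)] by (intro CollectI exI[of _ a] exI[of _ 1]) auto
  then show "K \<subseteq> {a / b |a b. a \<in> A \<and> b \<in> A \<and> b \<noteq> 0}" "S \<subseteq> {a / b |a b. a \<in> A \<and> b \<in> A \<and> b \<noteq> 0}"
    using assms by blast+
qed

lemma common_denominator:
  assumes A: "sring A" and "finite I"
    and "\<And>i. i \<in> I \<Longrightarrow> c i \<in> {a / b |a b. a \<in> A \<and> b \<in> A \<and> b \<noteq> 0}"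
  shows "\<exists>d\<in>A. d \<noteq> 0 \<and> (\<forall>i\<in>I. d * c i \<in> A)"
  using assms(2,3)
proof (induction I)
  case empty
  show ?case using sring_1[OF A] by (intro bexI[of _ 1]) auto
next
  case (insert i I)
  then obtain d where d: "d \<in> A" "d \<noteq> 0" "\<forall>i\<in>I. d * c i \<in> A" by auto
  obtain a b where ab: "c i = a / b" "a \<in> A" "b \<in> A" "b \<noteq> 0" using insert.prems[of i] by auto
  have "(d * b) * c j \<in> A" if "j \<in> insert i I" for j
  proof (cases "j = i")
    case True
    then show ?thesis using ab d A by (simp add: sring_mult)
  next
    case False
    then have "d * c j * b \<in> A" using that ab d A by (auto intro: sring_mult)
    then show ?thesis by (simp add: mult_ac)
  qed
  then show ?case using ab d A by (intro bexI[of _ "d * b"]) (auto intro: sring_mult)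
qed


section \<open>Algebraic elements\<close>

definition algebraic_over :: "'f::field set \<Rightarrow> 'f \<Rightarrow> bool" where
  "algebraic_over K x \<longleftrightarrow> (\<exists>p. p \<noteq> 0 \<and> (\<forall>i. coeff p i \<in> K) \<and> poly p x = 0)"

text \<open>\<open>ring.eval\<close> reads a coefficient list from the leading coefficient down,
  \<open>Poly\<close> from the constant one up; hence the \<open>rev\<close>.\<close>

lemma eval_rev_coeffs:
  "ring.eval (ring_of_type_algebra :: 'f::field ring) (rev cs) x = poly (Poly cs) x"
proof -
  interpret R: field "ring_of_type_algebra :: 'f ring" by rule
  have pow: "y [^]\<^bsub>ring_of_type_algebra\<^esub> n = y ^ n" for y :: 'f and n :: nat
    by (induction n) (simp_all add: ring_of_type_simps)
  show ?thesis
  proof (induction cs rule: rev_induct)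
    case (snoc c cs)
    have "Poly (cs @ [c]) = Poly cs + monom c (length cs)"
      by (intro poly_eqI) (auto simp: coeff_Poly_eq nth_default_append nth_default_def nth_append)
    then show ?case
      using snoc by (simp add: ring_of_type_simps pow poly_monom)
  qed (simp add: ring_of_type_simps)
qed

lemma algebraic_ring_of_type_iff:
  assumes "sfield K"
  shows "(ring.algebraic (ring_of_type_algebra :: 'f::field ring) over K) x \<longleftrightarrow> algebraic_over K x"
proof
  interpret R: field "ring_of_type_algebra :: 'f ring" by rule
  have K: "subring K (ring_of_type_algebra :: 'f ring)"
    using assms subfield_ring_of_type_iff subfieldE(1) by blast
  show "algebraic_over K x" if alg: "(R.algebraic over K) x"
  proof -
    obtain p where p: "p \<in> carrier (K[X]\<^bsub>ring_of_type_algebra\<^esub>)" "p \<noteq> []"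
        "R.eval p x = \<zero>\<^bsub>ring_of_type_algebra\<^esub>"
      using R.algebraicE[OF K _ alg] by (auto simp: ring_of_type_simps)
    then have pK: "set p \<subseteq> K" "hd p \<noteq> 0"
      by (auto simp: univ_poly_def polynomial_def ring_of_type_simps)
    have "poly (Poly (rev p)) x = 0"
      using p(3) eval_rev_coeffs[of "rev p" x] by (simp add: ring_of_type_simps)
    moreover have "coeff (Poly (rev p)) i \<in> K" for i
      using pK(1) sring_0[OF sfield_sring[OF assms]] nth_mem[of "length p - Suc i" p]
      by (auto simp: coeff_Poly_eq nth_default_def rev_nth simp del: nth_mem)
    moreover have "Poly (rev p) \<noteq> 0"
    proof
      assume "Poly (rev p) = 0"
      then have "coeff (Poly (rev p)) (length p - 1) = 0" by simp
      then show False
        using p(2) pK(2) by (auto simp: coeff_Poly_eq nth_default_def rev_nth hd_conv_nth)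
    qed
    ultimately show ?thesis unfolding algebraic_over_def by blast
  qed
  show "(R.algebraic over K) x" if alg: "algebraic_over K x"
  proof -
    obtain p where p: "p \<noteq> 0" "\<And>i. coeff p i \<in> K" "poly p x = 0"
      using alg unfolding algebraic_over_def by blast
    have "rev (coeffs p) \<in> carrier (K[X]\<^bsub>ring_of_type_algebra\<^esub>)"
      using p by (auto simp: univ_poly_def polynomial_def ring_of_type_simps coeffs_def hd_rev)
    moreover have "R.eval (rev (coeffs p)) x = \<zero>\<^bsub>ring_of_type_algebra\<^esub>"
      using p eval_rev_coeffs[of "coeffs p" x] by (simp add: ring_of_type_simps)
    ultimately show ?thesis
      using p(1) by (intro R.algebraicI[of "rev (coeffs p)"]) auto
  qed
qed

lemma sfield_algebraics:
  assumes "sfield (K :: 'f::field set)"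
  shows "sfield {x. algebraic_over K x}"
proof -
  interpret R: field "ring_of_type_algebra :: 'f ring" by rule
  show ?thesis
    using R.subfield_of_algebraics[of K] assms
    by (simp add: subfield_ring_of_type_iff algebraic_ring_of_type_iff ring_of_type_simps)
qed

lemma algebraic_over_self:
  assumes "sfield K" "x \<in> K"
  shows "algebraic_over K x"
  unfolding algebraic_over_def using assms
  by (intro exI[of _ "[:-x, 1:]"]) (auto simp: coeff_pCons sfield_closed split: nat.splits)

lemma algebraic_over_mono: "algebraic_over K x \<Longrightarrow> K \<subseteq> K' \<Longrightarrow> algebraic_over K' x"
  unfolding algebraic_over_def by blast

text \<open>The finitely many coefficients of an equation for x generate a finite extension E of K,
  and E(x) is finite over E. By the tower law E(x) is finite over K, so x is algebraic over
  K.\<close>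

lemma algebraic_over_trans:
  assumes K: "sfield K" and x: "algebraic_over {y. algebraic_over K y} x"
  shows "algebraic_over K x"
proof -
  let ?R = "ring_of_type_algebra :: 'a ring"
  interpret R: field ?R by rule
  note [simp] = subfield_ring_of_type_iff ring_of_type_simps
  obtain p where p: "p \<noteq> 0" "\<And>i. algebraic_over K (coeff p i)" "poly p x = 0"
    using x unfolding algebraic_over_def[of "Collect _"] by blast
  define E where "E = R.finite_extension K (coeffs p)"
  have sK: "subfield K ?R" using K by simp
  have algc: "(R.algebraic over K) c" if "c \<in> set (coeffs p)" for c
    using p(2) that K by (auto simp: algebraic_ring_of_type_iff coeffs_def split: if_splits)
  have E: "subfield E ?R" "R.finite_dimension K E"
    unfolding E_def using R.finite_extension_is_subfield[OF sK] R.finite_extension_finite_dimension(1)[OF sK] algc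
    by auto
  have cE: "coeff p i \<in> E" for i
  proof (cases "coeff p i = 0")
    case True
    then show ?thesis using E by (simp add: sfield_closed)
  next
    case False
    then have "coeff p i \<in> set (coeffs p)"
      using range_coeff[of p] by auto
    then show ?thesis
      unfolding E_def using R.finite_extension_mem[OF subfieldE(1)[OF sK]] by auto
  qed
  then have "algebraic_over E x" using p unfolding algebraic_over_def by blast
  then have xE: "(R.algebraic over E) x" using E by (simp add: algebraic_ring_of_type_iff)
  have "R.finite_dimension E (R.simple_extension E x)"
    using R.finite_dimension_simple_extension[OF E(1) _] xE by simp
  then have fd: "R.finite_dimension K (R.simple_extension E x)"
    using R.telescopic_base_dim(1)[OF sK E(1) E(2)] by simp
  have "subring (R.simple_extension E x) ?R"
    using R.simple_extension_is_subring[OF subfieldE(1)[OF E(1)]] by simp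
  then have "(R.algebraic over K) x"
    using R.finite_dimension_imp_algebraic[OF sK _ fd] R.simple_extension_mem[OF subfieldE(1)[OF E(1)]]
    by simp
  then show ?thesis using K by (simp add: algebraic_ring_of_type_iff)
qed


section \<open>Algebraic hull and exchange\<close>

definition alg_hull :: "'f::field set \<Rightarrow> 'f set \<Rightarrow> 'f set" where
  "alg_hull K S = {x. algebraic_over (field_adjoin K S) x}"

lemma adjoin_subset_hull: "field_adjoin K S \<subseteq> alg_hull K S"
  unfolding alg_hull_def using algebraic_over_self[OF sfield_adjoin] by auto

lemma gens_subset_hull: "S \<subseteq> alg_hull K S"
  using adjoin_subset_hull adjoin_gens by blast

lemma alg_hull_mono: "S \<subseteq> T \<Longrightarrow> alg_hull K S \<subseteq> alg_hull K T"
  unfolding alg_hull_def using algebraic_over_mono adjoin_mono[of K K S T] by blast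

lemma alg_hull_least: "T \<subseteq> alg_hull K S \<Longrightarrow> alg_hull K T \<subseteq> alg_hull K S"
proof
  fix x assume T: "T \<subseteq> alg_hull K S" and x: "x \<in> alg_hull K T"
  have "field_adjoin K T \<subseteq> alg_hull K S"
    using T adjoin_subset_hull[of K S] adjoin_base[of K S]
    by (intro adjoin_least) (auto simp: alg_hull_def sfield_algebraics sfield_adjoin)
  then have "algebraic_over {y. algebraic_over (field_adjoin K S) y} x"
    using x algebraic_over_mono by (force simp: alg_hull_def)
  then show "x \<in> alg_hull K S"
    unfolding alg_hull_def using algebraic_over_trans[OF sfield_adjoin] by blast
qed

lemma sring_poly_values: "sring L \<Longrightarrow> sring {poly p b |p. \<forall>i. coeff p i \<in> L}" (is "_ \<Longrightarrow> sring ?A")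
proof -
  assume L: "sring L"
  have I: "poly p b \<in> ?A" if "\<And>i. coeff p i \<in> L" for p using that by blast
  have "x + y \<in> ?A \<and> x * y \<in> ?A" if xy: "x \<in> ?A" "y \<in> ?A" for x y
  proof -
    obtain p q where "x = poly p b" "y = poly q b" "\<forall>i. coeff p i \<in> L" "\<forall>i. coeff q i \<in> L"
      using xy by blast
    then show ?thesis
      using I[of "p + q"] I[of "p * q"] L by (auto simp: coeff_mult sring_closed)
  qed
  moreover have "- x \<in> ?A" if x: "x \<in> ?A" for x
  proof -
    obtain p where "x = poly p b" "\<forall>i. coeff p i \<in> L" using x by blast
    then show ?thesis using I[of "- p"] L by (auto simp: sring_closed)
  qed
  moreover have "1 \<in> ?A" using I[of 1] L by (auto simp: coeff_1 sring_closed)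
  ultimately show ?thesis by (auto simp: sring_def)
qed

lemma adjoin_insert_fractions:
  "field_adjoin K (insert b S) \<subseteq> {x / y |x y. x \<in> {poly p b |p. \<forall>i. coeff p i \<in> field_adjoin K S}
     \<and> y \<in> {poly p b |p. \<forall>i. coeff p i \<in> field_adjoin K S} \<and> y \<noteq> 0}"
proof (rule adjoin_fractions)
  let ?L = "field_adjoin K S"
  let ?A = "{poly p b |p. \<forall>i. coeff p i \<in> ?L}"
  note L = sfield_adjoin[of K S]
  show "sring ?A" by (rule sring_poly_values) (simp add: L sfield_sring)
  have "c \<in> ?A" if "c \<in> ?L" for c
    using that L by (intro CollectI exI[of _ "[:c:]"]) (auto simp: coeff_pCons sfield_closed split: nat.splits)
  moreover have "b \<in> ?A"
    using L by (intro CollectI exI[of _ "[:0, 1:]"]) (auto simp: coeff_pCons sfield_closed split: nat.splits)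
  ultimately show "K \<subseteq> ?A" "insert b S \<subseteq> ?A" using adjoin_base[of K S] adjoin_gens[of S K] by blast+
qed

text \<open>Clearing denominators in the equation of f over L(b) gives a relation between f and b
  with coefficients in L, which is then read as a polynomial Q in b. If Q were zero, each of its
  coefficients would be an equation for f over L and hence trivial, because f is transcendental over
  L; then the leading coefficient of p would vanish.\<close>

lemma alg_hull_exchange:
  assumes f: "f \<in> alg_hull K (insert b S)" and nf: "f \<notin> alg_hull K S"
  shows "b \<in> alg_hull K (insert f S)"
proof -
  define L where "L = field_adjoin K S"
  let ?A = "{poly p b |p. \<forall>i. coeff p i \<in> L}"
  have L: "sfield L" unfolding L_def by (rule sfield_adjoin)
  have A: "sring ?A" by (rule sring_poly_values) (simp add: L sfield_sring)
  obtain p where p: "p \<noteq> 0" "\<And>i. coeff p i \<in> field_adjoin K (insert b S)" "poly p f = 0"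
    using f unfolding alg_hull_def algebraic_over_def by blast
  define n where "n = degree p"
  have "\<exists>d\<in>?A. d \<noteq> 0 \<and> (\<forall>i\<in>{..n}. d * coeff p i \<in> ?A)"
    using p(2) adjoin_insert_fractions[of K b S, folded L_def]
    by (intro common_denominator[OF A]) (simp, blast)
  then obtain d where d: "d \<noteq> 0" "\<And>i. i \<le> n \<Longrightarrow> d * coeff p i \<in> ?A" by blast
  have "\<forall>i. \<exists>q. i \<le> n \<longrightarrow> d * coeff p i = poly q b \<and> (\<forall>j. coeff q j \<in> L)"
    using d(2) by blast
  then obtain q where q: "\<And>i. i \<le> n \<Longrightarrow> d * coeff p i = poly (q i) b"
      "\<And>i j. i \<le> n \<Longrightarrow> coeff (q i) j \<in> L"
    by metis
  define Q where "Q = (\<Sum>i\<le>n. smult (f ^ i) (q i))"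
  have "poly Q b = (\<Sum>i\<le>n. f ^ i * (d * coeff p i))"
    unfolding Q_def poly_sum using q(1) by simp
  also have "\<dots> = d * poly p f"
    unfolding poly_altdef n_def by (simp add: sum_distrib_left mult_ac)
  finally have "poly Q b = 0" using p by simp
  moreover have "coeff Q j \<in> field_adjoin K (insert f S)" for j
  proof -
    have "L \<subseteq> field_adjoin K (insert f S)" unfolding L_def by (rule adjoin_mono) auto
    moreover have "f \<in> field_adjoin K (insert f S)" using adjoin_gens by blast
    ultimately show ?thesis
      unfolding Q_def coeff_sum coeff_smult using q(2)
      by (intro sfield_closed sfield_adjoin) auto
  qed
  moreover have "Q \<noteq> 0"
  proof
    assume "Q = 0"
    have z: "coeff (q i) j = 0" if i: "i \<le> n" for i j
    proof -
      define r where "r = (\<Sum>i\<le>n. monom (coeff (q i) j) i)"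
      have c: "coeff r i = (if i \<le> n then coeff (q i) j else 0)" for i
        unfolding r_def by (simp add: coeff_sum if_distrib cong: if_cong)
      have "poly r f = coeff Q j"
        unfolding r_def Q_def by (simp add: poly_sum poly_monom coeff_sum mult_ac)
      then have "poly r f = 0" using \<open>Q = 0\<close> by simp
      moreover have "coeff r i \<in> L" for i using c q(2) L by (auto simp: sfield_closed)
      ultimately have "r = 0"
        using nf unfolding alg_hull_def L_def[symmetric] algebraic_over_def by blast
      then show ?thesis using c[of i] i by simp
    qed
    have "coeff p n = 0"
      using q(1)[of n] z[of n] d(1) by (simp add: poly_altdef)
    then show False using p(1) n_def by simp
  qed
  ultimately show ?thesis unfolding alg_hull_def algebraic_over_def by blast
qed

text \<open>Independence phrased through the hull operator, the form in which exchange applies. It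
  is converted to independence of polynomial relations only at the very end.\<close>

definition alg_free :: "'f::field set \<Rightarrow> 'f set \<Rightarrow> bool" where
  "alg_free K B \<longleftrightarrow> (\<forall>b\<in>B. b \<notin> alg_hull K (B - {b}))"

text \<open>Steinitz: an element of E outside B replaces one of B outside E. This keeps the size of
  B and the hull condition, and it decreases \<open>card (E - B)\<close>.\<close>

lemma alg_free_card_le:
  assumes E: "alg_free K E" "finite E" and "finite B" "E \<subseteq> alg_hull K B"
  shows "card E \<le> card B"
  using assms(3,4)
proof (induction "card (E - B)" arbitrary: B rule: less_induct)
  case less
  show ?case
  proof (cases "E \<subseteq> B")
    case True
    then show ?thesis using less.prems card_mono by blast
  next
    case False
    then obtain x where x: "x \<in> E" "x \<notin> B" by blast
    have xn: "x \<notin> alg_hull K (E \<inter> B)"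
      using E(1) x alg_hull_mono[of "E \<inter> B" "E - {x}" K] unfolding alg_free_def by blast
    \<comment> \<open>Elements of B are added to E \<inter> B one at a time until x becomes
      algebraic. The last one added is the b to be exchanged; it lies outside E because E \<inter> B
      is contained in C.\<close>
    have chain: "\<exists>C b. C \<subseteq> B \<and> b \<in> B - C \<and> E \<inter> B \<subseteq> C \<and> x \<notin> alg_hull K C \<and> x \<in> alg_hull K (insert b C)"
      if "E \<inter> B \<subseteq> C" "C \<subseteq> B" "x \<notin> alg_hull K C" for C
      using that
    proof (induction "card (B - C)" arbitrary: C rule: less_induct)
      case inner: less
      have "C \<noteq> B" using inner.prems x less.prems by blast
      then obtain b where b: "b \<in> B - C" using inner.prems by blast
      show ?case
      proof (cases "x \<in> alg_hull K (insert b C)")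
        case True
        then show ?thesis using b inner.prems by blast
      next
        case False
        have "card (B - insert b C) < card (B - C)"
          using b less.prems by (intro psubset_card_mono) auto
        then show ?thesis
          by (rule inner.hyps) (use inner.prems b False in auto)
      qed
    qed
    obtain C b where C: "C \<subseteq> B" "b \<in> B - C" "E \<inter> B \<subseteq> C" "x \<notin> alg_hull K C"
        "x \<in> alg_hull K (insert b C)"
      using chain[OF order_refl Int_lower2 xn] by metis
    define B' where "B' = insert x (B - {b})"
    have "b \<in> alg_hull K (insert x C)" using alg_hull_exchange C by blast
    then have "b \<in> alg_hull K B'"
      using alg_hull_mono[of "insert x C" B' K] C unfolding B'_def by blast
    then have "B \<subseteq> alg_hull K B'" using gens_subset_hull[of B' K] unfolding B'_def by blast
    then have "E \<subseteq> alg_hull K B'" using alg_hull_least less.prems by blast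
    moreover have "card (E - B') < card (E - B)"
      using E(2) x C unfolding B'_def by (intro psubset_card_mono) auto
    moreover have "finite B'" "card B' = card B"
      using less.prems x C(2) unfolding B'_def by (auto simp: card_Suc_Diff1 simp del: card_Diff_singleton card_Diff_insert)
    ultimately show ?thesis using less.hyps[of B'] by simp
  qed
qed

text \<open>If some b were algebraic over the rest of B, then E would be algebraic over fewer than
  \<open>card E\<close> elements.\<close>

lemma alg_free_exchange:
  assumes E: "alg_free K E" "finite E" and B: "finite B" "E \<subseteq> alg_hull K B" "card B \<le> card E"
  shows "alg_free K B" "card B = card E"
proof -
  show "card B = card E" using alg_free_card_le[OF E B(1,2)] B(3) by simp
  show "alg_free K B"
    unfolding alg_free_def
  proof (intro ballI notI)
    fix b assume b: "b \<in> B" "b \<in> alg_hull K (B - {b})"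
    then have "B \<subseteq> alg_hull K (B - {b})" using gens_subset_hull[of "B - {b}" K] by blast
    then have "E \<subseteq> alg_hull K (B - {b})" using alg_hull_least B(2) by blast
    then have "card E \<le> card (B - {b})" using alg_free_card_le[OF E] B(1) by blast
    moreover have "card (B - {b}) < card B" using b(1) B(1) by (intro psubset_card_mono) auto
    ultimately show False using B(3) by linarith
  qed
qed

text \<open>Induction on the variables: collected in powers of b, the relation has coefficients in
  K(V), over which b is transcendental, so each coefficient vanishes separately. Exponents are
  functions on the whole type, and only their restrictions to V distinguish monomials; hence the
  injectivity assumption.\<close>

lemma alg_free_monomials:
  fixes M :: "('f::field \<Rightarrow> nat) set"
  assumes B: "alg_free K B" and V: "finite V" "V \<subseteq> B" and M: "finite M" "inj_on (\<lambda>m. restrict m V) M"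
    and c: "\<And>m. m \<in> M \<Longrightarrow> c m \<in> K" and s: "(\<Sum>m\<in>M. c m * (\<Prod>i\<in>V. i ^ m i)) = 0"
  shows "\<forall>m\<in>M. c m = 0"
  using V M c s
proof (induction V arbitrary: M rule: finite_induct)
  case empty
  have "m = m'" if "m \<in> M" "m' \<in> M" for m m' using inj_onD[OF empty.prems(3) _ that] by simp
  then have "\<exists>m. M \<subseteq> {m}" by (cases "M = {}") blast+
  then obtain m where "M \<subseteq> {m}" by blast
  then show ?case using empty.prems(5) by (cases "M = {}") (auto simp: subset_singleton_iff)
next
  case (insert b V)
  define Q where "Q = (\<Sum>m\<in>M. monom (c m * (\<Prod>i\<in>V. i ^ m i)) (m b))"
  have cQ: "coeff Q j = (\<Sum>m\<in>{m\<in>M. m b = j}. c m * (\<Prod>i\<in>V. i ^ m i))" for j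
    unfolding Q_def coeff_sum coeff_monom using insert.prems(2) by (simp add: sum.inter_filter)
  have "poly Q b = 0"
    using insert.prems(5) insert.hyps unfolding Q_def
    by (simp add: poly_sum poly_monom mult_ac)
  moreover have "coeff Q j \<in> field_adjoin K V" for j
    unfolding cQ using insert.prems(4) adjoin_base[of K V] adjoin_gens[of V K]
    by (intro sfield_closed sfield_adjoin) auto
  moreover have "b \<notin> alg_hull K V"
    using B insert.prems(1) insert.hyps alg_hull_mono[of V "B - {b}" K] unfolding alg_free_def by blast
  ultimately have "Q = 0" unfolding alg_hull_def algebraic_over_def by blast
  have "\<forall>m\<in>{m\<in>M. m b = j}. c m = 0" for j
  proof (rule insert.IH)
    show "inj_on (\<lambda>m. restrict m V) {m\<in>M. m b = j}"
    proof (rule inj_onI)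
      fix m m' assume m: "m \<in> {m\<in>M. m b = j}" "m' \<in> {m\<in>M. m b = j}" "restrict m V = restrict m' V"
      have "restrict m (insert b V) = restrict m' (insert b V)"
      proof
        fix v show "restrict m (insert b V) v = restrict m' (insert b V) v"
        proof (cases "v \<in> V")
          case True
          then have "m v = m' v" using fun_cong[OF m(3), of v] by simp
          then show ?thesis by (simp add: restrict_def)
        next
          case False
          then show ?thesis using m(1,2) by (simp add: restrict_def)
        qed
      qed
      then show "m = m'" using inj_onD[OF insert.prems(3), of m m'] m(1,2) by simp
    qed
    show "(\<Sum>m\<in>{m\<in>M. m b = j}. c m * (\<Prod>i\<in>V. i ^ m i)) = 0"
      using \<open>Q = 0\<close> cQ[of j] by simp
  qed (use insert.prems in auto)
  then show ?case by blast
qed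

lemma alg_free_imp_algebraically_independent:
  assumes "alg_free K B" "finite B"
  shows "algebraically_independent K B"
  unfolding algebraically_independent_def
proof (intro allI impI)
  fix p :: "('a, 'a) mvpoly"
  assume "(\<forall>m\<in>Poly_Mapping.keys p. Poly_Mapping.lookup p m \<in> K \<and> Poly_Mapping.keys m \<subseteq> B) \<and> mveval (\<lambda>c. c) (\<lambda>b. b) p = 0"
  then have p: "\<And>m. m \<in> Poly_Mapping.keys p \<Longrightarrow> Poly_Mapping.lookup p m \<in> K"
      "\<And>m. m \<in> Poly_Mapping.keys p \<Longrightarrow> Poly_Mapping.keys m \<subseteq> B" "mveval (\<lambda>c. c) (\<lambda>b. b) p = 0"
    by auto
  have inj: "inj_on (Poly_Mapping.lookup :: ('a \<Rightarrow>\<^sub>0 nat) \<Rightarrow> 'a \<Rightarrow> nat) (Poly_Mapping.keys p)" by (simp add: inj_on_def lookup_inject)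
  have "\<forall>m\<in>Poly_Mapping.lookup ` Poly_Mapping.keys p. Poly_Mapping.lookup p (Poly_Mapping.Abs_poly_mapping m) = 0"
  proof (rule alg_free_monomials[OF assms(1) assms(2) order_refl])
    show "inj_on (\<lambda>m. restrict m B) (Poly_Mapping.lookup ` Poly_Mapping.keys p)"
    proof (rule inj_onI, clarify)
      fix m m' assume m: "m \<in> Poly_Mapping.keys p" "m' \<in> Poly_Mapping.keys p" "restrict (Poly_Mapping.lookup m) B = restrict (Poly_Mapping.lookup m') B"
      show "Poly_Mapping.lookup m = Poly_Mapping.lookup m'"
      proof
        fix v show "Poly_Mapping.lookup m v = Poly_Mapping.lookup m' v"
        proof (cases "v \<in> B")
          case True
          then show ?thesis using fun_cong[OF m(3), of v] by simp
        next
          case False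
          then have "v \<notin> Poly_Mapping.keys m" "v \<notin> Poly_Mapping.keys m'" using p(2) m(1,2) by blast+
          then show ?thesis by (simp add: in_keys_iff)
        qed
      qed
    qed
    have "(\<Sum>m\<in>Poly_Mapping.lookup ` Poly_Mapping.keys p. Poly_Mapping.lookup p (Poly_Mapping.Abs_poly_mapping m) * (\<Prod>i\<in>B. i ^ m i))
        = (\<Sum>m\<in>Poly_Mapping.keys p. Poly_Mapping.lookup p m * (\<Prod>i\<in>B. i ^ Poly_Mapping.lookup m i))"
      by (subst sum.reindex[OF inj]) (simp add: lookup_inverse)
    also have "\<dots> = mveval (\<lambda>c. c) (\<lambda>b. b) p"
      unfolding mveval_def mvmon_def[symmetric]
      using p(2) assms(2) by (intro sum.cong) (auto simp: mvmon_superset)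
    finally show "(\<Sum>m\<in>Poly_Mapping.lookup ` Poly_Mapping.keys p. Poly_Mapping.lookup p (Poly_Mapping.Abs_poly_mapping m) * (\<Prod>i\<in>B. i ^ m i)) = 0"
      using p(3) by simp
  qed (use p(1) in \<open>auto simp: lookup_inverse\<close>)
  then have "Poly_Mapping.lookup p m = 0" if "m \<in> Poly_Mapping.keys p" for m
    using that by (auto simp: lookup_inverse)
  then show "p = 0" by (metis in_keys_iff keys_eq_empty equals0I)
qed

lemma lookup_mult_single:
  fixes p :: "('v, 'a::comm_ring_1) mvpoly"
  shows "Poly_Mapping.lookup (p * Poly_Mapping.single k c) (m + k) = Poly_Mapping.lookup p m * c"
  by (induction p rule: mvpoly_induct)
    (auto simp: distrib_right lookup_add mult_single lookup_single when_def)

text \<open>After clearing denominators, an equation for the variable over the other ones reads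
  \<open>(\<Sum>j\<le>n. q j * mvvar i ^ j) = 0\<close> with \<open>q j\<close> free of that
  variable. Comparing monomials forces the leading \<open>q n\<close> to vanish.\<close>

lemma alg_free_rf_var: "alg_free (rf_constants :: 'k::field ratfun set) (rf_var ` I)"
  unfolding alg_free_def
proof (clarify)
  fix i assume "(rf_var i :: 'k ratfun) \<in> alg_hull rf_constants (rf_var ` I - {rf_var i})"
  then obtain p where p: "p \<noteq> 0" "poly p (rf_var i) = 0"
     "\<And>j. coeff p j \<in> field_adjoin (rf_constants :: 'k ratfun set) (rf_var ` I - {rf_var i})"
    unfolding alg_hull_def algebraic_over_def by blast
  define P where "P = {q :: (nat, 'k) mvpoly. \<forall>m\<in>Poly_Mapping.keys q. Poly_Mapping.lookup m i = 0}"
  have Pmult: "q * r \<in> P" if "q \<in> P" "r \<in> P" for q r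
    using that keys_mult[of q r] unfolding P_def by (fastforce simp: lookup_add)
  have Padd: "q + r \<in> P" if "q \<in> P" "r \<in> P" for q r
    using that keys_add[of q r] unfolding P_def by auto
  have Pminus: "- q \<in> P" if "q \<in> P" for q
    using that unfolding P_def by simp
  define A where "A = (to_fract ` P :: 'k ratfun set)"
  have A: "sring A"
    unfolding sring_def
  proof (intro conjI ballI)
    show "1 \<in> A" unfolding A_def P_def by (rule image_eqI[of _ _ 1]) auto
    fix x y assume "x \<in> A" "y \<in> A"
    then obtain q r where qr: "x = to_fract q" "y = to_fract r" "q \<in> P" "r \<in> P" unfolding A_def by blast
    show "x + y \<in> A" unfolding A_def by (rule image_eqI[of _ _ "q + r"]) (use qr Padd in simp_all)
    show "x * y \<in> A" unfolding A_def by (rule image_eqI[of _ _ "q * r"]) (use qr Pmult in simp_all)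
    show "- x \<in> A" unfolding A_def by (rule image_eqI[of _ _ "- q"]) (use qr Pminus in \<open>simp_all add: to_fract_def\<close>)
  qed
  have "rf_constants \<subseteq> A"
    unfolding rf_constants_def rf_const_def mvconst_def A_def P_def by (auto split: if_splits)
  moreover have "rf_var ` I - {rf_var i} \<subseteq> A"
    by (auto simp: rf_var_def mvvar_def lookup_single when_def A_def P_def)
  ultimately have fr: "field_adjoin rf_constants (rf_var ` I - {rf_var i}) \<subseteq> {a / b |a b. a \<in> A \<and> b \<in> A \<and> b \<noteq> 0}"
    using A by (intro adjoin_fractions)
  define n where "n = degree p"
  obtain d where d: "d \<noteq> 0" "\<And>j. j \<le> n \<Longrightarrow> d * coeff p j \<in> A"
    using common_denominator[OF A, of "{..n}" "coeff p"] p(3) fr by blast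
  have "\<forall>j. \<exists>q. j \<le> n \<longrightarrow> d * coeff p j = to_fract q \<and> q \<in> P"
    using d(2) unfolding A_def by blast
  then obtain q where q: "\<And>j. j \<le> n \<Longrightarrow> d * coeff p j = to_fract (q j)" "\<And>j. j \<le> n \<Longrightarrow> q j \<in> P"
    by metis
  have tf_sum: "to_fract (sum f J) = (\<Sum>j\<in>J. to_fract (f j))" for f :: "nat \<Rightarrow> (nat, 'k) mvpoly" and J
    by (induction J rule: infinite_finite_induct) auto
  have tf_pow: "to_fract (x ^ j) = to_fract x ^ j" for x :: "(nat, 'k) mvpoly" and j
    by (induction j) auto
  have "to_fract (\<Sum>j\<le>n. q j * mvvar i ^ j) = (\<Sum>j\<le>n. d * coeff p j * rf_var i ^ j)"
    unfolding tf_sum using q(1) by (intro sum.cong) (auto simp: tf_pow rf_var_def)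
  also have "\<dots> = d * poly p (rf_var i)"
    unfolding poly_altdef n_def by (simp add: sum_distrib_left mult_ac)
  finally have "to_fract (\<Sum>j\<le>n. q j * mvvar i ^ j) = 0" using p(2) by (simp only: mult_zero_right)
  then have z: "(\<Sum>j\<le>n. q j * mvvar i ^ j) = 0" by (simp only: to_fract_eq_0_iff)
  have "Poly_Mapping.lookup (q n) m = 0" for m
  proof (cases "Poly_Mapping.lookup m i = 0")
    case True': True
    \<comment> \<open>For m free of the i-th variable, the monomial with exponent m plus n times
      that variable can come only from the summand j = n.\<close>
    have l: "Poly_Mapping.lookup (q j * mvvar i ^ j) (m + Poly_Mapping.single i n) = (if j = n then Poly_Mapping.lookup (q n) m else 0)"
      if j: "j \<le> n" for j
    proof (cases "j = n")
      case True
      then show ?thesis by (simp add: mvvar_power lookup_mult_single)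
    next
      case False
      have "m + Poly_Mapping.single i n \<notin> Poly_Mapping.keys (q j * mvvar i ^ j)"
      proof
        assume "m + Poly_Mapping.single i n \<in> Poly_Mapping.keys (q j * mvvar i ^ j)"
        then obtain a where "a \<in> Poly_Mapping.keys (q j)" "m + Poly_Mapping.single i n = a + Poly_Mapping.single i j"
          using keys_mult[of "q j" "mvvar i ^ j"] by (auto simp: mvvar_power)
        then have "Poly_Mapping.lookup (m + Poly_Mapping.single i n) i = Poly_Mapping.lookup (a + Poly_Mapping.single i j) i"
            "Poly_Mapping.lookup a i = 0"
          using q(2)[OF j] by (auto simp: P_def)
        then show False using True' False by (simp add: lookup_add)
      qed
      then show ?thesis using False by (simp add: in_keys_iff)
    qed
    have "0 = Poly_Mapping.lookup (\<Sum>j\<le>n. q j * mvvar i ^ j) (m + Poly_Mapping.single i n)" using z by simp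
    also have "\<dots> = (\<Sum>j\<le>n. Poly_Mapping.lookup (q j * mvvar i ^ j) (m + Poly_Mapping.single i n))"
      by (simp add: lookup_sum)
    also have "\<dots> = (\<Sum>j\<le>n. if j = n then Poly_Mapping.lookup (q n) m else 0)" using l by (intro sum.cong) auto
    finally show ?thesis by simp
  next
    case False
    then have "m \<notin> Poly_Mapping.keys (q n)" using q(2)[of n] by (auto simp: P_def)
    then show ?thesis by (simp add: in_keys_iff)
  qed
  then have "q n = 0" by (simp add: poly_mapping_eqI)
  then show False using q(1)[of n] d(1) p(1) n_def by auto
qed

section \<open>Field homomorphisms and invariants\<close>

definition field_hom :: "('f::field \<Rightarrow> 'g::field) \<Rightarrow> bool" where
  "field_hom \<tau> \<longleftrightarrow> \<tau> 1 = 1 \<and> (\<forall>x y. \<tau> (x + y) = \<tau> x + \<tau> y \<and> \<tau> (x * y) = \<tau> x * \<tau> y)"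

context
  fixes \<tau> :: "'f::field \<Rightarrow> 'g::field"
  assumes \<tau>: "field_hom \<tau>"
begin

lemma hom_1: "\<tau> 1 = 1"
  and hom_add: "\<tau> (x + y) = \<tau> x + \<tau> y"
  and hom_mult: "\<tau> (x * y) = \<tau> x * \<tau> y"
  using \<tau> by (auto simp: field_hom_def)

lemma hom_0: "\<tau> 0 = 0"
  using hom_add[of 0 0] by (metis add.right_neutral add_left_cancel)

lemma hom_uminus: "\<tau> (- x) = - \<tau> x"
  using hom_add[of x "- x"] hom_0 by (simp add: eq_neg_iff_add_eq_0 add.commute)

lemma hom_diff: "\<tau> (x - y) = \<tau> x - \<tau> y"
  using hom_add[of x "- y"] hom_uminus[of y] by simp

lemma hom_sum: "\<tau> (sum f A) = (\<Sum>i\<in>A. \<tau> (f i))"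
  by (induction A rule: infinite_finite_induct) (auto simp: hom_0 hom_add)

lemma hom_prod: "\<tau> (prod f A) = (\<Prod>i\<in>A. \<tau> (f i))"
  by (induction A rule: infinite_finite_induct) (auto simp: hom_1 hom_mult)

lemma hom_power: "\<tau> (x ^ n) = \<tau> x ^ n"
  by (induction n) (auto simp: hom_1 hom_mult)

lemma hom_of_nat: "\<tau> (of_nat n) = of_nat n"
  by (induction n) (auto simp: hom_1 hom_add hom_0)

lemma hom_eq_0_iff: "\<tau> x = 0 \<longleftrightarrow> x = 0"
proof
  assume "\<tau> x = 0"
  then have "\<tau> (x * inverse x) = 0" by (simp add: hom_mult)
  then show "x = 0" using hom_1 by (cases "x = 0") auto
qed (simp add: hom_0)

lemma hom_inverse: "\<tau> (inverse x) = inverse (\<tau> x)"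
proof (cases "x = 0")
  case False
  then have "\<tau> x * \<tau> (inverse x) = 1" by (simp add: hom_mult[symmetric] hom_1)
  then show ?thesis by (metis inverse_unique)
qed (simp add: hom_0)

lemma hom_divide: "\<tau> (x / y) = \<tau> x / \<tau> y"
  by (simp add: divide_inverse hom_mult hom_inverse)

lemma hom_poly: "\<tau> (poly p x) = poly (map_poly \<tau> p) (\<tau> x)"
  by (induction p) (auto simp: hom_0 hom_add hom_mult map_poly_pCons)

lemmas hom_simps = hom_0 hom_1 hom_add hom_mult hom_uminus hom_diff hom_sum hom_prod hom_power
  hom_of_nat hom_inverse hom_divide

end

lemma hom_funpow: "field_hom \<tau> \<Longrightarrow> field_hom (\<tau> ^^ n)" for \<tau> :: "'f::field \<Rightarrow> 'f"
  by (induction n) (auto simp: field_hom_def)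

lemma sfield_fixed: "field_hom \<tau> \<Longrightarrow> sfield {x. \<tau> x = x}"
  by (auto simp: sfield_def sring_def hom_simps)

lemma hom_fixes_adjoin:
  assumes "field_hom \<tau>" "\<And>x. x \<in> K \<Longrightarrow> \<tau> x = x" "\<And>x. x \<in> S \<Longrightarrow> \<tau> x = x" "x \<in> field_adjoin K S"
  shows "\<tau> x = x"
  using adjoin_least[OF sfield_fixed[OF assms(1)], of K S] assms by blast

lemma funpow_fixes: "\<tau> x = x \<Longrightarrow> (\<tau> ^^ n) x = x" for \<tau> :: "'a \<Rightarrow> 'a"
  by (induction n) auto

text \<open>The inverse of \<open>b\<close> is obtained from its norm, which is invariant and hence lies in the field of
  invariants.\<close>

lemma sfield_if_invariants_sfield:
  assumes R: "sring R" and F0: "sfield F0" "F0 \<subseteq> R" and \<tau>: "field_hom \<tau>" "\<And>x. x \<in> R \<Longrightarrow> \<tau> x \<in> R"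
    and N: "N > 0" "\<And>x. x \<in> R \<Longrightarrow> (\<tau> ^^ N) x = x"
    and inv: "\<And>x. x \<in> R \<Longrightarrow> \<tau> x = x \<Longrightarrow> x \<in> F0"
  shows "sfield R"
  unfolding sfield_def
proof (intro conjI ballI R)
  fix b assume b: "b \<in> R"
  have pow: "(\<tau> ^^ i) b \<in> R" for i using b \<tau>(2) by (induction i) auto
  define n where "n = (\<Prod>i<N. (\<tau> ^^ i) b)"
  have "\<tau> n = (\<Prod>i<N. (\<tau> ^^ Suc i) b)" unfolding n_def using \<tau>(1) by (simp add: hom_prod)
  moreover have "(\<Prod>i<N. (\<tau> ^^ Suc i) b) * b = n * (\<tau> ^^ N) b"
    unfolding n_def using prod.lessThan_Suc_shift[of "\<lambda>i. (\<tau> ^^ i) b" N] prod.lessThan_Suc[of "\<lambda>i. (\<tau> ^^ i) b" N]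
    by (simp add: mult_ac)
  ultimately have "\<tau> n = n" if "b \<noteq> 0" using that N(2)[OF b] by simp
  moreover have nR: "n \<in> R" unfolding n_def by (intro sring_prod R pow)
  ultimately have inF: "inverse n \<in> R" if "b \<noteq> 0" using that inv F0 sfield_inverse by blast
  have n: "n = b * (\<Prod>i\<in>{1..<N}. (\<tau> ^^ i) b)"
    unfolding n_def using N(1) by (subst lessThan_atLeast0, subst prod.atLeast_Suc_lessThan) auto
  have "n \<noteq> 0" if "b \<noteq> 0"
    unfolding n_def using that hom_eq_0_iff[OF hom_funpow[OF \<tau>(1)]] by simp
  then have "inverse b = inverse n * (\<Prod>i\<in>{1..<N}. (\<tau> ^^ i) b)" if "b \<noteq> 0"
    using that unfolding n by simp
  moreover have "inverse n * (\<Prod>i\<in>{1..<N}. (\<tau> ^^ i) b) \<in> R" if "b \<noteq> 0"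
    using inF that pow by (intro sring_mult R sring_prod) auto
  ultimately show "inverse b \<in> R" by (cases "b = 0") (use sring_0[OF R] in auto)
qed

text \<open>An invariant of F0[\<theta>] is p(\<theta>) with p of degree below n. It is the value of
  p at all n distinct conjugates of \<theta>, so p is constant. No irreducibility is involved.
  Knowing the invariants of the ring F0[\<theta>] then shows, through norms, that this ring is a
  field and thus contains F0(\<theta>).\<close>

lemma adjoin_single_invariant:
  assumes F0: "sfield F0" and \<tau>: "field_hom \<tau>" "\<And>x. x \<in> F0 \<Longrightarrow> \<tau> x = x"
    and \<tau>\<theta>: "\<tau> \<theta> = poly q \<theta>" "\<And>i. coeff q i \<in> F0"
    and N: "N > 0" "(\<tau> ^^ N) \<theta> = \<theta>"
    and rel: "\<theta> ^ n = (\<Sum>i<n. a i * \<theta> ^ i)" "\<And>i. i < n \<Longrightarrow> a i \<in> F0"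
    and conj: "inj_on (\<lambda>i. (\<tau> ^^ i) \<theta>) {..<n}" "n > 0"
    and f: "f \<in> field_adjoin F0 {\<theta>}" "\<tau> f = f"
  shows "f \<in> F0"
proof -
  let ?R = "{poly p \<theta> |p. \<forall>i. coeff p i \<in> F0}"
  note F0r = sfield_sring[OF F0]
  have R: "sring ?R" by (rule sring_poly_values[OF F0r])
  have I: "poly p \<theta> \<in> ?R" if "\<And>i. coeff p i \<in> F0" for p using that by blast
  have F0R: "F0 \<subseteq> ?R"
  proof
    fix c assume "c \<in> F0"
    then show "c \<in> ?R" using I[of "[:c:]"] F0r by (auto simp: coeff_pCons sring_closed split: nat.splits)
  qed
  have \<theta>R: "\<theta> \<in> ?R" using I[of "[:0, 1:]"] F0r by (auto simp: coeff_pCons sring_closed split: nat.splits)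
  have \<tau>poly: "\<tau> (poly p \<theta>) = poly p (\<tau> \<theta>)" if "\<And>i. coeff p i \<in> F0" for p
  proof -
    have "map_poly \<tau> p = p" using \<tau> that by (intro poly_eqI) (simp add: coeff_map_poly hom_0)
    then show ?thesis using hom_poly[OF \<tau>(1), of p \<theta>] by simp
  qed
  have span: "\<exists>c. (\<forall>i. c i \<in> F0) \<and> poly p \<theta> = (\<Sum>i<n. c i * \<theta> ^ i)" if "\<And>i. coeff p i \<in> F0" for p
    using that
  proof (induction p)
    case 0
    show ?case using F0r by (intro exI[of _ "\<lambda>_. 0"]) (auto simp: sring_closed)
  next
    case (pCons b p)
    have "coeff p i \<in> F0" for i using pCons.prems[of "Suc i"] by simp
    then obtain c where c: "\<And>i. c i \<in> F0" "poly p \<theta> = (\<Sum>i<n. c i * \<theta> ^ i)" using pCons.IH by blast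
    obtain m where m: "n = Suc m" using conj(2) by (cases n) auto
    \<comment> \<open>Multiplication by \<theta> shifts the coefficients and \<open>b\<close> fills
      position 0; the overflowing top coefficient \<open>c m\<close> is folded back by means of
      \<open>rel\<close>.\<close>
    define d where "d i = (if i < n then (if i = 0 then b else c (i - 1)) + c m * a i else 0)" for i
    have "poly (pCons b p) \<theta> = b + \<theta> * (\<Sum>i<m. c i * \<theta> ^ i) + c m * \<theta> ^ n"
      using c(2) m by (simp add: algebra_simps)
    also have "\<dots> = (b + (\<Sum>i<m. c i * \<theta> ^ Suc i)) + (\<Sum>i<n. c m * a i * \<theta> ^ i)"
      unfolding rel(1) by (simp add: sum_distrib_left mult_ac)
    also have "b + (\<Sum>i<m. c i * \<theta> ^ Suc i) = (\<Sum>i<n. (if i = 0 then b else c (i - 1)) * \<theta> ^ i)"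
      unfolding m by (subst sum.lessThan_Suc_shift) simp
    finally have "poly (pCons b p) \<theta> = (\<Sum>i<n. d i * \<theta> ^ i)"
      unfolding d_def sum.distrib[symmetric] by (simp add: algebra_simps)
    moreover have "d i \<in> F0" for i
      using c(1) rel(2) pCons.prems[of 0] F0r unfolding d_def by (auto intro!: sring_closed)
    ultimately show ?case by blast
  qed
  have inv: "x \<in> F0" if x: "x \<in> ?R" "\<tau> x = x" for x
  proof -
    obtain c where c: "\<And>i. c i \<in> F0" "x = (\<Sum>i<n. c i * \<theta> ^ i)" using x(1) span by blast
    define p where "p = (\<Sum>i<n. monom (c i) i)"
    have cp: "coeff p i = (if i < n then c i else 0)" for i
      unfolding p_def by (simp add: coeff_sum if_distrib cong: if_cong)
    have xp: "x = poly p \<theta>" unfolding c(2) p_def by (simp add: poly_sum poly_monom)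
    have "poly p ((\<tau> ^^ i) \<theta>) = x" for i
    proof (induction i)
      case (Suc i)
      have "map_poly \<tau> p = p"
        using \<tau> c(1) sring_0[OF F0r] by (intro poly_eqI) (simp add: coeff_map_poly hom_0 cp)
      then show ?case using hom_poly[OF \<tau>(1), of p "(\<tau> ^^ i) \<theta>"] Suc x(2) by simp
    qed (simp add: xp)
    then have roots: "(\<lambda>i. (\<tau> ^^ i) \<theta>) ` {..<n} \<subseteq> {y. poly (p - [:x:]) y = 0}" by auto
    have "p - [:x:] = 0"
    proof (rule ccontr)
      assume nz: "p - [:x:] \<noteq> 0"
      have "degree (p - [:x:]) < n"
      proof (rule le_less_trans)
        show "degree (p - [:x:]) \<le> n - 1"
          using conj(2) by (intro degree_le) (auto simp: cp coeff_pCons split: nat.splits)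
      qed (use conj(2) in simp)
      moreover have "card ((\<lambda>i. (\<tau> ^^ i) \<theta>) ` {..<n}) \<le> card {y. poly (p - [:x:]) y = 0}"
        by (rule card_mono[OF poly_roots_finite[OF nz] roots])
      moreover have "card {y. poly (p - [:x:]) y = 0} \<le> degree (p - [:x:])"
        using nz by (rule card_poly_roots_bound)
      ultimately show False using card_image[OF conj(1)] by simp
    qed
    then have "coeff p 0 = x" by (metis coeff_pCons_0 eq_iff_diff_eq_0)
    then show ?thesis using cp[of 0] c(1) conj(2) by auto
  qed
  have "sfield ?R"
  proof (rule sfield_if_invariants_sfield[OF R F0 F0R \<tau>(1) _ N(1) _ inv])
    fix x assume "x \<in> ?R"
    then obtain p where p: "x = poly p \<theta>" "\<And>i. coeff p i \<in> F0" by blast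
    have "\<tau> \<theta> \<in> ?R" unfolding \<tau>\<theta>(1) by (rule I) (rule \<tau>\<theta>(2))
    then show "\<tau> x \<in> ?R" unfolding p(1) \<tau>poly[OF p(2)]
      using p(2) F0R by (intro sring_poly[OF R]) blast+
    have "map_poly (\<tau> ^^ N) p = p"
      using funpow_fixes[of \<tau>] \<tau> p(2) by (intro poly_eqI) (simp add: coeff_map_poly hom_0[OF hom_funpow])
    then show "(\<tau> ^^ N) x = x" unfolding p(1) using hom_poly[OF hom_funpow[OF \<tau>(1)], of N p \<theta>] N(2) by simp
  qed
  then have "field_adjoin F0 {\<theta>} \<subseteq> ?R" using F0R \<theta>R by (intro adjoin_least) auto
  then show ?thesis using f inv by blast
qed

section \<open>Polynomials modulo the cyclotomic polynomial\<close>

text \<open>For prime p this is the p-th cyclotomic polynomial. It is not assumed irreducible over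
  the field, so the quotient is treated as a ring only.\<close>

definition cyc :: "nat \<Rightarrow> 'f::field poly" where
  "cyc p = (\<Sum>i<p. monom 1 i)"

definition cyc_cong :: "nat \<Rightarrow> 'f::field poly \<Rightarrow> 'f poly \<Rightarrow> bool" where
  "cyc_cong p P Q \<longleftrightarrow> [P = Q] (mod cyc p)"

lemma ccong_iff_dvd: "cyc_cong p P Q \<longleftrightarrow> cyc p dvd P - Q"
  by (simp add: cyc_cong_def cong_iff_dvd_diff)

lemma ccong_0_iff: "cyc_cong p P 0 \<longleftrightarrow> cyc p dvd P"
  by (simp add: ccong_iff_dvd)

lemma ccong_refl [simp, intro]: "cyc_cong p P P"
  and ccong_sym: "cyc_cong p P Q \<Longrightarrow> cyc_cong p Q P"
  and ccong_trans [trans]: "cyc_cong p P Q \<Longrightarrow> cyc_cong p Q R \<Longrightarrow> cyc_cong p P R"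
  and ccong_add: "cyc_cong p P Q \<Longrightarrow> cyc_cong p P' Q' \<Longrightarrow> cyc_cong p (P + P') (Q + Q')"
  and ccong_mult: "cyc_cong p P Q \<Longrightarrow> cyc_cong p P' Q' \<Longrightarrow> cyc_cong p (P * P') (Q * Q')"
  and ccong_pow: "cyc_cong p P Q \<Longrightarrow> cyc_cong p (P ^ k) (Q ^ k)"
  and ccong_sum: "(\<And>i. i \<in> I \<Longrightarrow> cyc_cong p (F i) (G i)) \<Longrightarrow> cyc_cong p (sum F I) (sum G I)"
  and ccong_prod: "(\<And>i. i \<in> I \<Longrightarrow> cyc_cong p (F i) (G i)) \<Longrightarrow> cyc_cong p (prod F I) (prod G I)"
  and ccong_eq_trans [trans]: "P = Q \<Longrightarrow> cyc_cong p Q R \<Longrightarrow> cyc_cong p P R"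
  and eq_ccong_trans [trans]: "cyc_cong p P Q \<Longrightarrow> Q = R \<Longrightarrow> cyc_cong p P R"
  unfolding cyc_cong_def
  by (auto intro: cong_sym cong_trans cong_add cong_mult cong_pow cong_sum cong_prod)

text \<open>The substitution t -> t^r. Modulo \<open>cyc p\<close> and for r prime to p it plays the
  role of a Galois automorphism of the p-th roots of unity.\<close>

definition subst_pow :: "nat \<Rightarrow> 'f::field poly \<Rightarrow> 'f poly" where
  "subst_pow r P = pcompose P (monom 1 r)"

lemma subst_pow_add: "subst_pow r (P + Q) = subst_pow r P + subst_pow r Q"
  and subst_pow_diff: "subst_pow r (P - Q) = subst_pow r P - subst_pow r Q"
  and subst_pow_mult: "subst_pow r (P * Q) = subst_pow r P * subst_pow r Q"
  and subst_pow_smult: "subst_pow r (smult a P) = smult a (subst_pow r P)"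
  and subst_pow_const: "subst_pow r [:a:] = [:a:]"
  and subst_pow_1: "subst_pow r 1 = 1"
  and subst_pow_0: "subst_pow r 0 = 0"
  by (simp_all add: subst_pow_def pcompose_add pcompose_diff pcompose_mult pcompose_smult one_pCons)

lemma smult_sum_right: "smult a (sum f A) = (\<Sum>i\<in>A. smult a (f i))"
  by (induction A rule: infinite_finite_induct) (auto simp: smult_add_right)

lemma subst_pow_sum: "subst_pow r (sum f A) = (\<Sum>i\<in>A. subst_pow r (f i))"
  by (induction A rule: infinite_finite_induct) (auto simp: subst_pow_add subst_pow_0)

lemma subst_pow_prod: "subst_pow r (prod f A) = (\<Prod>i\<in>A. subst_pow r (f i))"
  by (induction A rule: infinite_finite_induct) (auto simp: subst_pow_mult subst_pow_1)

lemma subst_pow_power: "subst_pow r (P ^ k) = subst_pow r P ^ k"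
  by (induction k) (auto simp: subst_pow_mult subst_pow_1)

lemma monom_power': "monom (1 :: 'f::field) r ^ k = monom 1 (r * k)"
  by (simp add: monom_power)

lemma subst_pow_monom: "subst_pow r (monom a i) = monom a (r * i)"
proof -
  have eq: "monom a i = smult a (monom 1 1 ^ i)"
    by (simp add: monom_power' smult_monom)
  have "subst_pow r (monom 1 1) = monom (1 :: 'a) r"
    by (simp add: subst_pow_def monom_altdef pcompose_pCons)
  then show ?thesis
    unfolding eq subst_pow_smult subst_pow_power by (simp add: monom_power' smult_monom)
qed

lemma subst_pow_subst_pow: "subst_pow r (subst_pow s P) = subst_pow (r * s) P"
proof -
  have "subst_pow r (subst_pow s (monom a i)) = subst_pow (r * s) (monom a i)" for a :: 'a and i
    by (simp add: subst_pow_monom mult_ac)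
  then show ?thesis
    by (subst (1 2) poly_as_sum_of_monoms[of P, symmetric]) (simp only: subst_pow_sum)
qed

lemma subst_pow_one: "subst_pow 1 P = P"
  by (subst (1 2) poly_as_sum_of_monoms[of P, symmetric]) (simp add: subst_pow_sum subst_pow_monom)

context
  fixes \<tau> :: "'f::field \<Rightarrow> 'f" assumes \<tau>: "field_hom \<tau>"
begin

lemma coeff_map_hom: "coeff (map_poly \<tau> P) i = \<tau> (coeff P i)"
  by (simp add: coeff_map_poly hom_0[OF \<tau>])

lemma map_hom_add: "map_poly \<tau> (P + Q) = map_poly \<tau> P + map_poly \<tau> Q"
  by (intro poly_eqI) (simp add: coeff_map_hom hom_add[OF \<tau>])

lemma map_hom_diff: "map_poly \<tau> (P - Q) = map_poly \<tau> P - map_poly \<tau> Q"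
  by (intro poly_eqI) (simp add: coeff_map_hom hom_diff[OF \<tau>])

lemma map_hom_mult: "map_poly \<tau> (P * Q) = map_poly \<tau> P * map_poly \<tau> Q"
  by (intro poly_eqI) (simp add: coeff_map_hom coeff_mult hom_mult[OF \<tau>] hom_sum[OF \<tau>])

lemma map_hom_monom: "map_poly \<tau> (monom a i) = monom (\<tau> a) i"
  by (intro poly_eqI) (simp add: coeff_map_hom hom_0[OF \<tau>])

lemma map_hom_const: "map_poly \<tau> [:a:] = [:\<tau> a:]"
  using map_hom_monom[of a 0] by (simp add: monom_0)

lemma map_hom_1: "map_poly \<tau> 1 = 1"
  using map_hom_const[of 1] hom_1[OF \<tau>] by (simp add: one_pCons)

lemma map_hom_smult: "map_poly \<tau> (smult a P) = smult (\<tau> a) (map_poly \<tau> P)"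
  by (intro poly_eqI) (simp add: coeff_map_hom hom_mult[OF \<tau>])

lemma map_hom_sum: "map_poly \<tau> (sum f A) = (\<Sum>i\<in>A. map_poly \<tau> (f i))"
  by (induction A rule: infinite_finite_induct) (auto simp: map_hom_add)

lemma map_hom_prod: "map_poly \<tau> (prod f A) = (\<Prod>i\<in>A. map_poly \<tau> (f i))"
  by (induction A rule: infinite_finite_induct) (auto simp: map_hom_mult map_hom_1)

lemma map_hom_power: "map_poly \<tau> (P ^ k) = map_poly \<tau> P ^ k"
  by (induction k) (auto simp: map_hom_mult map_hom_1)

lemma map_hom_subst_pow: "map_poly \<tau> (subst_pow r P) = subst_pow r (map_poly \<tau> P)"
  by (subst (1 2) poly_as_sum_of_monoms[of P, symmetric])
    (simp add: subst_pow_sum subst_pow_monom map_hom_sum map_hom_monom)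

lemma map_hom_cong: "cyc_cong p P Q \<Longrightarrow> cyc_cong p (map_poly \<tau> P) (map_poly \<tau> Q)"
proof -
  have "map_poly \<tau> (cyc p) = cyc p"
    by (simp add: cyc_def map_hom_sum map_hom_monom hom_1[OF \<tau>])
  moreover assume "cyc_cong p P Q"
  ultimately show ?thesis
    by (auto simp: ccong_iff_dvd map_hom_diff[symmetric] map_hom_mult elim!: dvdE)
qed

end

lemma bij_betw_Suc_mod:
  fixes p :: nat
  assumes "p > 0"
  shows "bij_betw (\<lambda>i. Suc i mod p) {..<p} {..<p}"
proof -
  have "inj_on (\<lambda>i. Suc i mod p) {..<p}"
    by (intro inj_onI) (auto simp: mod_Suc split: if_splits)
  moreover have "(\<lambda>i. Suc i mod p) ` {..<p} \<subseteq> {..<p}" using assms by auto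
  ultimately show ?thesis by (simp add: bij_betw_def endo_inj_surj)
qed

section \<open>The quotient by the cyclotomic polynomial of a prime\<close>

locale prime_cyc =
  fixes p :: nat
  assumes prime: "prime p"
begin

lemma p_gt_1: "p > 1" and p_pos: "p > 0"
  using prime prime_gt_1_nat prime_gt_0_nat by auto

abbreviation cc :: "'f::field poly \<Rightarrow> 'f poly \<Rightarrow> bool" (infix \<open>\<approx>\<close> 50) where
  "P \<approx> Q \<equiv> cyc_cong p P Q"

abbreviation T :: "nat \<Rightarrow> 'f::field poly" where "T \<equiv> monom 1"

lemma T_mult: "T a * T b = T (a + b)" by (simp add: mult_monom)

lemma cc_T_p: "T p \<approx> (1 :: 'f::field poly)"
proof -
  have "T p - 1 = (T 1 - 1) * (cyc p :: 'f poly)"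
    using power_diff_1_eq[of "T 1 :: 'f poly" p] by (simp add: cyc_def monom_power')
  then show ?thesis by (simp add: ccong_iff_dvd)
qed

lemma cc_T_mod: "T a \<approx> (T (a mod p) :: 'f::field poly)"
proof -
  have "(T a :: 'f poly) = T p ^ (a div p) * T (a mod p)"
    by (simp add: monom_power' T_mult)
  also have "\<dots> \<approx> 1 ^ (a div p) * T (a mod p)"
    by (intro ccong_mult ccong_pow cc_T_p ccong_refl)
  finally show ?thesis by simp
qed

lemma cc_T: "[a = b] (mod p) \<Longrightarrow> T a \<approx> (T b :: 'f::field poly)"
  using cc_T_mod[of a] cc_T_mod[of b] unfolding cong_def[of a b p] by (metis ccong_trans ccong_sym)

lemma cc_monom: "[a = b] (mod p) \<Longrightarrow> monom c a \<approx> monom (c :: 'f::field) b"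
  using ccong_mult[OF ccong_refl cc_T, of a b "[:c:]"] by (simp add: smult_monom)

lemma bij_mult_mod:
  assumes "\<not> p dvd r"
  shows "bij_betw (\<lambda>i. r * i mod p) {..<p} {..<p}" "bij_betw (\<lambda>i. r * i mod p) {1..<p} {1..<p}"
proof -
  have cop: "coprime r p" using assms prime by (simp add: coprime_commute prime_imp_coprime)
  have inj: "inj_on (\<lambda>i. r * i mod p) {..<p}"
  proof (rule inj_onI)
    fix i j assume ij: "i \<in> {..<p}" "j \<in> {..<p}" "r * i mod p = r * j mod p"
    then have "[r * i = r * j] (mod p)" by (simp add: cong_def)
    then have "[i = j] (mod p)" using cop by (simp add: cong_mult_lcancel_nat)
    then show "i = j" using ij by (simp add: cong_def)
  qed
  have "(\<lambda>i. r * i mod p) ` {..<p} = {..<p}"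
    using inj p_pos by (intro endo_inj_surj) auto
  then show *: "bij_betw (\<lambda>i. r * i mod p) {..<p} {..<p}" using inj by (simp add: bij_betw_def)
  have "bij_betw (\<lambda>i. r * i mod p) ({..<p} - {0}) ({..<p} - {0})"
    using bij_betw_DiffI[OF *, of "{0}" "{0}"] p_pos by (auto simp: bij_betw_def)
  moreover have "{..<p} - {0} = {1..<p}" by auto
  ultimately show "bij_betw (\<lambda>i. r * i mod p) {1..<p} {1..<p}" by simp
qed

text \<open>Orthogonality of characters of Z/p: for r prime to p the exponents run through all
  residues, and the sum becomes \<open>cyc p\<close>.\<close>

lemma sum_T_mult:
  "(\<Sum>i<p. T (r * i)) \<approx> (if p dvd r then of_nat p else (0 :: 'f::field poly))"
proof (cases "p dvd r")
  case True
  have "(\<Sum>i<p. T (r * i)) \<approx> (\<Sum>i<p. T 0 :: 'f poly)"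
    using True by (intro ccong_sum cc_T) (auto simp: cong_0_iff)
  then show ?thesis using True by (simp add: monom_0 one_pCons[symmetric])
next
  case False
  have "(\<Sum>i<p. T (r * i)) \<approx> (\<Sum>i<p. T (r * i mod p) :: 'f poly)"
    by (intro ccong_sum cc_T_mod)
  also have "(\<Sum>i<p. T (r * i mod p) :: 'f poly) = cyc p"
    unfolding cyc_def by (rule sum.reindex_bij_betw[OF bij_mult_mod(1)[OF False]])
  also have "cyc p \<approx> (0 :: 'f poly)" by (simp add: ccong_0_iff)
  finally show ?thesis using False by simp
qed

lemma one_cc: "1 \<approx> - (\<Sum>s\<in>{1..<p}. T s :: 'f::field poly)"
proof -
  have "cyc p = 1 + (\<Sum>s\<in>{1..<p}. T s :: 'f poly)"
    using p_pos unfolding cyc_def lessThan_atLeast0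
    by (subst sum.atLeast_Suc_lessThan) (auto simp: monom_0 one_pCons)
  then show ?thesis by (simp add: ccong_iff_dvd)
qed

text \<open>By orthogonality \<open>cyc p\<close> divides its own image under the substitution, so
  the substitution descends to the quotient.\<close>

lemma subst_pow_cong:
  assumes "\<not> p dvd r" "P \<approx> Q"
  shows "subst_pow r P \<approx> subst_pow r (Q :: 'f::field poly)"
proof -
  obtain D where D: "P - Q = cyc p * D" using assms(2) by (auto simp: ccong_iff_dvd elim: dvdE)
  have "subst_pow r (cyc p) = (\<Sum>i<p. T (r * i) :: 'f poly)"
    by (simp add: cyc_def subst_pow_sum subst_pow_monom)
  also have "\<dots> \<approx> 0" using sum_T_mult[of r] assms(1) by simp
  finally have "cyc p dvd (subst_pow r (cyc p) :: 'f poly)" by (simp add: ccong_0_iff)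
  then have "cyc p dvd subst_pow r (P - Q)" unfolding D subst_pow_mult by (rule dvd_mult2)
  then show ?thesis by (simp add: ccong_iff_dvd subst_pow_diff)
qed

lemma subst_pow_exp_cong:
  assumes "[r = s] (mod p)"
  shows "subst_pow r P \<approx> subst_pow s (P :: 'f::field poly)"
proof -
  have "subst_pow r P = (\<Sum>i\<le>degree P. monom (coeff P i) (r * i))" for r
    by (subst (1) poly_as_sum_of_monoms[of P, symmetric]) (simp add: subst_pow_sum subst_pow_monom)
  then show ?thesis
    using assms by (auto intro!: ccong_sum cc_monom cong_mult)
qed

lemma degree_cyc: "degree (cyc p :: 'f::field poly) = p - 1"
proof (rule antisym)
  have c: "coeff (cyc p :: 'f poly) i = (if i < p then 1 else 0)" for i
    by (simp add: cyc_def coeff_sum if_distrib cong: if_cong)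
  show "degree (cyc p :: 'f poly) \<le> p - 1" by (rule degree_le) (auto simp: c)
  show "p - 1 \<le> degree (cyc p :: 'f poly)" using p_pos by (intro le_degree) (simp add: c)
qed

text \<open>Coordinates in t, ..., t^(p-1) rather than 1, ..., t^(p-2): this basis is permuted by t
  -> t^r, and a constant c has all coordinates equal to -c.\<close>

definition expand :: "(nat \<Rightarrow> 'f::field) \<Rightarrow> 'f poly" where
  "expand u = (\<Sum>s\<in>{1..<p}. monom (u s) s)"

lemma expand_diff: "expand u - expand v = expand (\<lambda>s. u s - v s)"
  by (simp add: expand_def sum_subtractf diff_monom[symmetric])

lemma expand_const: "[:c:] \<approx> expand (\<lambda>_. - (c :: 'f::field))"
proof -
  have "[:c:] * 1 \<approx> [:c:] * - (\<Sum>s\<in>{1..<p}. T s)" by (intro ccong_mult ccong_refl one_cc)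
  also have "[:c:] * - (\<Sum>s\<in>{1..<p}. T s) = expand (\<lambda>_. - c)"
    by (simp add: expand_def sum_distrib_left smult_monom minus_monom[symmetric] sum_negf smult_sum_right)
  finally show ?thesis by simp
qed

text \<open>Subtracting \<open>u (p - 1)\<close> times \<open>cyc p\<close> removes the top term.
  What remains is a multiple of \<open>cyc p\<close> of smaller degree, hence zero, and its constant
  term is \<open>- u (p - 1)\<close>.\<close>

lemma expand_eq_0:
  assumes "expand u \<approx> (0 :: 'f::field poly)" "s \<in> {1..<p}"
  shows "u s = 0"
proof -
  define R where "R = expand u - smult (u (p - 1)) (cyc p)"
  have cR: "coeff R i = (if i \<in> {1..<p} then u i else 0) - (if i < p then u (p - 1) else 0)" for i
    by (simp add: R_def expand_def cyc_def coeff_sum if_distrib cong: if_cong)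
  have "cyc p dvd R" using assms(1) by (simp add: R_def ccong_0_iff dvd_diff dvd_smult)
  moreover have "degree R < p - 1 \<or> R = 0"
  proof (cases "R = 0")
    case False
    have "coeff R i = 0" if "i \<ge> p - 1" for i
      using that p_gt_1 by (cases "i = p - 1") (auto simp: cR)
    then have "degree R < p - 1"
      using False by (metis leading_coeff_0_iff linorder_not_le)
    then show ?thesis by simp
  qed simp
  ultimately have R: "R = 0" using dvd_imp_degree_le[of "cyc p" R] degree_cyc[where 'f='f] by fastforce
  then have "u (p - 1) = 0" using cR[of 0] p_pos by simp
  then show ?thesis using cR[of s] R assms(2) by simp
qed

lemma expand_eqD: "expand u \<approx> expand v \<Longrightarrow> s \<in> {1..<p} \<Longrightarrow> u s = (v s :: 'f::field)"
  using expand_eq_0[of "\<lambda>s. u s - v s" s] by (simp add: expand_diff[symmetric] ccong_iff_dvd)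

text \<open>The image of A[t] in the quotient, as a set of representatives closed under
  congruence.\<close>

definition coeffs_mod :: "'f::field set \<Rightarrow> 'f poly set" where
  "coeffs_mod A = {P. \<exists>Q. (\<forall>i. coeff Q i \<in> A) \<and> P \<approx> Q}"

lemma coeffs_modI: "(\<And>i. coeff Q i \<in> A) \<Longrightarrow> P \<approx> Q \<Longrightarrow> P \<in> coeffs_mod A"
  by (auto simp: coeffs_mod_def)

lemma coeffs_mod_cong: "P \<in> coeffs_mod A \<Longrightarrow> Q \<approx> P \<Longrightarrow> Q \<in> coeffs_mod A"
  unfolding coeffs_mod_def using ccong_trans by blast

context
  fixes A :: "'f::field set" assumes A: "sring A"
begin

lemma coeffs_mod_monom: "a \<in> A \<Longrightarrow> monom a i \<in> coeffs_mod A"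
  using A by (intro coeffs_modI[of "monom a i"]) (auto simp: sring_0)

lemma coeffs_mod_const: "a \<in> A \<Longrightarrow> [:a:] \<in> coeffs_mod A"
  using coeffs_mod_monom[of a 0] by (simp add: monom_0)

lemma coeffs_mod_add: "P \<in> coeffs_mod A \<Longrightarrow> Q \<in> coeffs_mod A \<Longrightarrow> P + Q \<in> coeffs_mod A"
  unfolding coeffs_mod_def by (clarsimp, rename_tac P' Q', rule_tac x = "P' + Q'" in exI)
    (auto intro: ccong_add sring_add[OF A])

lemma coeffs_mod_mult: "P \<in> coeffs_mod A \<Longrightarrow> Q \<in> coeffs_mod A \<Longrightarrow> P * Q \<in> coeffs_mod A"
  unfolding coeffs_mod_def by (clarsimp, rename_tac P' Q', rule_tac x = "P' * Q'" in exI)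
    (auto intro!: ccong_mult sring_mult[OF A] sring_sum[OF A] simp: coeff_mult)

lemma coeffs_mod_sum: "(\<And>i. i \<in> I \<Longrightarrow> f i \<in> coeffs_mod A) \<Longrightarrow> sum f I \<in> coeffs_mod A"
  by (induction I rule: infinite_finite_induct)
    (use coeffs_mod_const[OF sring_0[OF A]] in \<open>auto intro: coeffs_mod_add\<close>)

lemma coeffs_mod_1: "1 \<in> coeffs_mod A"
  using coeffs_mod_const[OF sring_1[OF A]] by (simp add: one_pCons)

lemma coeffs_mod_prod: "(\<And>i. i \<in> I \<Longrightarrow> f i \<in> coeffs_mod A) \<Longrightarrow> prod f I \<in> coeffs_mod A"
  by (induction I rule: infinite_finite_induct) (auto intro: coeffs_mod_mult coeffs_mod_1)

lemma coeffs_mod_power: "P \<in> coeffs_mod A \<Longrightarrow> P ^ k \<in> coeffs_mod A"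
  by (induction k) (auto intro: coeffs_mod_mult coeffs_mod_1)

lemma coeffs_mod_smult: "a \<in> A \<Longrightarrow> P \<in> coeffs_mod A \<Longrightarrow> smult a P \<in> coeffs_mod A"
  using coeffs_mod_mult[OF coeffs_mod_const] by simp

lemma coeffs_mod_subst_pow:
  assumes "\<not> p dvd r" "P \<in> coeffs_mod A"
  shows "subst_pow r P \<in> coeffs_mod A"
proof -
  obtain Q where Q: "\<And>i. coeff Q i \<in> A" "P \<approx> Q" using assms(2) by (auto simp: coeffs_mod_def)
  have "subst_pow r Q \<in> coeffs_mod A"
    by (subst poly_as_sum_of_monoms[of Q, symmetric])
      (auto simp: subst_pow_sum subst_pow_monom intro!: coeffs_mod_sum coeffs_mod_monom Q)
  then show ?thesis using subst_pow_cong[OF assms(1) Q(2)] by (rule coeffs_mod_cong)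
qed

lemma expand_coeffs_mod: "(\<And>s. s \<in> {1..<p} \<Longrightarrow> u s \<in> A) \<Longrightarrow> expand u \<in> coeffs_mod A"
  unfolding expand_def by (intro coeffs_mod_sum coeffs_mod_monom)

lemma coeffs_mod_expand:
  assumes "P \<in> coeffs_mod A"
  shows "\<exists>u. (\<forall>s. u s \<in> A) \<and> P \<approx> expand u"
proof -
  let ?S = "{P. \<exists>u. (\<forall>s. u s \<in> A) \<and> P \<approx> expand u}"
  have add: "P + Q \<in> ?S" if PQ: "P \<in> ?S" "Q \<in> ?S" for P Q
  proof -
    obtain u v where "\<And>s. u s \<in> A" "P \<approx> expand u" "\<And>s. v s \<in> A" "Q \<approx> expand v" using PQ by blast
    moreover have "expand u + expand v = expand (\<lambda>s. u s + v s)"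
      by (simp add: expand_def sum.distrib add_monom[symmetric])
    ultimately show ?thesis
      using A by (intro CollectI exI[of _ "\<lambda>s. u s + v s"]) (auto simp: sring_add dest: ccong_add)
  qed
  have monom: "monom a i \<in> ?S" if "a \<in> A" for a i
  \<comment> \<open>An exponent divisible by p yields a constant, which is not a basis element and
    has to be rewritten by \<open>expand_const\<close>.\<close>
  proof (cases "i mod p = 0")
    case True
    then have "monom a i \<approx> monom a 0" by (intro cc_monom) (simp add: cong_def)
    then have "monom a i \<approx> expand (\<lambda>_. - a)"
      using expand_const[of a] by (simp add: monom_0) (metis ccong_trans)
    then show ?thesis using that A by (intro CollectI exI[of _ "\<lambda>_. - a"]) (simp add: sring_uminus)
  next
    case False
    have "monom a i \<approx> monom a (i mod p)" by (intro cc_monom) (simp add: cong_def)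
    moreover have "monom a (i mod p) = expand (\<lambda>s. if s = i mod p then a else 0)"
      unfolding expand_def
      by (subst sum.mono_neutral_right[of "{1..<p}" "{i mod p}"]) (use False p_pos in auto)
    ultimately show ?thesis
      using that A by (intro CollectI exI[of _ "\<lambda>s. if s = i mod p then a else 0"]) (auto simp: sring_0)
  qed
  have "sum (\<lambda>i. monom (c i) i) I \<in> ?S" if "\<And>i. c i \<in> A" "finite I" for c I
    using that(2)
  proof (induction I)
    case empty
    show ?case using monom[OF sring_0[OF A], of 0] by simp
  next
    case (insert i I)
    then show ?case using add[OF monom[OF that(1)[of i], of i] insert.IH] by (simp only: sum.insert not_False_eq_True)
  qed
  moreover obtain Q where Q: "\<And>i. coeff Q i \<in> A" "P \<approx> Q" using assms unfolding coeffs_mod_def by blast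
  ultimately have "(\<Sum>i\<le>degree Q. monom (coeff Q i) i) \<in> ?S" by simp
  then have "Q \<in> ?S" by (simp only: poly_as_sum_of_monoms)
  then obtain u where "\<forall>s. u s \<in> A" "Q \<approx> expand u" by blast
  then show ?thesis using ccong_trans[OF Q(2)] by blast
qed

text \<open>The descent step from the quotient back to A: coordinates are unique, and those of the
  constant f are all -f.\<close>

lemma coeffs_mod_constD:
  assumes "[:f:] \<in> coeffs_mod A"
  shows "f \<in> A"
proof -
  obtain u where u: "\<And>s. u s \<in> A" "[:f:] \<approx> expand u" using coeffs_mod_expand[OF assms] by blast
  have "expand u \<approx> expand (\<lambda>_. - f)" using u(2) expand_const[of f] by (metis ccong_sym ccong_trans)
  then have "u 1 = - f" using p_gt_1 by (auto dest: expand_eqD[of _ _ 1])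
  then show ?thesis using u(1)[of 1] sring_uminus[OF A, of "u 1"] by simp
qed

end

lemma const_cc_eq: "[:a:] \<approx> [:b:] \<Longrightarrow> a = (b :: 'f::field)"
  using expand_const[of a] expand_const[of b] p_gt_1 expand_eqD[of "\<lambda>_. - a" "\<lambda>_. - b" 1]
  by (simp, metis ccong_sym ccong_trans)

end

section \<open>Cyclic permutation of variables away from the characteristic\<close>

text \<open>
  The exponent vectors \<open>al\<close>, \<open>ga\<close>, \<open>de\<close> stand for elements of \<open>\<int>[t] / (t\<^sup>n - 1)\<close>, made nonnegative
  by adding multiples of the norm element \<open>1 + t + \<dots> + t\<^bsup>n - 1\<^esup>\<close>. Up to such multiples (by \<open>c\<close>, \<open>h\<close>
  and \<open>h'\<close>) the assumptions say that \<open>al\<close> lies in the ideal \<open>(p, t - g)\<close>, and that \<open>al * ga = t - g\<close> and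
  \<open>al * de = p\<close>, so that \<open>al\<close> generates it.
\<close>

locale cyclic_action = prime_cyc +
  fixes g n c h h' :: nat and al ga de :: "nat \<Rightarrow> nat"
    and \<tau> :: "'f::field \<Rightarrow> 'f" and x :: "nat \<Rightarrow> 'f" and K L :: "'f set"
  assumes n: "n = p - 1"
    and g: "\<not> p dvd g" "[g ^ n = 1] (mod p)" "\<And>s. s \<in> {1..<p} \<Longrightarrow> \<exists>j<n. [s = g ^ j] (mod p)"
    and g_sum: "p dvd (\<Sum>j<n. g ^ j)"
    and al_sum: "(\<Sum>j<n. al j) = 1 + n * c" and al_weight: "p dvd (\<Sum>j<n. al j * g ^ j)"
    and al_ga: "\<And>q. q < n \<Longrightarrow>
      (\<Sum>i<n. ga i * al ((q + n - i) mod n)) + (if q = 0 then g else 0) = h + (if q = 1 then 1 else 0)"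
    and al_de: "\<And>q. q < n \<Longrightarrow> (\<Sum>i<n. de i * al ((q + n - i) mod n)) = h' + (if q = 0 then p else 0)"
    and n_gt_1: "n > 1"
    and char: "of_nat p \<noteq> (0 :: 'f)"
    and \<tau>: "field_hom \<tau>" and \<tau>_x: "\<And>i. i < p \<Longrightarrow> \<tau> (x i) = x (Suc i mod p)"
    and \<tau>_K: "\<And>a. a \<in> K \<Longrightarrow> \<tau> a = a"
    and L: "sfield L" "\<And>i. i \<in> {1..<p} \<Longrightarrow> x i \<in> L" "\<not> algebraic_over L (x 0)"
begin

section \<open>Lagrange resolvents and their norm\<close>

definition Y :: "'f poly" where "Y = (\<Sum>i<p. monom (x i) i)"

definition y :: "nat \<Rightarrow> 'f poly" where "y j = subst_pow (g ^ j) Y"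

lemma not_dvd_g_pow: "\<not> p dvd g ^ j"
  using g(1) prime prime_dvd_power by blast

lemma y_shift: "subst_pow (g ^ i) (y j) = y (i + j)"
  by (simp add: y_def subst_pow_subst_pow power_add)

lemma g_pow_n_mult: "[g ^ (n * k) = 1] (mod p)"
  using cong_pow[OF g(2), of k] by (simp add: power_mult)

lemma y_cong: "[i = j] (mod n) \<Longrightarrow> y i \<approx> y j"
proof -
  have "[g ^ i = g ^ (i mod n)] (mod p)" for i
  proof -
    have "g ^ i = g ^ (n * (i div n)) * g ^ (i mod n)" by (simp flip: power_add)
    also have "[\<dots> = 1 * g ^ (i mod n)] (mod p)" by (intro cong_mult g_pow_n_mult cong_refl)
    finally show ?thesis by simp
  qed
  moreover assume "[i = j] (mod n)"
  ultimately have "[g ^ i = g ^ j] (mod p)" unfolding cong_def[of i j n] by (metis cong_sym cong_trans)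
  then show ?thesis unfolding y_def by (rule subst_pow_exp_cong)
qed

definition Nm :: "'f poly" where "Nm = (\<Prod>j<n. y j)"

lemma bij_shift: "bij_betw (\<lambda>j. (i + j) mod n) {..<n} {..<n}"
proof -
  have "inj_on (\<lambda>j. (i + j) mod n) {..<n}"
  proof (rule inj_onI)
    fix j k assume jk: "j \<in> {..<n}" "k \<in> {..<n}" "(i + j) mod n = (i + k) mod n"
    then have "[i + j = i + k] (mod n)" by (simp add: cong_def)
    then have "[j = k] (mod n)" by (simp add: cong_add_lcancel_nat)
    then show "j = k" using jk by (simp add: cong_def)
  qed
  moreover have "(\<lambda>j. (i + j) mod n) ` {..<n} \<subseteq> {..<n}" using n_gt_1 by auto
  ultimately show ?thesis by (simp add: bij_betw_def endo_inj_surj)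
qed

lemma Nm_shift: "(\<Prod>j<n. y (i + j)) \<approx> Nm"
proof -
  have "(\<Prod>j<n. y (i + j)) \<approx> (\<Prod>j<n. y ((i + j) mod n))"
    by (intro ccong_prod y_cong) (simp add: cong_def)
  also have "(\<Prod>j<n. y ((i + j) mod n)) = Nm"
    unfolding Nm_def by (rule prod.reindex_bij_betw[OF bij_shift])
  finally show ?thesis .
qed

lemma subst_pow_cancel: "subst_pow (g ^ (n - 1)) (subst_pow g Q) \<approx> Q"
proof -
  have "subst_pow (g ^ (n - 1)) (subst_pow g Q) = subst_pow (g ^ n) Q"
    using n_gt_1 by (simp add: subst_pow_subst_pow power_minus_mult[of n g, simplified])
  also have "\<dots> \<approx> subst_pow 1 Q" using g(2) by (rule subst_pow_exp_cong)
  finally show ?thesis by (simp only: subst_pow_one)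
qed

definition Kx :: "'f set" where "Kx = field_adjoin K (x ` {..<p})"

lemma sring_Kx: "sring Kx"
  unfolding Kx_def by (intro sfield_sring sfield_adjoin)

lemma x_Kx: "i < p \<Longrightarrow> x i \<in> Kx"
  unfolding Kx_def using adjoin_gens[of "x ` {..<p}" K] by auto

lemma Y_coeffs: "Y \<in> coeffs_mod Kx"
  unfolding Y_def by (intro coeffs_mod_sum coeffs_mod_monom sring_Kx x_Kx) auto

lemma y_coeffs: "y j \<in> coeffs_mod Kx"
  unfolding y_def by (intro coeffs_mod_subst_pow sring_Kx not_dvd_g_pow Y_coeffs)

text \<open>The norm is fixed by t -> t^g, which permutes the coordinates by multiplication with g.
  As g generates the units modulo p, all coordinates agree, and such an element is a constant.
  Comparison of coordinates uses that the substitution is undone by t -> t^(g^(n-1)).\<close>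

lemma Nm_const: "\<exists>\<nu>\<in>Kx. Nm \<approx> [:\<nu>:]"
proof -
  have "Nm \<in> coeffs_mod Kx" unfolding Nm_def by (intro coeffs_mod_prod sring_Kx y_coeffs)
  then obtain u where u: "\<And>s. u s \<in> Kx" "Nm \<approx> expand u" using coeffs_mod_expand[OF sring_Kx] by blast
  have "expand u = (\<Sum>s\<in>{1..<p}. monom (u (g * s mod p)) (g * s mod p))"
    unfolding expand_def
    by (rule sum.reindex_bij_betw[OF bij_mult_mod(2)[OF g(1)], where g = "\<lambda>s. monom (u s) s", symmetric])
  also have "\<dots> \<approx> (\<Sum>s\<in>{1..<p}. monom (u (g * s mod p)) (g * s))"
    by (intro ccong_sum cc_monom) (simp add: cong_def)
  also have "\<dots> = subst_pow g (expand (\<lambda>s. u (g * s mod p)))"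
    by (simp add: expand_def subst_pow_sum subst_pow_monom)
  finally have e: "expand u \<approx> subst_pow g (expand (\<lambda>s. u (g * s mod p)))" .
  have "subst_pow g Nm = (\<Prod>j<n. y (1 + j))"
    using y_shift[of 1] by (simp add: Nm_def subst_pow_prod)
  then have "subst_pow g Nm \<approx> Nm" using Nm_shift[of 1] by simp
  moreover have "subst_pow g Nm \<approx> subst_pow g (expand u)" by (intro subst_pow_cong g u)
  ultimately have "subst_pow g (expand u) \<approx> subst_pow g (expand (\<lambda>s. u (g * s mod p)))"
    using u(2) e by (metis ccong_sym ccong_trans)
  then have "expand u \<approx> expand (\<lambda>s. u (g * s mod p))"
    using subst_pow_cong[OF not_dvd_g_pow] subst_pow_cancel by (metis ccong_sym ccong_trans)
  then have step: "u (g * s mod p) = u s" if "s \<in> {1..<p}" for s using that by (auto dest: expand_eqD)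
  have "u (g ^ j mod p) = u 1" for j
  proof (induction j)
    case (Suc j)
    have "g ^ j mod p \<in> {1..<p}" using not_dvd_g_pow[of j] p_pos by (auto simp: dvd_eq_mod_eq_0)
    then have "u (g * (g ^ j mod p) mod p) = u (g ^ j mod p)" by (rule step)
    then show ?case using Suc by (simp add: mod_mult_right_eq)
  qed (use p_gt_1 in simp)
  then have u1: "u (g ^ j mod p) = u 1" for j .
  have us: "u s = u 1" if s: "s \<in> {1..<p}" for s
  proof -
    obtain j where "[s = g ^ j] (mod p)" using g(3)[OF s] by blast
    then have "s = g ^ j mod p" using s by (simp add: cong_def)
    then show ?thesis using u1[of j] by simp
  qed
  have "expand u = expand (\<lambda>_. u 1)"
    unfolding expand_def by (rule sum.cong[OF refl]) (rule arg_cong[OF us])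
  then have "Nm \<approx> [:- u 1:]" using ccong_trans[OF u(2)] expand_const[of "- u 1"] ccong_sym by fastforce
  then show ?thesis using u(1) sring_uminus[OF sring_Kx] by blast
qed

definition \<nu> :: 'f where "\<nu> = (SOME \<nu>. \<nu> \<in> Kx \<and> Nm \<approx> [:\<nu>:])"

lemma \<nu>: "\<nu> \<in> Kx" "Nm \<approx> [:\<nu>:]"
  using someI_ex[of "\<lambda>\<nu>. \<nu> \<in> Kx \<and> Nm \<approx> [:\<nu>:]"] Nm_const unfolding \<nu>_def by auto

text \<open>The product is monic of degree m in \<open>a\<close>. Since \<open>a\<close> is an
  element and not an indeterminate, the coefficients have to be exhibited as a separate family
  C.\<close>

lemma prod_expand:
  fixes a :: 'f
  assumes "\<And>j. E j \<in> coeffs_mod L"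
  shows "\<exists>C. (\<forall>k. C k \<in> coeffs_mod L) \<and> C m = 1 \<and> (\<Prod>j<m. [:a:] + E j) = (\<Sum>k\<le>m. smult (a ^ k) (C k))"
proof (induction m)
  case 0
  show ?case
    using sfield_sring[OF L(1)] by (intro exI[of _ "\<lambda>_. 1"]) (auto intro: coeffs_mod_1)
next
  case (Suc m)
  note Lr = sfield_sring[OF L(1)]
  obtain C where C: "\<And>k. C k \<in> coeffs_mod L" "C m = 1"
    "(\<Prod>j<m. [:a:] + E j) = (\<Sum>k\<le>m. smult (a ^ k) (C k))" using Suc by blast
  have z: "0 \<in> coeffs_mod L" using coeffs_mod_const[OF Lr sring_0[OF Lr]] by simp
  define D where "D k = (if k = 0 then 0 else C (k - 1)) + (if k \<le> m then C k * E m else 0)" for k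
  have "(\<Prod>j<Suc m. [:a:] + E j) = (\<Sum>k\<le>m. smult (a ^ k) (C k)) * ([:a:] + E m)"
    by (simp add: C(3))
  also have "\<dots> = (\<Sum>k\<le>m. smult (a ^ Suc k) (C k)) + (\<Sum>k\<le>m. smult (a ^ k) (C k * E m))"
    by (simp add: distrib_left sum_distrib_right smult_sum_right mult.commute[of "[:a:]"] mult.commute[of _ a])
  also have "(\<Sum>k\<le>m. smult (a ^ Suc k) (C k))
      = (\<Sum>k\<le>Suc m. smult (a ^ k) (if k = 0 then 0 else C (k - 1)))"
    by (subst sum.atMost_Suc_shift) simp
  also have "(\<Sum>k\<le>m. smult (a ^ k) (C k * E m))
      = (\<Sum>k\<le>Suc m. smult (a ^ k) (if k \<le> m then C k * E m else 0))"
    by simp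
  finally have "(\<Prod>j<Suc m. [:a:] + E j) = (\<Sum>k\<le>Suc m. smult (a ^ k) (D k))"
    unfolding D_def sum.distrib[symmetric] smult_add_right .
  moreover have "D k \<in> coeffs_mod L" for k
    unfolding D_def using C(1) assms z by (auto intro!: coeffs_mod_add[OF Lr] coeffs_mod_mult[OF Lr])
  moreover have "D (Suc m) = 1" unfolding D_def using C(2) by simp
  ultimately show ?case by blast
qed

text \<open>Expanding the norm in powers of \<open>x 0\<close> gives a monic polynomial with coefficients in \<open>L\<close>.\<close>

lemma \<nu>_nonzero: "\<nu> \<noteq> 0"
proof
  assume "\<nu> = 0"
  note Lr = sfield_sring[OF L(1)]
  define Y1 where "Y1 = (\<Sum>i\<in>{1..<p}. monom (x i) i)"
  have "Y = [:x 0:] + Y1"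
    using p_pos unfolding Y_def Y1_def lessThan_atLeast0 by (subst sum.atLeast_Suc_lessThan) (auto simp: monom_0)
  then have y: "y j = [:x 0:] + subst_pow (g ^ j) Y1" for j
    by (simp add: y_def subst_pow_add subst_pow_const)
  have "Y1 \<in> coeffs_mod L"
    unfolding Y1_def by (intro coeffs_mod_sum coeffs_mod_monom Lr L)
  then obtain C where C: "\<And>k. C k \<in> coeffs_mod L" "C n = 1"
      "Nm = (\<Sum>k\<le>n. smult (x 0 ^ k) (C k))"
    using prod_expand[of "\<lambda>j. subst_pow (g ^ j) Y1" n "x 0"] coeffs_mod_subst_pow[OF Lr not_dvd_g_pow]
    unfolding Nm_def y by blast
  have "\<forall>k. \<exists>u. (\<forall>s. u s \<in> L) \<and> C k \<approx> expand u" using coeffs_mod_expand[OF Lr C(1)] by blast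
  then obtain u where u: "\<And>k s. u k s \<in> L" "\<And>k. C k \<approx> expand (u k)" by metis
  have "expand (\<lambda>s. \<Sum>k\<le>n. x 0 ^ k * u k s) = (\<Sum>k\<le>n. smult (x 0 ^ k) (expand (u k)))"
    unfolding expand_def smult_sum_right smult_monom
    by (subst sum.swap) (simp add: hom_sum monom_sum)
  also have "\<dots> \<approx> (\<Sum>k\<le>n. smult (x 0 ^ k) (C k))"
  proof (rule ccong_sum)
    fix k
    show "smult (x 0 ^ k) (expand (u k)) \<approx> smult (x 0 ^ k) (C k)"
      using ccong_mult[OF ccong_refl ccong_sym[OF u(2)], of "[:x 0 ^ k:]" k] by simp
  qed
  also have "\<dots> \<approx> 0" using \<nu>(2) \<open>\<nu> = 0\<close> C(3) by simp
  finally have "(\<Sum>k\<le>n. x 0 ^ k * u k 1) = 0"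
    using p_gt_1 by (auto dest: expand_eq_0)
  define q where "q = (\<Sum>k\<le>n. monom (u k 1) k)"
  have cq: "coeff q k = (if k \<le> n then u k 1 else 0)" for k
    by (simp add: q_def coeff_sum if_distrib cong: if_cong)
  have "poly q (x 0) = 0"
    using \<open>(\<Sum>k\<le>n. x 0 ^ k * u k 1) = 0\<close> by (simp add: q_def poly_sum poly_monom mult_ac)
  moreover have "coeff q k \<in> L" for k using cq u(1) sring_0[OF Lr] by simp
  ultimately have "q = 0" using L(3) unfolding algebraic_over_def by blast
  then have "u n 1 = 0" using cq[of n] by simp
  moreover have "C n \<approx> expand (\<lambda>_. - 1)"
    using C(2) expand_const[of 1] by (simp add: one_pCons)
  then have "expand (u n) \<approx> expand (\<lambda>_. - 1)"
    by (rule ccong_trans[OF ccong_sym[OF u(2)]])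
  then have "u n 1 = -1" using p_gt_1 by (auto dest: expand_eqD[of _ _ 1])
  ultimately show False by simp
qed

text \<open>The monomial whose exponent vector is \<open>al\<close> minus c times the norm element;
  the norm element turns into the scalar \<nu>, so only scalars are inverted.\<close>

definition Z :: "'f poly" where "Z = smult (inverse (\<nu> ^ c)) (\<Prod>j<n. y j ^ al j)"

definition z :: "nat \<Rightarrow> 'f poly" where "z i = subst_pow (g ^ i) Z"

lemma z_eq: "z i = smult (inverse (\<nu> ^ c)) (\<Prod>j<n. y (i + j) ^ al j)"
  by (simp add: z_def Z_def subst_pow_smult subst_pow_prod subst_pow_power y_shift)

lemma Z_coeffs: "Z \<in> coeffs_mod Kx"
proof -
  have "inverse (\<nu> ^ c) \<in> Kx" using \<nu>(1) unfolding Kx_def by (intro sfield_closed sfield_adjoin)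
  then show ?thesis unfolding Z_def
    by (intro coeffs_mod_smult coeffs_mod_prod coeffs_mod_power sring_Kx y_coeffs)
qed

text \<open>The choice matters only outside \<open>{1..<p}\<close>: on that range the coordinates of
  Z are unique, and \<open>expand\<close> reads no others.\<close>

definition w :: "nat \<Rightarrow> 'f" where "w = (SOME w. (\<forall>s. w s \<in> Kx) \<and> Z \<approx> expand w)"

lemma w: "w s \<in> Kx" "Z \<approx> expand w"
  using someI_ex[OF coeffs_mod_expand[OF sring_Kx Z_coeffs]] unfolding w_def by auto

definition y0 :: 'f where "y0 = (\<Sum>i<p. x i)"

definition F0 :: "'f set" where "F0 = field_adjoin K (insert y0 (w ` {1..<p}))"

lemma F0: "sfield F0" and F0r: "sring F0"
  unfolding F0_def by (simp_all add: sfield_adjoin sfield_sring)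

lemma F0_mem: "y0 \<in> F0" "s \<in> {1..<p} \<Longrightarrow> w s \<in> F0" "a \<in> K \<Longrightarrow> a \<in> F0"
  unfolding F0_def using adjoin_gens[of "insert y0 (w ` {1..<p})" K] adjoin_base[of K] by auto

lemma Z_F0: "Z \<in> coeffs_mod F0"
  using expand_coeffs_mod[OF F0r F0_mem(2)] w(2) by (rule coeffs_mod_cong)

lemma z_F0: "z i \<in> coeffs_mod F0"
  unfolding z_def by (intro coeffs_mod_subst_pow F0r not_dvd_g_pow Z_F0)

lemma smult_cong: "P \<approx> Q \<Longrightarrow> smult a P \<approx> smult a Q" for P Q :: "'f poly"
  using ccong_mult[OF ccong_refl, of p P Q "[:a:]"] by simp

text \<open>This is what \<open>al_sum\<close> is for: in the product of all n conjugates of Z every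
  resolvent has exponent 1 + n c, and the scalars contribute \<nu>^(-n c). The product is therefore
  \<nu> itself.\<close>

lemma \<nu>_F0: "\<nu> \<in> F0"
proof -
  have "(\<Prod>i<n. \<Prod>j<n. y (i + j) ^ al j) = (\<Prod>j<n. (\<Prod>i<n. y (j + i)) ^ al j)"
    by (subst prod.swap) (simp add: prod_power_distrib add.commute)
  also have "\<dots> \<approx> (\<Prod>j<n. [:\<nu>:] ^ al j)"
    by (intro ccong_prod ccong_pow) (metis Nm_shift \<nu>(2) ccong_trans)
  also have "(\<Prod>j<n. [:\<nu>:] ^ al j) = [:\<nu> ^ (1 + n * c):]"
    unfolding power_sum[symmetric] al_sum by (simp only: poly_const_pow)
  finally have e: "(\<Prod>i<n. \<Prod>j<n. y (i + j) ^ al j) \<approx> [:\<nu> ^ (1 + n * c):]" .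
  have "(\<Prod>i<n. z i) \<approx> smult (inverse (\<nu> ^ c) ^ n) [:\<nu> ^ (1 + n * c):]"
    unfolding z_eq using smult_cong[OF e] by (simp only: prod_smult prod_constant card_lessThan)
  also have "\<dots> = [:\<nu>:]"
    using \<nu>_nonzero by (simp add: power_add power_mult power_inverse field_simps)
  finally have e': "(\<Prod>i<n. z i) \<approx> [:\<nu>:]" .
  have "[:\<nu>:] \<in> coeffs_mod F0"
    by (rule coeffs_mod_cong[OF coeffs_mod_prod[OF F0r] ccong_sym[OF e']]) (rule z_F0)
  then show ?thesis by (rule coeffs_mod_constD[OF F0r])
qed

text \<open>Monomials in the conjugates of Z realise multiplication in the group ring: the exponent
  of \<open>y q\<close> is the q-th coefficient of the cyclic convolution of \<open>be\<close> with
  \<open>al\<close>.\<close>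

lemma prod_z:
  "(\<Prod>i<n. z i ^ be i) \<approx>
    smult (inverse (\<nu> ^ c) ^ (\<Sum>i<n. be i)) (\<Prod>q<n. y q ^ (\<Sum>i<n. be i * al ((q + n - i) mod n)))"
proof -
  have shift: "(\<Prod>j<n. y (i + j) ^ al j) \<approx> (\<Prod>q<n. y q ^ al ((q + n - i) mod n))" if i: "i < n" for i
  proof -
    have "(\<Prod>j<n. y (i + j) ^ al j) \<approx> (\<Prod>j<n. y ((i + j) mod n) ^ al j)"
      by (intro ccong_prod ccong_pow y_cong) (simp add: cong_def)
    also have "(\<Prod>j<n. y ((i + j) mod n) ^ al j)
        = (\<Prod>j<n. y ((i + j) mod n) ^ al (((i + j) mod n + n - i) mod n))"
    proof (rule prod.cong[OF refl])
      fix j assume j: "j \<in> {..<n}"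
      have "((i + j) mod n + n - i) mod n = j"
      proof (cases "i + j < n")
        case False
        then have "(i + j) mod n = i + j - n" using i j by (simp add: mod_if)
        then show ?thesis using False i j by simp
      qed (use i j in simp)
      then show "y ((i + j) mod n) ^ al j = y ((i + j) mod n) ^ al (((i + j) mod n + n - i) mod n)" by simp
    qed
    also have "\<dots> = (\<Prod>q<n. y q ^ al ((q + n - i) mod n))"
      by (rule prod.reindex_bij_betw[OF bij_shift])
    finally show ?thesis .
  qed
  have "(\<Prod>i<n. z i ^ be i) = smult (\<Prod>i<n. inverse (\<nu> ^ c) ^ be i) (\<Prod>i<n. (\<Prod>j<n. y (i + j) ^ al j) ^ be i)"
    unfolding z_eq by (simp add: smult_power prod_smult)
  also have "\<dots> \<approx> smult (\<Prod>i<n. inverse (\<nu> ^ c) ^ be i) (\<Prod>i<n. (\<Prod>q<n. y q ^ al ((q + n - i) mod n)) ^ be i)"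
    by (rule smult_cong, rule ccong_prod, rule ccong_pow, rule shift) simp
  also have "\<dots> = smult (\<Prod>i<n. inverse (\<nu> ^ c) ^ be i)
      (\<Prod>q<n. y q ^ (\<Sum>i<n. be i * al ((q + n - i) mod n)))"
  proof -
    have "(\<Prod>i<n. (\<Prod>q<n. y q ^ al ((q + n - i) mod n)) ^ be i)
        = (\<Prod>i<n. \<Prod>q<n. y q ^ (be i * al ((q + n - i) mod n)))"
      by (simp only: prod_power_distrib power_mult[symmetric] mult.commute)
    also have "\<dots> = (\<Prod>q<n. y q ^ (\<Sum>i<n. be i * al ((q + n - i) mod n)))"
      unfolding power_sum by (rule prod.swap)
    finally show ?thesis by (rule arg_cong)
  qed
  finally show ?thesis by (simp add: power_sum)
qed

lemma prod_power_add_if: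
  fixes F :: "nat \<Rightarrow> 'f poly"
  assumes "k < n"
  shows "(\<Prod>q<n. F q ^ (e q + (if q = k then b else 0))) = (\<Prod>q<n. F q ^ e q) * F k ^ b"
proof -
  have "(\<Prod>q<n. F q ^ (if q = k then b else 0)) = (\<Prod>q<n. if q = k then F k ^ b else 1)"
    by (intro prod.cong) auto
  also have "\<dots> = F k ^ b" using assms by simp
  finally show ?thesis by (simp add: power_add prod.distrib)
qed

text \<open>The identity \<open>al * ga = t - g\<close> read on exponents. The term -g is moved to
  the other side as a factor Y^g, because resolvents are not divided by; powers of the norm are
  absorbed as scalars.\<close>

lemma y_Suc_0: "\<exists>C\<in>coeffs_mod F0. y 1 \<approx> C * Y ^ g"
proof -
  define S where "S = (\<Sum>i<n. ga i)"
  define v where "v = inverse (\<nu> ^ c) ^ S"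
  have v: "v \<in> F0" "v \<noteq> 0"
    using \<nu>_F0 \<nu>_nonzero by (auto simp: v_def intro!: sfield_closed[OF F0])
  have y0: "y 0 = Y" by (simp add: y_def subst_pow_one[simplified])
  have "(\<Prod>i<n. z i ^ ga i) * Y ^ g
      \<approx> smult v (\<Prod>q<n. y q ^ (\<Sum>i<n. ga i * al ((q + n - i) mod n))) * Y ^ g"
    unfolding v_def S_def by (intro ccong_mult prod_z ccong_refl)
  also have "\<dots> = smult v (\<Prod>q<n. y q ^ ((\<Sum>i<n. ga i * al ((q + n - i) mod n)) + (if q = 0 then g else 0)))"
    using n_gt_1 by (simp add: prod_power_add_if y0)
  also have "\<dots> = smult v (\<Prod>q<n. y q ^ (h + (if q = 1 then 1 else 0)))"
    using al_ga by simp
  also have "\<dots> = smult v (Nm ^ h * y 1)"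
    using n_gt_1 by (simp add: prod_power_add_if Nm_def prod_power_distrib)
  also have "\<dots> \<approx> smult v ([:\<nu>:] ^ h * y 1)"
    by (intro smult_cong ccong_mult ccong_pow \<nu> ccong_refl)
  also have "\<dots> = smult (v * \<nu> ^ h) (y 1)" by (simp add: poly_const_pow)
  finally have "smult (inverse (v * \<nu> ^ h)) (smult (v * \<nu> ^ h) (y 1))
     \<approx> smult (inverse (v * \<nu> ^ h)) ((\<Prod>i<n. z i ^ ga i) * Y ^ g)"
    by (intro smult_cong) (rule ccong_sym)
  moreover have "inverse (v * \<nu> ^ h) * (v * \<nu> ^ h) = 1" using v \<nu>_nonzero by (intro left_inverse) simp
  ultimately have "y 1 \<approx> smult (inverse (v * \<nu> ^ h)) (\<Prod>i<n. z i ^ ga i) * Y ^ g"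
    by (simp only: smult_smult smult_1_left mult_smult_left)
  moreover have "smult (inverse (v * \<nu> ^ h)) (\<Prod>i<n. z i ^ ga i) \<in> coeffs_mod F0"
    using v \<nu>_F0 by (intro coeffs_mod_smult coeffs_mod_prod coeffs_mod_power F0r z_F0 sfield_closed F0)
  ultimately show ?thesis by blast
qed

text \<open>Applying t -> t^g to the expression for \<open>y j\<close> keeps its coefficients over
  F0 and turns Y into \<open>y 1\<close>, which is again a multiple of Y^g.\<close>

lemma y_power_Y: "\<exists>C\<in>coeffs_mod F0. y j \<approx> C * Y ^ (g ^ j)"
proof (induction j)
  case 0
  show ?case using coeffs_mod_1[OF F0r] by (intro bexI[of _ 1]) (simp_all add: y_def subst_pow_one[simplified])
next
  case (Suc j)
  then obtain C where C: "C \<in> coeffs_mod F0" "y j \<approx> C * Y ^ (g ^ j)" by blast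
  obtain D where D: "D \<in> coeffs_mod F0" "y 1 \<approx> D * Y ^ g" using y_Suc_0 by blast
  have y1: "subst_pow g Y = y 1" by (simp add: y_def)
  have "y (Suc j) = subst_pow g (y j)" using y_shift[of 1 j] by simp
  also have "\<dots> \<approx> subst_pow g (C * Y ^ (g ^ j))" using g(1) C(2) by (rule subst_pow_cong)
  also have "\<dots> = subst_pow g C * y 1 ^ (g ^ j)" by (simp add: subst_pow_mult subst_pow_power y1)
  also have "\<dots> \<approx> subst_pow g C * (D * Y ^ g) ^ (g ^ j)" by (intro ccong_mult ccong_pow D ccong_refl)
  also have "\<dots> = (subst_pow g C * D ^ (g ^ j)) * Y ^ (g ^ Suc j)"
    by (simp add: power_mult_distrib power_mult[symmetric] mult_ac)
  finally have "y (Suc j) \<approx> (subst_pow g C * D ^ (g ^ j)) * Y ^ (g ^ Suc j)" .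
  moreover have "subst_pow g C * D ^ (g ^ j) \<in> coeffs_mod F0"
    by (intro coeffs_mod_mult coeffs_mod_power coeffs_mod_subst_pow F0r g C D)
  ultimately show ?case by blast
qed

text \<open>The identity \<open>al * de = p\<close> read on exponents, again up to powers of
  \<nu>.\<close>

lemma Y_power_p: "Y ^ p \<in> coeffs_mod F0"
proof -
  define v where "v = inverse (\<nu> ^ c) ^ (\<Sum>i<n. de i)"
  have v: "v \<in> F0" "v \<noteq> 0"
    using \<nu>_F0 \<nu>_nonzero by (auto simp: v_def intro!: sfield_closed[OF F0])
  have y0: "y 0 = Y" by (simp add: y_def subst_pow_one[simplified])
  have "(\<Prod>i<n. z i ^ de i)
      \<approx> smult v (\<Prod>q<n. y q ^ (\<Sum>i<n. de i * al ((q + n - i) mod n)))"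
    unfolding v_def by (rule prod_z)
  also have "\<dots> = smult v (\<Prod>q<n. y q ^ (h' + (if q = 0 then p else 0)))"
    using al_de by simp
  also have "\<dots> = smult v (Nm ^ h' * Y ^ p)"
    using n_gt_1 by (simp add: prod_power_add_if Nm_def prod_power_distrib y0)
  also have "\<dots> \<approx> smult v ([:\<nu>:] ^ h' * Y ^ p)"
    by (intro smult_cong ccong_mult ccong_pow \<nu> ccong_refl)
  also have "\<dots> = smult (v * \<nu> ^ h') (Y ^ p)" by (simp add: poly_const_pow)
  finally have "smult (inverse (v * \<nu> ^ h')) (smult (v * \<nu> ^ h') (Y ^ p))
     \<approx> smult (inverse (v * \<nu> ^ h')) (\<Prod>i<n. z i ^ de i)"
    by (intro smult_cong) (rule ccong_sym)
  moreover have "inverse (v * \<nu> ^ h') * (v * \<nu> ^ h') = 1" using v \<nu>_nonzero by (intro left_inverse) simp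
  ultimately have "Y ^ p \<approx> smult (inverse (v * \<nu> ^ h')) (\<Prod>i<n. z i ^ de i)"
    by (simp only: smult_smult smult_1_left mult_smult_left)
  moreover have "smult (inverse (v * \<nu> ^ h')) (\<Prod>i<n. z i ^ de i) \<in> coeffs_mod F0"
    using v \<nu>_F0 by (intro coeffs_mod_smult coeffs_mod_prod coeffs_mod_power F0r z_F0 sfield_closed F0)
  ultimately show ?thesis by (rule coeffs_mod_cong[rotated])
qed

section \<open>Action of the cycle on the resolvents\<close>

definition \<tau>m :: "'f poly \<Rightarrow> 'f poly" where "\<tau>m = map_poly \<tau>"

lemmas \<tau>m_simps = map_hom_add[OF \<tau>, folded \<tau>m_def] map_hom_mult[OF \<tau>, folded \<tau>m_def]
  map_hom_sum[OF \<tau>, folded \<tau>m_def] map_hom_prod[OF \<tau>, folded \<tau>m_def] map_hom_power[OF \<tau>, folded \<tau>m_def]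
  map_hom_monom[OF \<tau>, folded \<tau>m_def] map_hom_const[OF \<tau>, folded \<tau>m_def]
  map_hom_smult[OF \<tau>, folded \<tau>m_def] map_hom_subst_pow[OF \<tau>, folded \<tau>m_def]

lemma \<tau>m_cong: "P \<approx> Q \<Longrightarrow> \<tau>m P \<approx> \<tau>m Q"
  unfolding \<tau>m_def by (rule map_hom_cong[OF \<tau>])

lemma \<tau>m_expand: "\<tau>m (expand u) = expand (\<lambda>s. \<tau> (u s))"
  by (simp add: expand_def \<tau>m_simps)

text \<open>Raising the index of each variable by one divides the resolvent by t; the exponent
  \<open>p - 1\<close> stands for -1.\<close>

lemma \<tau>m_Y: "\<tau>m Y \<approx> T (p - 1) * Y"
proof -
  have "T 1 * \<tau>m Y = (\<Sum>i<p. monom (x (Suc i mod p)) (Suc i))"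
    by (simp add: Y_def \<tau>m_simps sum_distrib_left mult_monom \<tau>_x)
  also have "\<dots> \<approx> (\<Sum>i<p. monom (x (Suc i mod p)) (Suc i mod p))"
    by (intro ccong_sum cc_monom) (simp add: cong_def)
  also have "\<dots> = Y"
    unfolding Y_def by (rule sum.reindex_bij_betw[OF bij_betw_Suc_mod[OF p_pos]])
  finally have "T (p - 1) * (T 1 * \<tau>m Y) \<approx> T (p - 1) * Y" by (intro ccong_mult ccong_refl)
  moreover have "T (p - 1) * (T 1 * \<tau>m Y) = T p * \<tau>m Y"
    using p_pos by (simp add: mult.assoc[symmetric] T_mult)
  moreover have "T p * \<tau>m Y \<approx> 1 * \<tau>m Y" by (intro ccong_mult cc_T_p ccong_refl)
  ultimately show ?thesis by (metis ccong_sym ccong_trans mult_1)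
qed

lemma \<tau>m_y: "\<tau>m (y j) \<approx> T (g ^ j * (p - 1)) * y j"
proof -
  have "\<tau>m (y j) = subst_pow (g ^ j) (\<tau>m Y)" by (simp add: y_def \<tau>m_simps)
  also have "\<dots> \<approx> subst_pow (g ^ j) (T (p - 1) * Y)"
    by (intro subst_pow_cong not_dvd_g_pow \<tau>m_Y)
  also have "\<dots> = T (g ^ j * (p - 1)) * y j"
    by (simp add: subst_pow_mult subst_pow_monom y_def)
  finally show ?thesis .
qed

text \<open>The cycle multiplies the monomial by t to minus its weight
  \<open>\<Sum>j<n. a j * g ^ j\<close>. Vanishing of the weight modulo p is membership of the
  exponent in the ideal (p, t - g).\<close>

lemma \<tau>m_prod_y:
  assumes "p dvd (\<Sum>j<n. a j * g ^ j)"
  shows "\<tau>m (\<Prod>j<n. y j ^ a j) \<approx> (\<Prod>j<n. y j ^ a j)"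
proof -
  have "\<tau>m (\<Prod>j<n. y j ^ a j) \<approx> (\<Prod>j<n. (T (g ^ j * (p - 1)) * y j) ^ a j)"
    unfolding \<tau>m_simps by (intro ccong_prod ccong_pow \<tau>m_y)
  also have "\<dots> = (\<Prod>j<n. T (g ^ j * (p - 1) * a j)) * (\<Prod>j<n. y j ^ a j)"
    by (simp add: power_mult_distrib prod.distrib monom_power')
  also have "(\<Prod>j<n. T (g ^ j * (p - 1) * a j)) = (T 1 :: 'f poly) ^ (\<Sum>j<n. g ^ j * (p - 1) * a j)"
    by (simp add: power_sum monom_power')
  also have "(\<Sum>j<n. g ^ j * (p - 1) * a j) = (p - 1) * (\<Sum>j<n. a j * g ^ j)"
    by (simp add: sum_distrib_left mult_ac)
  also have "(T 1 :: 'f poly) ^ \<dots> * (\<Prod>j<n. y j ^ a j) \<approx> T 0 * (\<Prod>j<n. y j ^ a j)"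
    unfolding monom_power' using assms
    by (intro ccong_mult ccong_refl cc_T) (auto simp: cong_0_iff)
  finally show ?thesis by (simp add: monom_0 one_pCons[symmetric])
qed

lemma \<tau>_\<nu>: "\<tau> \<nu> = \<nu>"
proof -
  have "\<tau>m Nm \<approx> Nm" unfolding Nm_def using \<tau>m_prod_y[of "\<lambda>_. 1"] g_sum by simp
  then have "\<tau>m [:\<nu>:] \<approx> [:\<nu>:]" using \<nu>(2) \<tau>m_cong[OF \<nu>(2)] by (metis ccong_sym ccong_trans)
  then show ?thesis unfolding \<tau>m_simps by (rule const_cc_eq)
qed

lemma \<tau>_w: "s \<in> {1..<p} \<Longrightarrow> \<tau> (w s) = w s"
proof (rule expand_eqD)
  have "\<tau>m Z \<approx> Z"
    unfolding Z_def \<tau>m_simps hom_inverse[OF \<tau>] hom_power[OF \<tau>] \<tau>_\<nu>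
    using \<tau>m_prod_y[OF al_weight] unfolding \<tau>m_simps by (rule smult_cong)
  then have "\<tau>m (expand w) \<approx> expand w" using w(2) \<tau>m_cong[OF w(2)] by (metis ccong_sym ccong_trans)
  then show "expand (\<lambda>s. \<tau> (w s)) \<approx> expand w" unfolding \<tau>m_expand .
qed

lemma \<tau>_y0: "\<tau> y0 = y0"
proof -
  have "\<tau> y0 = (\<Sum>i<p. x (Suc i mod p))" by (simp add: y0_def hom_sum[OF \<tau>] \<tau>_x)
  also have "\<dots> = y0" unfolding y0_def by (rule sum.reindex_bij_betw[OF bij_betw_Suc_mod[OF p_pos]])
  finally show ?thesis .
qed

lemma \<tau>_F0: "a \<in> F0 \<Longrightarrow> \<tau> a = a"
  unfolding F0_def by (rule hom_fixes_adjoin[OF \<tau>]) (auto simp: \<tau>_K \<tau>_w \<tau>_y0)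

lemma \<tau>m_coeffs_mod: "C \<in> coeffs_mod F0 \<Longrightarrow> \<tau>m C \<approx> C"
proof -
  assume "C \<in> coeffs_mod F0"
  then obtain Q where Q: "\<And>i. coeff Q i \<in> F0" "C \<approx> Q" by (auto simp: coeffs_mod_def)
  have "\<tau>m Q = Q" by (intro poly_eqI) (simp add: \<tau>m_def coeff_map_hom[OF \<tau>] \<tau>_F0 Q)
  then show ?thesis using Q(2) \<tau>m_cong[OF Q(2)] by (metis ccong_sym ccong_trans)
qed

lemma \<tau>m_pow_term:
  assumes C: "C \<in> coeffs_mod F0"
  shows "(\<tau>m ^^ i) (C * Y ^ j) \<approx> T ((p - 1) * j * i) * (C * Y ^ j)"
proof (induction i)
  case 0
  show ?case by (simp add: monom_0 one_pCons[symmetric])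
next
  case (Suc i)
  have "(\<tau>m ^^ Suc i) (C * Y ^ j) \<approx> \<tau>m (T ((p - 1) * j * i) * (C * Y ^ j))"
    using \<tau>m_cong[OF Suc] by simp
  also have "\<dots> = T ((p - 1) * j * i) * (\<tau>m C * \<tau>m Y ^ j)"
    by (simp add: \<tau>m_simps hom_1[OF \<tau>])
  also have "\<dots> \<approx> T ((p - 1) * j * i) * (C * (T (p - 1) * Y) ^ j)"
    by (intro ccong_mult ccong_pow \<tau>m_coeffs_mod C \<tau>m_Y ccong_refl)
  also have "\<dots> = (T ((p - 1) * j * i) * T ((p - 1) * j)) * (C * Y ^ j)"
    by (simp add: power_mult_distrib monom_power' mult_ac)
  also have "T ((p - 1) * j * i) * T ((p - 1) * j) = (T ((p - 1) * j * Suc i) :: 'f poly)"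
    by (simp add: T_mult add.commute)
  finally show ?case .
qed

text \<open>The ring F0[t][Y] modulo \<open>cyc p\<close>. It is generated additively, so that trace
  and period of \<tau> need to be computed on single terms only.\<close>

inductive_set Ypolys :: "'f poly set" where
  single: "C \<in> coeffs_mod F0 \<Longrightarrow> C * Y ^ j \<in> Ypolys"
| add: "P \<in> Ypolys \<Longrightarrow> Q \<in> Ypolys \<Longrightarrow> P + Q \<in> Ypolys"
| congr: "P \<in> Ypolys \<Longrightarrow> Q \<approx> P \<Longrightarrow> Q \<in> Ypolys"

lemma Ypolys_coeffs: "C \<in> coeffs_mod F0 \<Longrightarrow> C \<in> Ypolys"
  using Ypolys.single[of C 0] by simp

lemma Ypolys_mult_term:
  assumes "P \<in> Ypolys" "C \<in> coeffs_mod F0"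
  shows "C * Y ^ j * P \<in> Ypolys"
  using assms(1)
proof induction
  case (single D k)
  have "C * Y ^ j * (D * Y ^ k) = (C * D) * Y ^ (j + k)" by (simp add: power_add mult_ac)
  moreover have "(C * D) * Y ^ (j + k) \<in> Ypolys"
    by (intro Ypolys.single coeffs_mod_mult F0r assms(2) single)
  ultimately show ?case by (simp only:)
next
  case (add P Q)
  then show ?case by (simp add: distrib_left Ypolys.add)
next
  case (congr P Q)
  have "C * Y ^ j * Q \<approx> C * Y ^ j * P" by (intro ccong_mult ccong_refl congr)
  then show ?case using congr Ypolys.congr by blast
qed

lemma Ypolys_mult: "P \<in> Ypolys \<Longrightarrow> Q \<in> Ypolys \<Longrightarrow> P * Q \<in> Ypolys"
proof (induction P rule: Ypolys.induct)
  case (single C j)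
  then show ?case by (intro Ypolys_mult_term)
next
  case (add P P')
  then show ?case by (simp add: distrib_right Ypolys.add)
next
  case (congr P P')
  have "P' * Q \<approx> P * Q" by (intro ccong_mult ccong_refl congr)
  then show ?case using congr Ypolys.congr by blast
qed

lemma Ypolys_sum: "(\<And>i. i \<in> I \<Longrightarrow> f i \<in> Ypolys) \<Longrightarrow> sum f I \<in> Ypolys"
  by (induction I rule: infinite_finite_induct)
    (use Ypolys_coeffs[OF coeffs_mod_const[OF F0r sring_0[OF F0r]]] in \<open>auto intro: Ypolys.add\<close>)

lemma \<tau>m_funpow_add: "(\<tau>m ^^ i) (P + Q) = (\<tau>m ^^ i) P + (\<tau>m ^^ i) Q"
  by (induction i) (auto simp: \<tau>m_simps)

lemma \<tau>m_funpow_const: "(\<tau>m ^^ i) [:a:] = [:(\<tau> ^^ i) a:]"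
  by (induction i) (auto simp: \<tau>m_simps)

lemma \<tau>m_funpow_cong: "P \<approx> Q \<Longrightarrow> (\<tau>m ^^ i) P \<approx> (\<tau>m ^^ i) Q"
  by (induction i) (auto intro: \<tau>m_cong)

lemma Ypolys_\<tau>: "P \<in> Ypolys \<Longrightarrow> \<tau>m P \<in> Ypolys"
proof (induction rule: Ypolys.induct)
  case (single C j)
  have "T ((p - 1) * j * 1) * C * Y ^ j \<in> Ypolys"
    by (intro Ypolys.single coeffs_mod_mult coeffs_mod_monom F0r sring_1 single)
  then show ?case
    using \<tau>m_pow_term[OF single, of 1 j] by (intro Ypolys.congr[of _ "\<tau>m (C * Y ^ j)"]) (simp_all add: mult.assoc)
next
  case (add P Q)
  then show ?case by (simp add: \<tau>m_simps Ypolys.add)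
next
  case (congr P Q)
  then show ?case using \<tau>m_cong Ypolys.congr by blast
qed

lemma Ypolys_\<tau>_p: "P \<in> Ypolys \<Longrightarrow> (\<tau>m ^^ p) P \<approx> P"
proof (induction rule: Ypolys.induct)
  case (single C j)
  have "T ((p - 1) * j * p) * (C * Y ^ j) \<approx> T 0 * (C * Y ^ j)"
    by (intro ccong_mult ccong_refl cc_T) (simp add: cong_0_iff)
  then have "T ((p - 1) * j * p) * (C * Y ^ j) \<approx> C * Y ^ j" by (simp add: monom_0 one_pCons[symmetric])
  with \<tau>m_pow_term[OF single] show ?case by (rule ccong_trans)
next
  case (add P Q)
  then show ?case by (simp add: \<tau>m_funpow_add ccong_add)
next
  case (congr P Q)
  then show ?case using \<tau>m_funpow_cong by (metis ccong_sym ccong_trans)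
qed

text \<open>On a term C Y^j the trace is a character sum. It vanishes unless p divides j, and in
  that case it is p C (Y^p)^(j/p), whose coefficients lie in F0 by \<open>Y_power_p\<close>.\<close>

lemma Ypolys_trace: "P \<in> Ypolys \<Longrightarrow> (\<Sum>i<p. (\<tau>m ^^ i) P) \<in> coeffs_mod F0"
proof (induction rule: Ypolys.induct)
  case (single C j)
  have "(\<Sum>i<p. (\<tau>m ^^ i) (C * Y ^ j)) \<approx> (\<Sum>i<p. T ((p - 1) * j * i) * (C * Y ^ j))"
    by (intro ccong_sum \<tau>m_pow_term single)
  also have "\<dots> = (\<Sum>i<p. T ((p - 1) * j * i)) * (C * Y ^ j)"
    by (simp add: sum_distrib_right)
  also have "\<dots> \<approx> (if p dvd (p - 1) * j then of_nat p else 0) * (C * Y ^ j)"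
    by (intro ccong_mult sum_T_mult ccong_refl)
  finally have *: "(\<Sum>i<p. (\<tau>m ^^ i) (C * Y ^ j)) \<approx> (if p dvd (p - 1) * j then of_nat p else 0) * (C * Y ^ j)" .
  show ?case
  proof (cases "p dvd j")
    case True
    then obtain k where k: "j = p * k" by auto
    have "of_nat p * (C * (Y ^ p) ^ k) \<in> coeffs_mod F0"
      using coeffs_mod_const[OF F0r sring_of_nat[OF F0r]]
      by (intro coeffs_mod_mult coeffs_mod_power F0r Y_power_p single) (simp add: of_nat_poly)
    then show ?thesis using * True by (intro coeffs_mod_cong[OF _ *]) (simp add: k power_mult)
  next
    case False
    have "coprime p (p - 1)"
      using p_pos coprime_Suc_right_nat[of "p - 1"] by (simp add: coprime_commute)
    then have "\<not> p dvd (p - 1) * j" using False by (simp add: coprime_dvd_mult_right_iff)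
    then show ?thesis
      using * coeffs_mod_const[OF F0r sring_0[OF F0r]] by (intro coeffs_mod_cong[OF _ *]) simp
  qed
next
  case (add P Q)
  then show ?case by (simp add: \<tau>m_funpow_add sum.distrib coeffs_mod_add[OF F0r])
next
  case (congr P Q)
  have "(\<Sum>i<p. (\<tau>m ^^ i) Q) \<approx> (\<Sum>i<p. (\<tau>m ^^ i) P)" by (intro ccong_sum \<tau>m_funpow_cong congr)
  then show ?case using congr coeffs_mod_cong by blast
qed

text \<open>The scalars that are polynomials in t and Y over F0. This ring turns out to contain
  every variable, and its \<tau>-invariants are F0.\<close>

definition R :: "'f set" where "R = {f. [:f:] \<in> Ypolys}"

lemma R_ring: "sring R"
  unfolding sring_def
proof (intro conjI ballI)
  have c: "a \<in> F0 \<Longrightarrow> a \<in> R" for a unfolding R_def using Ypolys_coeffs coeffs_mod_const[OF F0r] by blast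
  show "1 \<in> R" using c sring_1[OF F0r] by blast
  fix a b assume ab: "a \<in> R" "b \<in> R"
  show "a + b \<in> R" using Ypolys.add[of "[:a:]" "[:b:]"] ab by (simp add: R_def)
  have mult: "a \<in> R \<Longrightarrow> b \<in> R \<Longrightarrow> a * b \<in> R" for a b using Ypolys_mult[of "[:a:]" "[:b:]"] by (simp add: R_def mult.commute)
  show "a * b \<in> R" using mult ab .
  have "- 1 \<in> R" using c sring_uminus[OF F0r sring_1[OF F0r]] by blast
  then show "- a \<in> R" using mult[of "-1" a] ab by simp
qed

lemma F0_R: "F0 \<subseteq> R"
  unfolding R_def using Ypolys_coeffs coeffs_mod_const[OF F0r] by blast

text \<open>A nonzero s is a power of g, so Y(t^s) is a conjugate resolvent. The value s = 0 gives
  the sum of the variables, which no resolvent supplies; hence the additional generator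
  \<open>y0\<close>.\<close>

lemma subst_Y_Ypolys: "s < p \<Longrightarrow> subst_pow s Y \<in> Ypolys"
proof (cases "s = 0")
  case True
  have "subst_pow 0 Y = [:y0:]"
    by (simp add: Y_def y0_def subst_pow_sum subst_pow_monom monom_0 sum_to_poly)
  then show ?thesis using True F0_R F0_mem(1) by (auto simp: R_def)
next
  case False
  assume "s < p"
  then obtain j where "[s = g ^ j] (mod p)" using g(3)[of s] False by auto
  then have "subst_pow s Y \<approx> y j" unfolding y_def by (rule subst_pow_exp_cong)
  moreover obtain C where "C \<in> coeffs_mod F0" "y j \<approx> C * Y ^ (g ^ j)" using y_power_Y by blast
  ultimately show ?thesis using Ypolys.single Ypolys.congr by blast
qed

text \<open>Fourier inversion: summing t^(-i s) Y(t^s) over all s, including 0, gives p times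
  \<open>x i\<close>; \<open>p - i\<close> represents -i. Dividing by p requires the characteristic
  to differ from p.\<close>

lemma x_R: "i < p \<Longrightarrow> x i \<in> R"
proof -
  assume i: "i < p"
  have "(\<Sum>s<p. T ((p - i) * s) * subst_pow s Y) = (\<Sum>j<p. smult (x j) (\<Sum>s<p. T ((p - i + j) * s)))"
    unfolding Y_def subst_pow_sum subst_pow_monom sum_distrib_left smult_sum_right
    by (subst sum.swap) (simp add: mult_monom smult_monom algebra_simps)
  also have "\<dots> \<approx> (\<Sum>j<p. smult (x j) (if p dvd (p - i + j) then of_nat p else 0))"
    by (intro ccong_sum smult_cong sum_T_mult)
  also have "\<dots> = (\<Sum>j<p. if j = i then [:x i * of_nat p:] else 0)"
  proof (intro sum.cong refl)
    fix j assume j: "j \<in> {..<p}"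
    have "p dvd (p - i + j) \<longleftrightarrow> j = i"
    proof
      assume "p dvd (p - i + j)"
      then obtain k where k: "p - i + j = p * k" by auto
      moreover have "0 < p - i + j" "p - i + j < p * 2" using i j by auto
      ultimately have "0 < k" "p * k < p * 2" by (auto intro: Nat.gr0I)
      then have "k = 1" using p_pos by simp
      then show "j = i" using k i by simp
    qed (use i in simp)
    then show "smult (x j) (if p dvd (p - i + j) then of_nat p else 0) = (if j = i then [:x i * of_nat p:] else 0)"
      by (simp add: of_nat_poly)
  qed
  also have "\<dots> = [:x i * of_nat p:]" using i by simp
  finally have "(\<Sum>s<p. T ((p - i) * s) * subst_pow s Y) \<approx> [:x i * of_nat p:]" .
  moreover have "(\<Sum>s<p. T ((p - i) * s) * subst_pow s Y) \<in> Ypolys"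
    by (intro Ypolys_sum Ypolys_mult subst_Y_Ypolys Ypolys_coeffs coeffs_mod_monom F0r sring_1) auto
  ultimately have "x i * of_nat p \<in> R" unfolding R_def using Ypolys.congr ccong_sym by blast
  moreover have "inverse (of_nat p) \<in> R"
    using F0_R sfield_inverse[OF F0 sring_of_nat[OF F0r], of p] by blast
  ultimately have "x i * of_nat p * inverse (of_nat p) \<in> R" by (rule sring_mult[OF R_ring])
  then show ?thesis using char by (simp add: mult.assoc)
qed

text \<open>The trace of an invariant f is p f, and traces lie over F0.\<close>

lemma R_invariant: "f \<in> R \<Longrightarrow> \<tau> f = f \<Longrightarrow> f \<in> F0"
proof -
  assume f: "f \<in> R" "\<tau> f = f"
  have "(\<tau> ^^ i) f = f" for i using funpow_fixes[of \<tau> f i] f(2) by simp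
  then have "(\<Sum>i<p. (\<tau>m ^^ i) [:f:]) = [:of_nat p * f:]"
    by (simp add: \<tau>m_funpow_const of_nat_poly)
  then have "[:of_nat p * f:] \<in> coeffs_mod F0" using Ypolys_trace[of "[:f:]"] f(1) by (simp add: R_def)
  then have "of_nat p * f \<in> F0" by (rule coeffs_mod_constD[OF F0r])
  then have "of_nat p * f / of_nat p \<in> F0" by (intro sfield_divide F0 sring_of_nat F0r)
  then show ?thesis using char by simp
qed

lemma sfield_R: "sfield R"
proof (rule sfield_if_invariants_sfield[OF R_ring F0 F0_R \<tau> _ p_pos _ R_invariant])
  show "\<tau> f \<in> R" if "f \<in> R" for f using Ypolys_\<tau>[of "[:f:]"] that by (simp add: R_def \<tau>m_simps)
  show "(\<tau> ^^ p) f = f" if "f \<in> R" for f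
    using Ypolys_\<tau>_p[of "[:f:]"] that const_cc_eq by (simp add: R_def \<tau>m_funpow_const)
qed

theorem invariants: "f \<in> field_adjoin K (x ` {..<p}) \<Longrightarrow> \<tau> f = f \<Longrightarrow> f \<in> field_adjoin K (insert (\<Sum>i<p. x i) (w ` {1..<p}))"
proof -
  assume f: "f \<in> field_adjoin K (x ` {..<p})" "\<tau> f = f"
  have "field_adjoin K (x ` {..<p}) \<subseteq> R"
    using F0_R F0_mem(3) x_R by (intro adjoin_least sfield_R) auto
  then show ?thesis using f R_invariant unfolding F0_def y0_def by blast
qed

text \<open>Multiplying the indices by r acts on Y as the substitution t -> t^(r'), with r' the
  inverse of r modulo p. The norm is a scalar and stays fixed, so the same substitution describes
  the action on Z; it permutes the basis t, ..., t^(p-1) and hence the coordinates.\<close>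

lemma w_equivariant:
  assumes \<kappa>: "field_hom \<kappa>" and r: "\<not> p dvd r" and \<kappa>_x: "\<And>i. i < p \<Longrightarrow> \<kappa> (x i) = x (r * i mod p)"
    and s: "s \<in> {1..<p}"
  shows "\<kappa> (w s) = w (r * s mod p)"
proof -
  define \<kappa>m where "\<kappa>m = map_poly \<kappa>"
  note \<kappa>m_simps = map_hom_prod[OF \<kappa>, folded \<kappa>m_def] map_hom_power[OF \<kappa>, folded \<kappa>m_def] map_hom_sum[OF \<kappa>, folded \<kappa>m_def]
    map_hom_monom[OF \<kappa>, folded \<kappa>m_def] map_hom_const[OF \<kappa>, folded \<kappa>m_def]
    map_hom_smult[OF \<kappa>, folded \<kappa>m_def] map_hom_subst_pow[OF \<kappa>, folded \<kappa>m_def]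
  have \<kappa>m_cong: "P \<approx> Q \<Longrightarrow> \<kappa>m P \<approx> \<kappa>m Q" for P Q unfolding \<kappa>m_def by (rule map_hom_cong[OF \<kappa>])
  have "coprime r p" using r prime by (simp add: coprime_commute prime_imp_coprime)
  then obtain r' where r': "[r * r' = 1] (mod p)" using cong_solve_coprime_nat by auto
  have nr': "\<not> p dvd r'"
  proof
    assume "p dvd r'"
    then have "[r * r' = 0] (mod p)" by (simp add: cong_0_iff)
    then have "[1 = 0] (mod p)" using r' by (metis cong_sym cong_trans)
    then show False using p_gt_1 by (simp add: cong_0_iff)
  qed
  have inv: "[r' * (r * i mod p) = i] (mod p)" for i
  proof -
    have "[r' * (r * i mod p) = r' * (r * i)] (mod p)" by (intro cong_mult cong_refl) (simp add: cong_def)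
    also have "r' * (r * i) = (r * r') * i" by simp
    also have "[(r * r') * i = 1 * i] (mod p)" by (intro cong_mult cong_refl r')
    finally show ?thesis by simp
  qed
  have "\<kappa>m Y = (\<Sum>i<p. monom (x (r * i mod p)) i)" by (simp add: Y_def \<kappa>m_simps \<kappa>_x)
  also have "\<dots> \<approx> (\<Sum>i<p. monom (x (r * i mod p)) (r' * (r * i mod p)))"
    by (intro ccong_sum cc_monom cong_sym[OF inv])
  also have "\<dots> = subst_pow r' Y"
    unfolding Y_def subst_pow_sum subst_pow_monom by (rule sum.reindex_bij_betw[OF bij_mult_mod(1)[OF r]])
  finally have Y: "\<kappa>m Y \<approx> subst_pow r' Y" .
  have y: "\<kappa>m (y j) \<approx> subst_pow r' (y j)" for j
  proof -
    have "\<kappa>m (y j) \<approx> subst_pow (g ^ j) (subst_pow r' Y)"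
      unfolding y_def \<kappa>m_simps by (intro subst_pow_cong not_dvd_g_pow Y)
    then show ?thesis by (simp add: y_def subst_pow_subst_pow mult.commute)
  qed
  have prod: "\<kappa>m (\<Prod>j<n. y j ^ a j) \<approx> subst_pow r' (\<Prod>j<n. y j ^ a j)" for a
    unfolding \<kappa>m_simps subst_pow_prod subst_pow_power by (intro ccong_prod ccong_pow y)
  have "\<kappa>m [:\<nu>:] \<approx> [:\<nu>:]"
  proof -
    have "\<kappa>m [:\<nu>:] \<approx> \<kappa>m Nm" by (intro \<kappa>m_cong ccong_sym[OF \<nu>(2)])
    also have "\<dots> \<approx> subst_pow r' Nm" unfolding Nm_def using prod[of "\<lambda>_. 1"] by simp
    also have "\<dots> \<approx> subst_pow r' [:\<nu>:]" by (intro subst_pow_cong nr' \<nu>)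
    finally show ?thesis by (simp add: subst_pow_const)
  qed
  then have \<nu>: "\<kappa> \<nu> = \<nu>" unfolding \<kappa>m_simps by (rule const_cc_eq)
  have "expand (\<lambda>s. \<kappa> (w s)) = \<kappa>m (expand w)" by (simp add: expand_def \<kappa>m_simps)
  also have "\<dots> \<approx> \<kappa>m Z" by (intro \<kappa>m_cong ccong_sym[OF w(2)])
  also have "\<dots> \<approx> subst_pow r' Z"
    unfolding Z_def \<kappa>m_simps(6) subst_pow_smult hom_inverse[OF \<kappa>] hom_power[OF \<kappa>] \<nu>
    by (rule smult_cong[OF prod])
  also have "\<dots> \<approx> subst_pow r' (expand w)" by (intro subst_pow_cong nr' w)
  also have "\<dots> = (\<Sum>s\<in>{1..<p}. monom (w s) (r' * s))"
    by (simp add: expand_def subst_pow_sum subst_pow_monom)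
  also have "\<dots> = (\<Sum>s\<in>{1..<p}. monom (w (r * s mod p)) (r' * (r * s mod p)))"
    by (rule sum.reindex_bij_betw[OF bij_mult_mod(2)[OF r], symmetric])
  also have "\<dots> \<approx> expand (\<lambda>s. w (r * s mod p))"
    unfolding expand_def by (intro ccong_sum cc_monom inv)
  finally show ?thesis using s by (auto dest: expand_eqD)
qed

end

section \<open>Cyclic permutation of variables in characteristic p\<close>

lemma adjoin_root_invariant:
  assumes F0: "sfield F0" and \<tau>: "field_hom \<tau>" "\<And>x. x \<in> F0 \<Longrightarrow> \<tau> x = x"
    and \<tau>\<theta>: "\<tau> \<theta> = poly q \<theta>" "\<And>i. coeff q i \<in> F0"
    and N: "N > 0" "(\<tau> ^^ N) \<theta> = \<theta>"
    and Q: "degree Q = n" "coeff Q n = 1" "\<And>i. coeff Q i \<in> F0" "poly Q \<theta> = 0"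
    and conj: "inj_on (\<lambda>i. (\<tau> ^^ i) \<theta>) {..<n}" "n > 0"
    and f: "f \<in> field_adjoin F0 {\<theta>}" "\<tau> f = f"
  shows "f \<in> F0"
proof (rule adjoin_single_invariant[OF F0 \<tau> \<tau>\<theta> N _ _ conj f])
  show "- coeff Q i \<in> F0" if "i < n" for i using Q(3) by (intro sfield_closed F0)
  have "0 = (\<Sum>i<Suc n. coeff Q i * \<theta> ^ i)"
    using Q(1,4) by (simp add: poly_altdef lessThan_Suc_atMost)
  then have "(\<Sum>i<n. coeff Q i * \<theta> ^ i) + \<theta> ^ n = 0" using Q(2) by simp
  then have "\<theta> ^ n = - (\<Sum>i<n. coeff Q i * \<theta> ^ i)" by (simp only: add_eq_0_iff)
  then show "\<theta> ^ n = (\<Sum>i<n. - coeff Q i * \<theta> ^ i)" by (simp add: sum_negf)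
qed

text \<open>Solves the Vandermonde system by Lagrange interpolation: P vanishes at every
  \<open>t l\<close> except \<open>t i\<close>, so combining the given power sums with the
  coefficients of P leaves \<open>s i * poly P (t i)\<close>.\<close>

lemma vandermonde_mem:
  assumes L: "sfield L" and t: "inj_on t {..<m}" "\<And>i. i < m \<Longrightarrow> t i \<in> L"
    and s: "\<And>j. j < m \<Longrightarrow> (\<Sum>i<m. s i * t i ^ j) \<in> L" and i: "i < m"
  shows "s i \<in> L"
proof -
  note Lr = sfield_sring[OF L]
  define P where "P = (\<Prod>l\<in>{..<m} - {i}. [:- t l, 1:])"
  have deg: "degree P < m"
  proof -
    have "degree P \<le> (\<Sum>l\<in>{..<m} - {i}. degree [:- t l, 1:])"
      unfolding P_def using degree_prod_sum_le[of "{..<m} - {i}" "\<lambda>l. [:- t l, 1:]"] by (simp add: o_def)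
    also have "\<dots> = m - 1" using i by simp
    finally show ?thesis using i by simp
  qed
  have coeff: "coeff (prod f S) j \<in> L"
    if "finite S" "\<And>l j. l \<in> S \<Longrightarrow> coeff (f l) j \<in> L" for f :: "nat \<Rightarrow> 'a poly" and S j
    using that
  proof (induction S arbitrary: j)
    case empty
    show ?case by (simp add: coeff_1 sring_0[OF Lr] sring_1[OF Lr])
  next
    case (insert l S)
    then show ?case by (auto simp: coeff_mult intro!: sring_sum[OF Lr] sring_mult[OF Lr])
  qed
  have cP: "coeff P j \<in> L" for j
    unfolding P_def using t(2)
    by (intro coeff) (auto simp: coeff_pCons sring_closed[OF Lr] split: nat.splits)
  have P: "poly P (t l) = (if l = i then poly P (t i) else 0)" if "l < m" for l
    using that i by (auto simp: P_def poly_prod)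
  have Pi: "poly P (t i) \<noteq> 0" using t(1) i by (auto simp: P_def poly_prod inj_on_def)
  have "(\<Sum>j<m. coeff P j * (\<Sum>l<m. s l * t l ^ j)) = (\<Sum>l<m. s l * (\<Sum>j<m. coeff P j * t l ^ j))"
    unfolding sum_distrib_left by (subst sum.swap) (simp add: mult_ac)
  also have "\<dots> = (\<Sum>l<m. s l * poly P (t l))"
    unfolding poly_altdef using deg
    by (intro sum.cong refl arg_cong2[of _ _ _ _ "(*)"] sum.mono_neutral_right) (auto simp: coeff_eq_0)
  also have "\<dots> = (\<Sum>l<m. if l = i then s i * poly P (t i) else 0)"
    by (intro sum.cong refl, subst P) auto
  also have "\<dots> = s i * poly P (t i)" using i by simp
  finally have "s i = (\<Sum>j<m. coeff P j * (\<Sum>l<m. s l * t l ^ j)) / poly P (t i)"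
    using Pi by (simp add: field_simps)
  also have "\<dots> \<in> L"
  proof (rule sfield_divide[OF L])
    show "(\<Sum>j<m. coeff P j * (\<Sum>l<m. s l * t l ^ j)) \<in> L"
      by (rule sring_sum[OF Lr], rule sring_mult[OF Lr cP]) (simp add: s)
    show "poly P (t i) \<in> L" by (rule sring_poly[OF Lr cP t(2)[OF i]])
  qed
  finally show ?thesis .
qed

section \<open>Explicit generators of the ideals for p = 5 and p = 11\<close>

lemma lessThan_4_nat: "{..<4::nat} = {0, 1, 2, 3}"
  and lessThan_10_nat: "{..<10::nat} = {0, 1, 2, 3, 4, 5, 6, 7, 8, 9}"
  and interval_5_nat: "{1..<5::nat} = {1, 2, 3, 4}"
  and interval_11_nat: "{1..<11::nat} = {1, 2, 3, 4, 5, 6, 7, 8, 9, 10}"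
  by (auto simp: set_eq_iff, presburger+)

lemma noether_cyclic_5:
  fixes \<tau> :: "'f::field \<Rightarrow> 'f"
  assumes "of_nat 5 \<noteq> (0 :: 'f)" "field_hom \<tau>" "\<And>i. i < 5 \<Longrightarrow> \<tau> (x i) = x (Suc i mod 5)"
    "\<And>a. a \<in> K \<Longrightarrow> \<tau> a = a" "sfield L" "\<And>i. i \<in> {1..<5} \<Longrightarrow> x i \<in> L" "\<not> algebraic_over L (x 0)"
  shows "\<exists>B. finite B \<and> card B \<le> 5 \<and> B \<subseteq> field_adjoin K (x ` {..<5}) \<and> (\<forall>b\<in>B. \<tau> b = b) \<and>
    (\<forall>f\<in>field_adjoin K (x ` {..<5}). \<tau> f = f \<longrightarrow> f \<in> field_adjoin K B)"
proof -
  \<comment> \<open>With c = 1 norm element removed, \<open>al\<close> is -1 + t + t^2. Its values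
    at t = 1, -1, i are 1, -1, i - 2; the last has norm 5, and at t = g = 2 the value is 5.\<close>
  interpret cyclic_action 5 2 4 1 4 10 "(!) [0, 2, 2, 1]" "(!) [2, 0, 1, 0]" "(!) [0, 3, 2, 4]" \<tau> x K L
  proof
    show "prime (5 :: nat)" by simp
    show "\<exists>j<4. [s = 2 ^ j] (mod 5)" if "s \<in> {1..<5}" for s :: nat
    proof -
      have "s \<in> (\<lambda>j. 2 ^ j mod 5) ` {..<4}"
        using that unfolding interval_5_nat lessThan_4_nat by auto
      then show ?thesis by (auto simp: cong_def)
    qed
    show "(\<Sum>i<4. [2, 0, 1, 0] ! i * [0, 2, 2, 1] ! ((q + 4 - i) mod 4)) + (if q = 0 then 2 else 0)
      = 4 + (if q = 1 then 1 else 0 :: nat)"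
      if "q < 4" for q
    proof -
      have "q \<in> {..<4}" using that by simp
      then show ?thesis unfolding lessThan_4_nat by (elim insertE emptyE) simp_all
    qed
    show "(\<Sum>i<4. [0, 3, 2, 4] ! i * [0, 2, 2, 1] ! ((q + 4 - i) mod 4))
      = 10 + (if q = 0 then 5 else 0 :: nat)"
      if "q < 4" for q
    proof -
      have "q \<in> {..<4}" using that by simp
      then show ?thesis unfolding lessThan_4_nat by (elim insertE emptyE) simp_all
    qed
    show "[2 ^ 4 = 1] (mod (5::nat))" by (simp add: cong_def)
    show "(5::nat) dvd (\<Sum>j<4. 2 ^ j)" "(\<Sum>j<4. [0, 2, 2, 1] ! j) = 1 + 4 * (1::nat)"
      "(5::nat) dvd (\<Sum>j<4. [0, 2, 2, 1] ! j * 2 ^ j)"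
      unfolding lessThan_4_nat by simp_all
  qed (use assms in auto)
  let ?B = "insert (\<Sum>i<5. x i) (w ` {1..<5})"
  have "card ?B \<le> Suc (card (w ` {1..<5}))" by (rule card_insert_le_m1) auto
  moreover have "card (w ` {1..<5}) \<le> 4" using card_image_le[of "{1..<5}" w] by simp
  moreover have "?B \<subseteq> field_adjoin K (x ` {..<5})"
    using w(1) sring_sum[OF sring_Kx, of "{..<5}" x] x_Kx unfolding Kx_def by blast
  ultimately show ?thesis
    using invariants \<tau>_w \<tau>_y0 unfolding y0_def by (intro exI[of _ ?B]) auto
qed

text \<open>The last clause is quantified over all homomorphisms because it is applied to powers of
  the multiplication as well as to the multiplication itself.\<close>

lemma noether_cyclic_11:
  fixes \<tau> :: "'f::field \<Rightarrow> 'f"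
  assumes "of_nat 11 \<noteq> (0 :: 'f)" "field_hom \<tau>" "\<And>i. i < 11 \<Longrightarrow> \<tau> (x i) = x (Suc i mod 11)"
    "\<And>a. a \<in> K \<Longrightarrow> \<tau> a = a" "sfield L" "\<And>i. i \<in> {1..<11} \<Longrightarrow> x i \<in> L" "\<not> algebraic_over L (x 0)"
  shows "\<exists>w. (\<forall>s\<in>{1..<11}. w s \<in> field_adjoin K (x ` {..<11})) \<and> (\<forall>s\<in>{1..<11}. \<tau> (w s) = w s) \<and>
    \<tau> (\<Sum>i<11. x i) = (\<Sum>i<11. x i) \<and>
    (\<forall>f\<in>field_adjoin K (x ` {..<11}). \<tau> f = f \<longrightarrow> f \<in> field_adjoin K (insert (\<Sum>i<11. x i) (w ` {1..<11}))) \<and>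
    (\<forall>\<kappa> r. field_hom \<kappa> \<and> \<not> 11 dvd r \<and> (\<forall>i<11. \<kappa> (x i) = x (r * i mod 11)) \<longrightarrow>
       (\<forall>s\<in>{1..<11}. \<kappa> (w s) = w (r * s mod 11)))"
proof -
  \<comment> \<open>With one norm element removed, \<open>?al\<close> is -1 + t^2 - t^3 + t^5 + t^9.
    It takes the value 1 at t = 1, -1 at t = -1, and 539 = 49 * 11 at the primitive root t =
    2.\<close>
  let ?al = "[0, 1, 2, 0, 1, 2, 1, 1, 1, 2] :: nat list" and ?ga = "[1, 1, 2, 0, 0, 0, 2, 2, 1, 0] :: nat list"
  let ?de = "[8, 7, 1, 9, 13, 15, 5, 0, 3, 10] :: nat list"
  interpret cyclic_action 11 2 10 1 10 77 "(!) ?al" "(!) ?ga" "(!) ?de" \<tau> x K L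
  proof
    show "prime (11 :: nat)" by simp
    show "\<exists>j<10. [s = 2 ^ j] (mod 11)" if "s \<in> {1..<11}" for s :: nat
    proof -
      have "s \<in> (\<lambda>j. 2 ^ j mod 11) ` {..<10}"
        using that unfolding interval_11_nat lessThan_10_nat by auto
      then show ?thesis by (auto simp: cong_def)
    qed
    show "(\<Sum>i<10. ?ga ! i * ?al ! ((q + 10 - i) mod 10)) + (if q = 0 then 2 else 0)
      = 10 + (if q = 1 then 1 else 0 :: nat)"
      if "q < 10" for q
    proof -
      have "q \<in> {..<10}" using that by simp
      then show ?thesis unfolding lessThan_10_nat by (elim insertE emptyE) simp_all
    qed
    show "(\<Sum>i<10. ?de ! i * ?al ! ((q + 10 - i) mod 10)) = 77 + (if q = 0 then 11 else 0 :: nat)"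
      if "q < 10" for q
    proof -
      have "q \<in> {..<10}" using that by simp
      then show ?thesis unfolding lessThan_10_nat by (elim insertE emptyE) simp_all
    qed
    show "[2 ^ 10 = 1] (mod (11::nat))" by (simp add: cong_def)
    show "(11::nat) dvd (\<Sum>j<10. 2 ^ j)" "(\<Sum>j<10. ?al ! j) = 1 + 10 * 1" "11 dvd (\<Sum>j<10. ?al ! j * 2 ^ j)"
      unfolding lessThan_10_nat by simp_all
  qed (use assms in auto)
  show ?thesis
    using w(1) \<tau>_w \<tau>_y0 invariants w_equivariant unfolding y0_def Kx_def
    by (intro exI[of _ w]) auto
qed

lemma of_nat_eq_char_p:
  assumes "prime p" "of_nat p = (0 :: 'f::field)"
  shows "(of_nat i :: 'f) = of_nat j \<longleftrightarrow> [i = j] (mod p)"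
proof -
  have "CHAR('f) dvd p" using assms(2) by (simp add: of_nat_eq_0_iff_char_dvd)
  moreover have "CHAR('f) \<noteq> 1" by simp
  ultimately have "CHAR('f) = p" using assms(1) by (auto simp: prime_nat_iff)
  then show ?thesis by (simp add: of_nat_eq_iff_cong_CHAR)
qed

section \<open>Moments and an Artin-Schreier generator\<close>

locale cyclic_char_p = prime_cyc +
  fixes \<tau> :: "'f::field \<Rightarrow> 'f" and x :: "nat \<Rightarrow> 'f" and K :: "'f set"
  assumes char: "of_nat p = (0 :: 'f)"
    and \<tau>: "field_hom \<tau>" and \<tau>_x: "\<And>i. i < p \<Longrightarrow> \<tau> (x i) = x (Suc i mod p)"
    and \<tau>_K: "\<And>a. a \<in> K \<Longrightarrow> \<tau> a = a"
    and sum_nz: "(\<Sum>i<p. x i) \<noteq> 0"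
begin

definition e0 :: 'f where "e0 = (\<Sum>i<p. x i)"
definition \<theta> :: 'f where "\<theta> = (\<Sum>i<p. of_nat i * x i) / e0"
text \<open>Central moments: the \<open>x i\<close> are weights at the points i of the prime field
  and \<theta> is their mean. The cycle shifts points and mean alike, so these moments are
  invariant.\<close>

definition et :: "nat \<Rightarrow> 'f" where "et j = (\<Sum>i<p. x i * (of_nat i - \<theta>) ^ j)"
text \<open>In characteristic p this is \<theta>^p - \<theta>; the conjugates \<theta> - i only
  permute the factors.\<close>

definition \<rho> :: 'f where "\<rho> = (\<Prod>i<p. \<theta> - of_nat i)"
text \<open>The first central moment is zero, which leaves position 1 free for \<rho>. Thus p
  generators suffice.\<close>

definition gen :: "nat \<Rightarrow> 'f" where "gen j = (if j = 0 then e0 else if j = 1 then \<rho> else et j)"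

lemma of_nat_eq: "(of_nat i :: 'f) = of_nat j \<longleftrightarrow> [i = j] (mod p)"
  by (rule of_nat_eq_char_p[OF prime char])

lemma of_nat_mod: "(of_nat (i mod p) :: 'f) = of_nat i"
  by (simp add: of_nat_eq cong_def)

lemma \<tau>_e0: "\<tau> e0 = e0"
  unfolding e0_def hom_sum[OF \<tau>] using sum.reindex_bij_betw[OF bij_betw_Suc_mod[OF p_pos], of x] \<tau>_x by simp

lemma \<tau>_\<theta>: "\<tau> \<theta> = \<theta> - 1"
proof -
  have "\<tau> (\<Sum>i<p. of_nat i * x i) = (\<Sum>i<p. (of_nat (Suc i mod p) - 1) * x (Suc i mod p))"
    by (simp add: hom_sum[OF \<tau>] hom_mult[OF \<tau>] hom_of_nat[OF \<tau>] \<tau>_x of_nat_mod)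
  also have "\<dots> = (\<Sum>i<p. (of_nat i - 1) * x i)"
    by (rule sum.reindex_bij_betw[OF bij_betw_Suc_mod[OF p_pos]])
  also have "\<dots> = (\<Sum>i<p. of_nat i * x i) - e0"
    by (simp add: e0_def algebra_simps sum_subtractf)
  finally show ?thesis
    using sum_nz unfolding \<theta>_def hom_divide[OF \<tau>] \<tau>_e0 by (simp add: e0_def diff_divide_distrib)
qed

lemma \<tau>_et: "\<tau> (et j) = et j"
proof -
  have "\<tau> (et j) = (\<Sum>i<p. x (Suc i mod p) * (of_nat (Suc i mod p) - \<theta>) ^ j)"
    by (simp add: et_def hom_simps[OF \<tau>] \<tau>_x \<tau>_\<theta> of_nat_mod algebra_simps)
  also have "\<dots> = et j" unfolding et_def by (rule sum.reindex_bij_betw[OF bij_betw_Suc_mod[OF p_pos]])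
  finally show ?thesis .
qed

lemma \<tau>_\<rho>: "\<tau> \<rho> = \<rho>"
proof -
  have "\<tau> \<rho> = (\<Prod>i<p. \<theta> - of_nat (Suc i mod p))"
    by (simp add: \<rho>_def hom_simps[OF \<tau>] \<tau>_\<theta> of_nat_mod algebra_simps)
  also have "\<dots> = \<rho>" unfolding \<rho>_def by (rule prod.reindex_bij_betw[OF bij_betw_Suc_mod[OF p_pos]])
  finally show ?thesis .
qed

lemma \<tau>_gen: "\<tau> (gen j) = gen j"
  by (simp add: gen_def \<tau>_e0 \<tau>_\<rho> \<tau>_et)

lemma et_0: "et 0 = e0"
  by (simp add: et_def e0_def)

lemma et_1: "et 1 = 0"
proof -
  have "et 1 = (\<Sum>i<p. of_nat i * x i) - e0 * \<theta>"
    unfolding et_def e0_def sum_distrib_right sum_subtractf[symmetric] by (simp add: algebra_simps)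
  then show ?thesis using sum_nz by (simp add: \<theta>_def e0_def)
qed

lemma gen_mem: "gen j \<in> field_adjoin K (x ` {..<p})"
proof -
  have x: "x i \<in> field_adjoin K (x ` {..<p})" if "i < p" for i
    using that adjoin_gens[of "x ` {..<p}" K] by auto
  note cl = sfield_closed[OF sfield_adjoin]
  have e0: "e0 \<in> field_adjoin K (x ` {..<p})" unfolding e0_def using x by (intro cl) auto
  then have \<theta>: "\<theta> \<in> field_adjoin K (x ` {..<p})" unfolding \<theta>_def using x by (intro cl) auto
  then show ?thesis unfolding gen_def \<rho>_def et_def using e0 x by (auto intro!: cl)
qed

text \<open>Adjoining \<theta> to F0 recovers all variables, since the moments form a Vandermonde
  system at the distinct points i - \<theta>. As \<theta> has p distinct conjugates and satisfies a
  monic equation of degree p over F0, the invariants lie in F0.\<close>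

lemma invariants:
  assumes "f \<in> field_adjoin K (x ` {..<p})" "\<tau> f = f"
  shows "f \<in> field_adjoin K (gen ` {..<p})"
proof -
  define F0 where "F0 = field_adjoin K (gen ` {..<p})"
  have F0: "sfield F0" unfolding F0_def by (rule sfield_adjoin)
  note cl = sfield_closed[OF F0]
  have gF: "gen j \<in> F0" if "j < p" for j
    unfolding F0_def using that adjoin_gens[of "gen ` {..<p}" K] by auto
  have \<rho>F: "\<rho> \<in> F0" using gF[of 1] p_gt_1 by (simp add: gen_def)
  have etF: "et j \<in> F0" if "j < p" for j
  proof (cases "j = 1")
    case True
    then show ?thesis using et_1 cl(1) by simp
  next
    case False
    then show ?thesis using gF[OF that] et_0 by (cases "j = 0") (auto simp: gen_def)
  qed
  define L where "L = field_adjoin F0 {\<theta>}"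
  have L: "sfield L" "F0 \<subseteq> L" "\<theta> \<in> L"
    unfolding L_def using sfield_adjoin adjoin_base adjoin_gens by blast+
  have "x i \<in> L" if "i < p" for i
  proof (rule vandermonde_mem[where t = "\<lambda>i. of_nat i - \<theta>" and m = p])
    show "inj_on (\<lambda>i. of_nat i - \<theta>) {..<p}" by (auto simp: inj_on_def of_nat_eq cong_def)
    show "(\<Sum>i<p. x i * (of_nat i - \<theta>) ^ j) \<in> L" if "j < p" for j
      using etF[OF that] L(2) by (auto simp: et_def)
  qed (use L that in \<open>auto intro!: sfield_closed[OF L(1)]\<close>)
  moreover have "K \<subseteq> L" using L(2) adjoin_base[of K] unfolding F0_def by blast
  ultimately have "field_adjoin K (x ` {..<p}) \<subseteq> L" by (intro adjoin_least L) auto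
  then have fL: "f \<in> field_adjoin F0 {\<theta>}" using assms(1) unfolding L_def by blast
  have \<tau>F: "\<tau> a = a" if "a \<in> F0" for a
    using that unfolding F0_def by (rule hom_fixes_adjoin[OF \<tau>, rotated 2]) (auto simp: \<tau>_K \<tau>_gen)
  have pow: "(\<tau> ^^ i) \<theta> = \<theta> - of_nat i" for i
    by (induction i) (auto simp: hom_diff[OF \<tau>] \<tau>_\<theta> hom_of_nat[OF \<tau>])
  \<comment> \<open>This is X^p - X - \<rho>, written so that vanishing at \<theta> holds by the
    definition of \<rho>.\<close>
  define Q where "Q = (\<Prod>i<p. [:- of_nat i, 1:]) - [:\<rho>:]"
  have deg: "degree (\<Prod>i<m. [:- of_nat i :: 'f, 1:]) = m" for m
    by (subst degree_prod_eq_sum_degree) auto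
  have lc: "lead_coeff (\<Prod>i<m. [:- of_nat i :: 'f, 1:]) = 1" for m
    by (simp add: lead_coeff_prod)
  have degQ: "degree Q = p"
  proof -
    have "Q = (\<Prod>i<p. [:- of_nat i, 1:]) + [:- \<rho>:]" unfolding Q_def by (simp flip: diff_conv_add_uminus add: minus_pCons)
    then show ?thesis
      using degree_add_eq_left[of "[:- \<rho>:]" "\<Prod>i<p. [:- of_nat i, 1:]"] deg[of p] p_pos by simp
  qed
  have lcQ: "coeff Q p = 1"
    using lc[of p] deg[of p] p_pos by (simp add: Q_def coeff_pCons split: nat.splits)
  have "coeff (\<Prod>i<m. [:- of_nat i, 1:]) j \<in> F0" for m j
  proof (induction m arbitrary: j)
    case (Suc m)
    have "(\<Prod>i<Suc m. [:- of_nat i :: 'f, 1:]) = smult (- of_nat m) (\<Prod>i<m. [:- of_nat i, 1:]) + pCons 0 (\<Prod>i<m. [:- of_nat i, 1:])"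
      by (simp add: mult.commute)
    then show ?case using Suc cl by (auto simp: coeff_pCons intro!: cl split: nat.splits)
  qed (auto simp: coeff_1 cl)
  then have cQ: "coeff Q j \<in> F0" for j
    unfolding Q_def using \<rho>F by (auto simp: coeff_pCons intro!: cl split: nat.splits)
  have "f \<in> F0"
  proof (rule adjoin_root_invariant[OF F0 \<tau> \<tau>F _ _ p_pos _ degQ lcQ cQ _ _ p_pos fL assms(2)])
    show "\<tau> \<theta> = poly [:-1, 1:] \<theta>" by (simp add: \<tau>_\<theta>)
    show "coeff [:-1, 1:] i \<in> F0" for i
      by (auto simp: coeff_pCons intro!: cl split: nat.splits)
    show "(\<tau> ^^ p) \<theta> = \<theta>" by (simp add: pow char)
    show "poly Q \<theta> = 0" by (simp add: Q_def poly_prod \<rho>_def)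
    show "inj_on (\<lambda>i. (\<tau> ^^ i) \<theta>) {..<p}" by (auto simp: inj_on_def pow of_nat_eq cong_def)
  qed
  then show ?thesis unfolding F0_def .
qed

section \<open>Multiplications acting on the moments\<close>

context
  fixes \<kappa> :: "'f \<Rightarrow> 'f" and r :: nat
  assumes \<kappa>: "field_hom \<kappa>" and r: "\<not> p dvd r" and \<kappa>_x: "\<And>i. i < p \<Longrightarrow> \<kappa> (x i) = x (r * i mod p)"
begin

lemma of_nat_r: "of_nat r \<noteq> (0 :: 'f)"
  using of_nat_eq[of r 0] r by (simp add: cong_0_iff)

lemma \<kappa>_e0: "\<kappa> e0 = e0"
  unfolding e0_def hom_sum[OF \<kappa>] using sum.reindex_bij_betw[OF bij_mult_mod(1)[OF r], of x] \<kappa>_x by simp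

text \<open>Reindexing by i -> r i replaces the point i by i / r. So \<theta> has weight -1, the
  j-th moment weight -j and \<rho> weight -p as powers of r.\<close>

lemma \<kappa>_\<theta>: "\<kappa> \<theta> = \<theta> / of_nat r"
proof -
  have "\<kappa> (\<Sum>i<p. of_nat i * x i) = (\<Sum>i<p. (of_nat (r * i mod p) / of_nat r) * x (r * i mod p))"
    using of_nat_r by (simp add: hom_simps[OF \<kappa>] \<kappa>_x of_nat_mod)
  also have "\<dots> = (\<Sum>i<p. (of_nat i / of_nat r) * x i)"
    by (rule sum.reindex_bij_betw[OF bij_mult_mod(1)[OF r]])
  finally show ?thesis
    unfolding \<theta>_def hom_divide[OF \<kappa>] \<kappa>_e0 by (simp add: sum_divide_distrib[symmetric] field_simps)
qed

lemma \<kappa>_et: "\<kappa> (et j) = et j / of_nat r ^ j"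
proof -
  have "\<kappa> (et j) = (\<Sum>i<p. x (r * i mod p) * ((of_nat (r * i mod p) - \<theta>) / of_nat r) ^ j)"
    using of_nat_r by (simp add: et_def hom_simps[OF \<kappa>] \<kappa>_x \<kappa>_\<theta> of_nat_mod field_simps)
  also have "\<dots> = (\<Sum>i<p. x i * ((of_nat i - \<theta>) / of_nat r) ^ j)"
    by (rule sum.reindex_bij_betw[OF bij_mult_mod(1)[OF r]])
  finally show ?thesis by (simp add: et_def power_divide sum_divide_distrib)
qed

lemma \<kappa>_\<rho>: "\<kappa> \<rho> = \<rho> / of_nat r ^ p"
proof -
  have "\<kappa> \<rho> = (\<Prod>i<p. (\<theta> - of_nat (r * i mod p)) / of_nat r)"
    using of_nat_r by (simp add: \<rho>_def hom_simps[OF \<kappa>] \<kappa>_\<theta> of_nat_mod diff_divide_distrib)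
  also have "\<dots> = (\<Prod>i<p. (\<theta> - of_nat i) / of_nat r)"
    by (rule prod.reindex_bij_betw[OF bij_mult_mod(1)[OF r]])
  finally show ?thesis by (simp add: \<rho>_def prod_dividef)
qed

end

end

section \<open>Invariants of involutions and of cycles of length five\<close>

text \<open>Without the summand \<open>(u + v) U V\<close> of \<open>b\<close>, the sums of the \<open>a i\<close> and \<open>b i\<close> would not determine
  \<open>U V\<close> in characteristic 2.\<close>

lemma pair_invariants:
  fixes u v :: "nat \<Rightarrow> 'f::field" and m :: nat
  defines "U \<equiv> \<Sum>i<m. u i" and "V \<equiv> \<Sum>i<m. v i"
  defines "a \<equiv> \<lambda>i. u i + v i"
  defines "b \<equiv> \<lambda>i. u i * U + v i * V + (u i + v i) * (U * V)"
  assumes \<sigma>: "field_hom \<sigma>" "\<And>c. c \<in> K \<Longrightarrow> \<sigma> c = c" "\<And>i. i < m \<Longrightarrow> \<sigma> (u i) = v i" "\<And>i. i < m \<Longrightarrow> \<sigma> (v i) = u i"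
    and nz: "U \<noteq> V" "U + V \<noteq> 2"
    and f: "f \<in> field_adjoin K (u ` {..<m} \<union> v ` {..<m})" "\<sigma> f = f"
  shows "f \<in> field_adjoin K (a ` {..<m} \<union> b ` {..<m})"
proof -
  define F0 where "F0 = field_adjoin K (a ` {..<m} \<union> b ` {..<m})"
  have F0: "sfield F0" unfolding F0_def by (rule sfield_adjoin)
  note cl = sfield_closed[OF F0]
  have ab: "a i \<in> F0" "b i \<in> F0" if "i < m" for i
    unfolding F0_def using that adjoin_gens[of "a ` {..<m} \<union> b ` {..<m}" K] by auto
  have \<sigma>U: "\<sigma> U = V" "\<sigma> V = U" unfolding U_def V_def hom_sum[OF \<sigma>(1)] using \<sigma>(3,4) by auto
  have "\<sigma> (a i) = a i" "\<sigma> (b i) = b i" if "i < m" for i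
    using \<sigma>U \<sigma>(3,4)[OF that] by (simp_all add: a_def b_def hom_simps[OF \<sigma>(1)] mult_ac add_ac)
  then have \<sigma>F0: "\<sigma> c = c" if "c \<in> F0" for c
    using that unfolding F0_def by (rule_tac hom_fixes_adjoin[OF \<sigma>(1), rotated 2]) (auto simp: \<sigma>(2))
  have A: "U + V \<in> F0"
  proof -
    have "U + V = (\<Sum>i<m. a i)" by (simp add: U_def V_def a_def sum.distrib)
    also have "\<dots> \<in> F0" using ab by (intro cl) auto
    finally show ?thesis .
  qed
  have P: "U * V \<in> F0"
  proof -
    have "(\<Sum>i<m. b i) = (\<Sum>i<m. u i) * U + (\<Sum>i<m. v i) * V + ((\<Sum>i<m. u i) + (\<Sum>i<m. v i)) * (U * V)"
      unfolding b_def sum_distrib_right sum.distrib[symmetric] ..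
    then have "(\<Sum>i<m. b i) = U * U + V * V + (U + V) * (U * V)" by (simp add: U_def V_def)
    then have "(\<Sum>i<m. b i) - (U + V) * (U + V) = (U * V) * (U + V - 2)" by (simp add: algebra_simps)
    then have "U * V = ((\<Sum>i<m. b i) - (U + V) * (U + V)) / (U + V - (1 + 1))" using nz(2) by simp
    moreover have "(\<Sum>i<m. b i) \<in> F0" using ab(2) by (intro cl) auto
    then have "((\<Sum>i<m. b i) - c * c) / (c - (1 + 1)) \<in> F0" if "c \<in> F0" for c
      using that by (intro cl(2-4) cl(6) sfield_divide F0)
    ultimately show ?thesis using A by metis
  qed
  define L where "L = field_adjoin F0 {U}"
  have L: "sfield L" "F0 \<subseteq> L" "U \<in> L"
    unfolding L_def using sfield_adjoin adjoin_base adjoin_gens by blast+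
  note clL = sfield_closed[OF L(1)]
  have VL: "V \<in> L" using sring_diff[OF sfield_sring[OF L(1)], of "U + V" U] L A by auto
  have uv: "u i \<in> L" "v i \<in> L" if i: "i < m" for i
  proof -
    \<comment> \<open>\<open>a i\<close> and \<open>u i * U + v i * V\<close> are two linear
      equations for the pair; eliminating \<open>v i\<close> leaves the factor U - V.\<close>
    have "u i * (U - V) = b i - a i * (U * V) - a i * V" by (simp add: a_def b_def algebra_simps)
    then have "u i = (b i - a i * (U * V) - a i * V) / (U - V)" using nz(1) by (simp add: field_simps)
    also have "\<dots> \<in> L" using ab[OF i] L P VL by (intro clL) auto
    finally show "u i \<in> L" .
    then have "a i - u i \<in> L" using ab[OF i] L by (intro clL) auto
    then show "v i \<in> L" by (simp add: a_def)
  qed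
  have "K \<subseteq> L" using L(2) adjoin_base[of K] unfolding F0_def by blast
  then have fL: "f \<in> field_adjoin F0 {U}"
    using f(1) adjoin_least[OF L(1), of K "u ` {..<m} \<union> v ` {..<m}"] uv unfolding L_def by blast
  have "f \<in> F0"
  proof (rule adjoin_root_invariant[OF F0 \<sigma>(1) \<sigma>F0 _ _ _ _ _ _ _ _ _ _ fL f(2)])
    show "\<sigma> U = poly [:U + V, -1:] U" by (simp add: \<sigma>U)
    show "coeff [:U + V, -1:] i \<in> F0" for i
      using A by (auto simp: coeff_pCons intro!: cl split: nat.splits)
    show "(\<sigma> ^^ 2) U = U" by (simp add: numeral_2_eq_2 \<sigma>U)
    let ?Q = "[:U * V, - (U + V), 1:]"
    show "degree ?Q = 2" "coeff ?Q 2 = 1" by (simp_all add: numeral_2_eq_2)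
    show "coeff ?Q i \<in> F0" for i
      using A P sring_uminus[OF sfield_sring[OF F0] A]
      by (auto simp: coeff_pCons intro: cl(1,2) split: nat.splits)
    show "poly ?Q U = 0" by (simp add: algebra_simps)
    show "inj_on (\<lambda>i. (\<sigma> ^^ i) U) {..<2}"
      using nz(1) by (auto simp: inj_on_def less_2_cases_iff \<sigma>U)
  qed auto
  then show ?thesis unfolding F0_def .
qed

section \<open>One 5-cycle, and two parallel ones\<close>

lemma noether_cyclic_5_all:
  fixes \<tau> :: "'f::field \<Rightarrow> 'f"
  assumes \<tau>: "field_hom \<tau>" "\<And>i. i < 5 \<Longrightarrow> \<tau> (x i) = x (Suc i mod 5)" "\<And>a. a \<in> K \<Longrightarrow> \<tau> a = a"
    and L: "sfield L" "\<And>i. i \<in> {1..<5} \<Longrightarrow> x i \<in> L" "\<not> algebraic_over L (x 0)"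
    and nz: "(\<Sum>i<5. x i) \<noteq> 0"
  shows "\<exists>B. finite B \<and> card B \<le> 5 \<and> B \<subseteq> field_adjoin K (x ` {..<5}) \<and> (\<forall>b\<in>B. \<tau> b = b) \<and>
    (\<forall>f\<in>field_adjoin K (x ` {..<5}). \<tau> f = f \<longrightarrow> f \<in> field_adjoin K B)"
proof (cases "of_nat 5 = (0 :: 'f)")
  case True
  interpret cyclic_char_p 5 \<tau> x K
    by unfold_locales (use assms True in \<open>simp_all\<close>)
  show ?thesis
    using gen_mem \<tau>_gen invariants card_image_le[of "{..<5}" gen]
    by (intro exI[of _ "gen ` {..<5}"]) auto
next
  case False
  then show ?thesis by (intro noether_cyclic_5[OF _ \<tau> L]) auto
qed

lemma adjoin_insert_not_mem:
  assumes "alg_free K B" "b \<in> B" "b = c" "c \<in> field_adjoin K (B - {b})"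
  shows False
  using assms adjoin_subset_hull[of K "B - {b}"] unfolding alg_free_def by blast

text \<open>The moments \<open>\<Sum>i<5. b i * a i ^ j\<close> are invariant because both families
  rotate together, and over the \<open>a i\<close> they determine the \<open>b i\<close> by
  Vandermonde. They replace the second family, and with c they form an invariant base field K', over
  which a single 5-cycle remains. The count is 1 + 5 + 5.\<close>

lemma cyclic_pair_invariants:
  fixes \<tau> :: "'f::field \<Rightarrow> 'f" and a b :: "nat \<Rightarrow> 'f"
  assumes free: "alg_free K (insert c (a ` {..<5} \<union> b ` {..<5}))"
    and card: "card (insert c (a ` {..<5} \<union> b ` {..<5})) = 11"
    and \<tau>: "field_hom \<tau>" "\<And>z. z \<in> K \<Longrightarrow> \<tau> z = z" "\<tau> c = c"
      "\<And>i. i < 5 \<Longrightarrow> \<tau> (a i) = a (Suc i mod 5)" "\<And>i. i < 5 \<Longrightarrow> \<tau> (b i) = b (Suc i mod 5)"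
  defines "E \<equiv> field_adjoin K (insert c (a ` {..<5} \<union> b ` {..<5}))"
  shows "\<exists>B. finite B \<and> card B \<le> 11 \<and> B \<subseteq> E \<and> (\<forall>z\<in>B. \<tau> z = z) \<and>
    (\<forall>f\<in>E. \<tau> f = f \<longrightarrow> f \<in> field_adjoin K B)"
proof -
  let ?S = "insert c (a ` {..<5} \<union> b ` {..<5})"
  have ca: "card (a ` {..<5}) = 5" and inj: "inj_on a {..<5}"
  proof -
    have "card ?S \<le> Suc (card (a ` {..<5} \<union> b ` {..<5}))" by (rule card_insert_le_m1) auto
    also have "card (a ` {..<5} \<union> b ` {..<5}) \<le> card (a ` {..<5}) + card (b ` {..<5})" by (rule card_Un_le)
    also have "card (b ` {..<5}) \<le> 5" using card_image_le[of "{..<5}" b] by simp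
    finally have "5 \<le> card (a ` {..<5})" using card by simp
    moreover have "card (a ` {..<5}) \<le> 5" using card_image_le[of "{..<5}" a] by simp
    ultimately show "card (a ` {..<5}) = 5" by simp
    then show "inj_on a {..<5}" by (intro eq_card_imp_inj_on) auto
  qed
  define L where "L = field_adjoin K (?S - {a 0})"
  have L: "sfield L" unfolding L_def by (rule sfield_adjoin)
  have aL: "a i \<in> L" if "i \<in> {1..<5}" for i
  proof -
    have "a i \<noteq> a 0" using inj_onD[OF inj, of i 0] that by auto
    then show ?thesis unfolding L_def using that adjoin_gens[of "?S - {a 0}" K] by auto
  qed
  have a0: "\<not> algebraic_over L (a 0)"
    using free unfolding alg_free_def alg_hull_def L_def by auto
  have nz: "(\<Sum>i<5. a i) \<noteq> 0"
  proof
    assume "(\<Sum>i<5. a i) = 0"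
    moreover have "(\<Sum>i<5. a i) = a 0 + (\<Sum>i\<in>{1..<5}. a i)"
      unfolding lessThan_atLeast0 by (subst sum.atLeast_Suc_lessThan) auto
    ultimately have "a 0 = - (\<Sum>i\<in>{1..<5}. a i)" by (simp only: add_eq_0_iff2)
    then show False
      by (rule adjoin_insert_not_mem[OF free, rotated])
        (use aL in \<open>auto simp: L_def intro!: sfield_closed sfield_adjoin\<close>)
  qed
  define n where "n j = (\<Sum>i<5. b i * a i ^ j)" for j :: nat
  define K' where "K' = field_adjoin K (insert c (n ` {..<5}))"
  have "bij_betw (\<lambda>i. Suc i mod 5) {..<5} {..<5}" by (rule bij_betw_Suc_mod) simp
  then have \<tau>n: "\<tau> (n j) = n j" for j
    unfolding n_def hom_sum[OF \<tau>(1)] hom_mult[OF \<tau>(1)] hom_power[OF \<tau>(1)]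
    using sum.reindex_bij_betw[of "\<lambda>i. Suc i mod 5" "{..<5}" "{..<5}" "\<lambda>i. b i * a i ^ j"] \<tau>(4,5) by simp
  have \<tau>K': "\<tau> z = z" if "z \<in> K'" for z
    by (rule hom_fixes_adjoin[OF \<tau>(1), of K "insert c (n ` {..<5})"]) (use that in \<open>auto simp: \<tau> \<tau>n K'_def\<close>)
  have "\<exists>B. finite B \<and> card B \<le> 5 \<and> B \<subseteq> field_adjoin K' (a ` {..<5}) \<and> (\<forall>z\<in>B. \<tau> z = z) \<and>
      (\<forall>f\<in>field_adjoin K' (a ` {..<5}). \<tau> f = f \<longrightarrow> f \<in> field_adjoin K' B)"
    by (rule noether_cyclic_5_all[OF \<tau>(1,4) \<tau>K' L aL a0 nz])
  then obtain B where B: "finite B" "card B \<le> 5" "B \<subseteq> field_adjoin K' (a ` {..<5})" "\<forall>z\<in>B. \<tau> z = z"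
    "\<forall>f\<in>field_adjoin K' (a ` {..<5}). \<tau> f = f \<longrightarrow> f \<in> field_adjoin K' B"
    by (elim exE conjE) (rule that)
  have K': "insert c (n ` {..<5}) \<subseteq> K'" "K \<subseteq> K'"
    unfolding K'_def by (rule adjoin_gens adjoin_base)+
  have E: "field_adjoin K' (a ` {..<5}) = E"
  proof
    have E: "sfield E" "K \<subseteq> E" "?S \<subseteq> E" unfolding E_def by (rule sfield_adjoin adjoin_base adjoin_gens)+
    note cl = sfield_closed[OF E(1)]
    have "n j \<in> E" for j unfolding n_def using E(3) by (intro cl) auto
    then have "K' \<subseteq> E" unfolding K'_def using E by (intro adjoin_least) auto
    then show "field_adjoin K' (a ` {..<5}) \<subseteq> E" using E by (intro adjoin_least) auto
    let ?M = "field_adjoin K' (a ` {..<5})"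
    have M: "sfield ?M" "K' \<subseteq> ?M" "a ` {..<5} \<subseteq> ?M" by (rule sfield_adjoin adjoin_base adjoin_gens)+
    have nM: "insert c (n ` {..<5}) \<subseteq> ?M" "K \<subseteq> ?M"
      by (rule order_trans[OF K'(1) M(2)], rule order_trans[OF K'(2) M(2)])
    have "b i \<in> ?M" if "i < 5" for i
    proof (rule vandermonde_mem[OF M(1) inj])
      show "(\<Sum>i<5. b i * a i ^ j) \<in> ?M" if "j < 5" for j
        using nM(1) that unfolding n_def by auto
    qed (use M that in auto)
    then show "E \<subseteq> ?M" unfolding E_def using M nM by (intro adjoin_least) auto
  qed
  let ?B = "insert c (n ` {..<5}) \<union> B"
  have "card ?B \<le> card (insert c (n ` {..<5})) + card B" by (rule card_Un_le)
  moreover have "card (insert c (n ` {..<5})) \<le> Suc (card (n ` {..<5}))" by (rule card_insert_le_m1) auto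
  moreover have "card (n ` {..<5}) \<le> 5" using card_image_le[of "{..<5}" n] by simp
  ultimately have "card ?B \<le> 11" using B(2) by simp
  moreover have "field_adjoin K' B = field_adjoin K ?B" unfolding K'_def by (rule adjoin_adjoin)
  moreover have "insert c (n ` {..<5}) \<subseteq> E"
    unfolding E[symmetric] by (rule order_trans[OF K'(1) adjoin_base])
  ultimately show ?thesis
    using B E \<tau>n \<tau>(3) by (intro exI[of _ ?B]) auto
qed

text \<open>The polynomial with zeros \<open>x i\<close> is unchanged by permutations of the
  variables, so its coefficients are invariants and lie in K(B). This supplies the hypothesis for
  exchange.\<close>

lemma permuted_subset_alg_hull:
  fixes x :: "nat \<Rightarrow> 'f::field" and m :: nat
  assumes k: "\<And>\<phi>. \<phi> \<in> S \<Longrightarrow> field_hom \<phi>"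
    and perm: "\<And>\<phi>. \<phi> \<in> S \<Longrightarrow> \<exists>\<pi>. bij_betw \<pi> {..<m} {..<m} \<and> (\<forall>i<m. \<phi> (x i) = x (\<pi> i))"
    and inv: "\<And>f. f \<in> field_adjoin K (x ` {..<m}) \<Longrightarrow> \<forall>\<phi>\<in>S. \<phi> f = f \<Longrightarrow> f \<in> field_adjoin K B"
  shows "x ` {..<m} \<subseteq> alg_hull K B"
proof -
  define P where "P = (\<Prod>i<m. [:- x i, 1:])"
  note cl = sfield_closed[OF sfield_adjoin]
  have xE: "x i \<in> field_adjoin K (x ` {..<m})" if "i < m" for i
    using that adjoin_gens[of "x ` {..<m}" K] by auto
  have "coeff (\<Prod>i<l. [:- x i, 1:]) j \<in> field_adjoin K (x ` {..<m})" if "l \<le> m" for l j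
    using that
  proof (induction l arbitrary: j)
    case (Suc l)
    have "(\<Prod>i<Suc l. [:- x i, 1:]) = smult (- x l) (\<Prod>i<l. [:- x i, 1:]) + pCons 0 (\<Prod>i<l. [:- x i, 1:])"
      by (simp add: mult.commute)
    then show ?case using Suc xE by (auto simp: coeff_pCons intro!: cl split: nat.splits)
  qed (auto simp: coeff_1 cl)
  then have cE: "coeff P j \<in> field_adjoin K (x ` {..<m})" for j unfolding P_def by simp
  have "\<phi> (coeff P j) = coeff P j" if \<phi>: "\<phi> \<in> S" for \<phi> j
  proof -
    obtain \<pi> where \<pi>: "bij_betw \<pi> {..<m} {..<m}" "\<And>i. i < m \<Longrightarrow> \<phi> (x i) = x (\<pi> i)" using perm[OF \<phi>] by blast
    have c: "map_poly \<phi> [:- x i, 1:] = [:- \<phi> (x i), 1:]" for i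
      by (intro poly_eqI) (simp add: coeff_map_hom[OF k[OF \<phi>]] coeff_pCons hom_simps[OF k[OF \<phi>]] split: nat.splits)
    have "map_poly \<phi> P = (\<Prod>i<m. [:- x (\<pi> i), 1:])"
      unfolding P_def map_hom_prod[OF k[OF \<phi>]] c using \<pi>(2) by simp
    also have "\<dots> = P" unfolding P_def by (rule prod.reindex_bij_betw[OF \<pi>(1)])
    finally show ?thesis using coeff_map_hom[OF k[OF \<phi>], of P j] by simp
  qed
  then have "coeff P j \<in> field_adjoin K B" for j using inv cE by blast
  moreover have "P \<noteq> 0" by (simp add: P_def)
  moreover have "poly P (x i) = 0" if "i < m" for i using that by (auto simp: P_def poly_prod)
  ultimately show ?thesis unfolding alg_hull_def algebraic_over_def by auto
qed

section \<open>Metacyclic permutations of eleven variables\<close>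

lemma adjoin_insert: "field_adjoin (field_adjoin K {c}) S = field_adjoin K (insert c S)"
  using adjoin_adjoin[of K "{c}" S] by simp

text \<open>m is the order of r modulo 11: 1, 5, 10, 2 for r = 1, 4, 7, 10. The exponent 11 comes
  from the action on \<rho> in characteristic 11.\<close>

lemma power_mod_cases:
  assumes "r \<in> {1, 4, 7, 10 :: nat}"
  shows "\<exists>m. m \<in> {1..10} \<and> [r ^ m = 1] (mod 11) \<and> [r ^ 11 = r] (mod 11) \<and> inj_on (\<lambda>i. r ^ i mod 11) {..<m}"
proof -
  have inj: "inj_on (\<lambda>i. 1 ^ i mod 11 :: nat) {..<1}" "inj_on (\<lambda>i. 10 ^ i mod 11 :: nat) {..<2}"
    "inj_on (\<lambda>i. 4 ^ i mod 11 :: nat) {..<5}" "inj_on (\<lambda>i. 7 ^ i mod 11 :: nat) {..<10}"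
    by (simp_all add: lessThan_nat_numeral lessThan_Suc inj_on_def)
  consider "r = 1" | "r = 10" | "r = 4" | "r = 7" using assms by auto
  then show ?thesis
  proof cases
    case 1
    then show ?thesis using inj by (intro exI[of _ 1]) (auto simp: cong_def)
  next
    case 2
    then show ?thesis using inj by (intro exI[of _ 2]) (auto simp: cong_def)
  next
    case 3
    then show ?thesis using inj by (intro exI[of _ 5]) (auto simp: cong_def)
  next
    case 4
    then show ?thesis using inj by (intro exI[of _ 10]) (auto simp: cong_def)
  qed
qed

section \<open>Invariants of the group generated by the cycle and a multiplication\<close>

locale metacyclic_action =
  fixes k :: "'f::field set" and x :: "nat \<Rightarrow> 'f" and \<tau> \<kappa> :: "'f \<Rightarrow> 'f" and r :: nat
  assumes x_free: "alg_free k (x ` {..<11})" and x_inj: "inj_on x {..<11}"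
    and \<tau>: "field_hom \<tau>" "\<And>a. a \<in> k \<Longrightarrow> \<tau> a = a" "\<And>i. i < 11 \<Longrightarrow> \<tau> (x i) = x (Suc i mod 11)"
    and \<kappa>: "field_hom \<kappa>" "\<And>a. a \<in> k \<Longrightarrow> \<kappa> a = a" "\<And>i. i < 11 \<Longrightarrow> \<kappa> (x i) = x (r * i mod 11)"
    and r: "r \<in> {1, 4, 7, 10}"
begin

definition E :: "'f set" where "E = field_adjoin k (x ` {..<11})"

lemma card_x: "card (x ` {..<11}) = 11"
  using card_image[OF x_inj] by simp

lemma prime_cyc_11: "prime_cyc 11"
  by unfold_locales simp

lemma not_11_dvd: "\<not> 11 dvd r"
  using r by auto

lemma \<tau>_perm: "\<exists>\<pi>. bij_betw \<pi> {..<11} {..<11} \<and> (\<forall>i<11. \<tau> (x i) = x (\<pi> i))"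
  using \<tau>(3) bij_betw_Suc_mod[of 11] by (intro exI[of _ "\<lambda>i. Suc i mod 11"]) simp

lemma \<kappa>_pow_x: "i < 11 \<Longrightarrow> (\<kappa> ^^ j) (x i) = x (r ^ j * i mod 11)"
proof (induction j)
  case (Suc j)
  then have "(\<kappa> ^^ Suc j) (x i) = x (r * (r ^ j * i mod 11) mod 11)" using \<kappa>(3) by simp
  then show ?case by (simp add: mod_mult_right_eq mult.assoc)
qed simp

lemma \<kappa>_pow_perm: "\<exists>\<pi>. bij_betw \<pi> {..<11} {..<11} \<and> (\<forall>i<11. (\<kappa> ^^ j) (x i) = x (\<pi> i))"
proof -
  have "\<not> 11 dvd r ^ j" using not_11_dvd prime_dvd_power[of "11 :: nat" r j] by auto
  then show ?thesis
    using prime_cyc.bij_mult_mod(1)[OF prime_cyc_11, of "r ^ j"] \<kappa>_pow_x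
    by (intro exI[of _ "\<lambda>i. r ^ j * i mod 11"]) auto
qed

text \<open>The bound on the size stands in for algebraic independence, which exchange then
  provides.\<close>

definition good :: "'f set \<Rightarrow> bool" where
  "good B \<longleftrightarrow> finite B \<and> card B \<le> 11 \<and> B \<subseteq> E \<and> (\<forall>b\<in>B. \<tau> b = b \<and> \<kappa> b = b) \<and>
    (\<forall>f\<in>E. \<tau> f = f \<and> \<kappa> f = f \<longrightarrow> f \<in> field_adjoin k B)"

text \<open>The multiplication scales every generator: \<open>et j\<close> by r^(-j) and \<rho> by
  r^(-11) = r^(-1). So \<rho> can normalise the moments to invariants, and its power \<rho>^m, with
  m the order of r, takes its place.\<close>

lemma good_char_11:
  assumes char: "of_nat 11 = (0 :: 'f)"
  shows "\<exists>B. good B"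
proof -
  have sum_nz: "(\<Sum>i<11. x i) \<noteq> 0"
  proof
    assume "(\<Sum>i<11. x i) = 0"
    moreover have "(\<Sum>i<11. x i) = x 0 + (\<Sum>i\<in>{1..<11}. x i)"
      unfolding lessThan_atLeast0 by (subst sum.atLeast_Suc_lessThan) auto
    ultimately have eq: "x 0 = - (\<Sum>i\<in>{1..<11}. x i)" by (simp only: add_eq_0_iff2)
    have "x i \<in> field_adjoin k (x ` {..<11} - {x 0})" if "i \<in> {1..<11}" for i
      using that inj_onD[OF x_inj, of i 0] adjoin_gens[of "x ` {..<11} - {x 0}" k] by auto
    then have mem: "- (\<Sum>i\<in>{1..<11}. x i) \<in> field_adjoin k (x ` {..<11} - {x 0})"
      by (intro sring_uminus sring_sum sfield_sring sfield_adjoin)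
    show False by (rule adjoin_insert_not_mem[OF x_free _ eq mem]) simp
  qed
  interpret cyclic_char_p 11 \<tau> x k
    by unfold_locales (use char sum_nz \<tau> in simp_all)
  note eq = \<kappa>_e0[OF \<kappa>(1) not_11_dvd \<kappa>(3)] \<kappa>_et[OF \<kappa>(1) not_11_dvd \<kappa>(3)] \<kappa>_\<rho>[OF \<kappa>(1) not_11_dvd \<kappa>(3)]
  have r0: "of_nat r \<noteq> (0 :: 'f)" by (rule of_nat_r[OF \<kappa>(1) not_11_dvd \<kappa>(3)])
  obtain m where m: "m \<in> {1..10}" "[r ^ m = 1] (mod 11)" "[r ^ 11 = r] (mod 11)" "inj_on (\<lambda>i. r ^ i mod 11) {..<m}"
    using power_mod_cases[OF r] by blast
  have rm: "of_nat r ^ m = (1 :: 'f)" and r11: "of_nat r ^ 11 = (of_nat r :: 'f)"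
    using m(2,3) of_nat_eq[of "r ^ m" 1] of_nat_eq[of "r ^ 11" r] by simp_all
  have \<kappa>\<rho>: "\<kappa> \<rho> = \<rho> / of_nat r" using eq(3) r11 by simp
  \<comment> \<open>Freeness of the generators is needed here to divide by \<rho>: zero lies in
    every adjoined field and cannot belong to a free set.\<close>
  have "x ` {..<11} \<subseteq> alg_hull k (gen ` {..<11})"
    by (rule permuted_subset_alg_hull[of "{\<tau>}"]) (use \<tau> \<tau>_perm invariants in auto)
  moreover have "card (gen ` {..<11}) \<le> 11" using card_image_le[of "{..<11}" gen] by simp
  ultimately have free: "alg_free k (gen ` {..<11})"
    using alg_free_exchange(1)[OF x_free, of "gen ` {..<11}"] card_x by simp
  have mem: "\<rho> \<in> gen ` {..<11}" by (rule image_eqI[of _ _ 1]) (auto simp: gen_def)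
  have "\<rho> \<noteq> 0"
  proof
    assume "\<rho> = 0"
    then show False
      using sfield_closed(1)[OF sfield_adjoin] by (rule adjoin_insert_not_mem[OF free mem])
  qed
  define h where "h j = (if j = 0 then e0 else if j = 1 then \<rho> ^ m else et j / \<rho> ^ j)" for j :: nat
  define F1 where "F1 = field_adjoin k (h ` {..<11})"
  have F1: "sfield F1" unfolding F1_def by (rule sfield_adjoin)
  have hF: "h j \<in> F1" if "j < 11" for j
    unfolding F1_def using that adjoin_gens[of "h ` {..<11}" k] by auto
  have \<kappa>h: "\<kappa> (h j) = h j" for j
    using r0 rm by (simp add: h_def eq(1,2) \<kappa>\<rho> hom_simps[OF \<kappa>(1)] power_divide)
  have \<tau>h: "\<tau> (h j) = h j" for j
    by (simp add: h_def \<tau>_e0 \<tau>_et \<tau>_\<rho> hom_simps[OF \<tau>(1)])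
  have \<rho>m: "\<rho> ^ m \<in> F1" using hF[of 1] by (simp add: h_def)
  have \<kappa>F1: "\<kappa> a = a" if "a \<in> F1" for a
    by (rule hom_fixes_adjoin[OF \<kappa>(1), of k "h ` {..<11}"]) (use that \<kappa>(2) \<kappa>h in \<open>auto simp: F1_def\<close>)
  define L where "L = field_adjoin F1 {\<rho>}"
  have L: "sfield L" "F1 \<subseteq> L" "\<rho> \<in> L"
    unfolding L_def using sfield_adjoin adjoin_base adjoin_gens by blast+
  have "gen j \<in> L" if "j < 11" for j
  proof -
    have hL: "h j \<in> L" using hF[OF that] L by blast
    have "gen j = (if j = 0 then h j else if j = 1 then \<rho> else h j * \<rho> ^ j)"
      using \<open>\<rho> \<noteq> 0\<close> by (simp add: gen_def h_def)
    also have "\<dots> \<in> L" using hL L by (auto intro!: sfield_closed)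
    finally show ?thesis .
  qed
  moreover have "k \<subseteq> L" using L(2) adjoin_base[of k] unfolding F1_def by blast
  ultimately have genL: "field_adjoin k (gen ` {..<11}) \<subseteq> L" by (intro adjoin_least L) auto
  have pow: "(\<kappa> ^^ i) \<rho> = \<rho> / of_nat r ^ i" for i
    by (induction i) (auto simp: hom_simps[OF \<kappa>(1)] \<kappa>\<rho>)
  have inv: "f \<in> F1" if f: "f \<in> E" "\<tau> f = f" "\<kappa> f = f" for f
  proof -
    have fL: "f \<in> field_adjoin F1 {\<rho>}" using invariants[of f] f genL unfolding E_def L_def by blast
    show ?thesis
    proof (rule adjoin_root_invariant[OF F1 \<kappa>(1) \<kappa>F1 _ _ _ _ _ _ _ _ _ _ fL f(3)])
      show "\<kappa> \<rho> = poly [:0, inverse (of_nat r):] \<rho>" by (simp add: \<kappa>\<rho> divide_inverse)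
      show "coeff [:0, inverse (of_nat r):] i \<in> F1" for i
        by (auto simp: coeff_pCons intro!: sfield_closed F1 split: nat.splits)
      show "m > 0" "m > 0" using m(1) by auto
      show "(\<kappa> ^^ m) \<rho> = \<rho>" by (simp add: pow rm)
      \<comment> \<open>The Kummer equation X^m = \<rho>^m. The conjugates \<rho> / r^i are distinct
        for i < m because m is the order of r.\<close>
      let ?Q = "monom 1 m + [:- (\<rho> ^ m):]"
      show "degree ?Q = m"
        using m(1) by (subst degree_add_eq_left) (auto simp: degree_monom_eq)
      show "coeff ?Q m = 1" using m(1) by (auto simp: coeff_pCons split: nat.splits)
      show "coeff ?Q i \<in> F1" for i
        using \<rho>m sfield_closed(1,2,5)[OF F1] by (auto simp: coeff_pCons split: nat.splits)
      show "poly ?Q \<rho> = 0" by (simp add: poly_monom)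
      show "inj_on (\<lambda>i. (\<kappa> ^^ i) \<rho>) {..<m}"
      proof (rule inj_onI)
        fix i j assume ij: "i \<in> {..<m}" "j \<in> {..<m}" "(\<kappa> ^^ i) \<rho> = (\<kappa> ^^ j) \<rho>"
        then have "of_nat (r ^ i) = (of_nat (r ^ j) :: 'f)"
          using \<open>\<rho> \<noteq> 0\<close> r0 by (simp add: pow field_simps)
        then have "r ^ i mod 11 = r ^ j mod 11" unfolding of_nat_eq cong_def .
        then show "i = j" using inj_onD[OF m(4)] ij by blast
      qed
    qed
  qed
  have "h j \<in> E" if "j < 11" for j
  proof -
    have g: "gen j \<in> E" for j unfolding E_def by (rule gen_mem)
    have E: "sfield E" unfolding E_def by (rule sfield_adjoin)
    have "\<rho> \<in> E" using g[of 1] by (simp add: gen_def)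
    then have "(if j = 0 then gen j else if j = 1 then \<rho> ^ m else gen j / \<rho> ^ j) \<in> E"
      using g[of j] by (auto intro!: sfield_closed E)
    then show ?thesis by (simp add: h_def gen_def split: if_splits)
  qed
  then have "good (h ` {..<11})"
    unfolding good_def using \<kappa>h \<tau>h inv card_image_le[of "{..<11}" h] unfolding F1_def by auto
  then show ?thesis by blast
qed

text \<open>Once the cycle is divided out, \<kappa> permutes the \<open>w s\<close> by s -> r s and
  fixes y. For r = 10 it swaps two families of five, for r = 4 it rotates both, and r = 7 is treated
  through the powers \<kappa>^5 and \<kappa>^6, which do one each.\<close>

lemma good_not_char_11:
  assumes char: "of_nat 11 \<noteq> (0 :: 'f)"
  shows "\<exists>B. good B"
proof -
  define y where "y = (\<Sum>i<11. x i)"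
  have rest: "x i \<in> field_adjoin k (x ` {..<11} - {x 0})" if "i \<in> {1..<11}" for i
    using that inj_onD[OF x_inj, of i 0] adjoin_gens[of "x ` {..<11} - {x 0}" k] by auto
  have x0: "\<not> algebraic_over (field_adjoin k (x ` {..<11} - {x 0})) (x 0)"
    using x_free unfolding alg_free_def alg_hull_def by auto
  have "\<exists>w. (\<forall>s\<in>{1..<11}. w s \<in> E) \<and> (\<forall>s\<in>{1..<11}. \<tau> (w s) = w s) \<and> \<tau> y = y \<and>
    (\<forall>f\<in>E. \<tau> f = f \<longrightarrow> f \<in> field_adjoin k (insert y (w ` {1..<11}))) \<and>
    (\<forall>\<phi> t. field_hom \<phi> \<and> \<not> 11 dvd t \<and> (\<forall>i<11. \<phi> (x i) = x (t * i mod 11)) \<longrightarrow>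
       (\<forall>s\<in>{1..<11}. \<phi> (w s) = w (t * s mod 11)))"
    unfolding E_def y_def by (rule noether_cyclic_11[OF char \<tau>(1,3,2) sfield_adjoin rest x0])
  then obtain w where w': "\<forall>s\<in>{1..<11}. w s \<in> E" "\<forall>s\<in>{1..<11}. \<tau> (w s) = w s" "\<tau> y = y"
      "\<forall>f\<in>E. \<tau> f = f \<longrightarrow> f \<in> field_adjoin k (insert y (w ` {1..<11}))"
      "\<forall>\<phi> t. field_hom \<phi> \<and> \<not> 11 dvd t \<and> (\<forall>i<11. \<phi> (x i) = x (t * i mod 11)) \<longrightarrow>
        (\<forall>s\<in>{1..<11}. \<phi> (w s) = w (t * s mod 11))"
    by (elim exE conjE) (rule that)
  note w = w'(1,2)[rule_format] w'(3) w'(4)[rule_format]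
  have w_hom: "\<phi> (w s) = w (t * s mod 11)"
    if "field_hom \<phi>" "\<not> 11 dvd t" "\<And>i. i < 11 \<Longrightarrow> \<phi> (x i) = x (t * i mod 11)" "s \<in> {1..<11}" for \<phi> s t
    using w'(5) that by blast
  note E = sfield_adjoin[of k "x ` {..<11}", folded E_def]
  have yE: "y \<in> E"
    unfolding y_def E_def using adjoin_gens[of "x ` {..<11}" k] by (intro sfield_closed sfield_adjoin) auto
  have ndvd: "\<not> 11 dvd r ^ j" for j using not_11_dvd prime_dvd_power[of "11 :: nat" r j] by auto
  have \<kappa>w: "(\<kappa> ^^ j) (w s) = w (r ^ j * s mod 11)" if "s \<in> {1..<11}" for j s
    by (rule w_hom[OF hom_funpow[OF \<kappa>(1)] ndvd \<kappa>_pow_x that])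
  have \<kappa>y: "\<kappa> y = y"
    unfolding y_def hom_sum[OF \<kappa>(1)]
    using sum.reindex_bij_betw[OF prime_cyc.bij_mult_mod(1)[OF prime_cyc_11 not_11_dvd], of x] \<kappa>(3) by simp
  have \<kappa>k: "(\<kappa> ^^ j) a = a" if "a \<in> k" for j a using funpow_fixes \<kappa>(2)[OF that] by metis
  have \<kappa>jy: "(\<kappa> ^^ j) y = y" for j using funpow_fixes[of \<kappa> y] \<kappa>y by simp
  define B1 where "B1 = insert y (w ` {1..<11})"
  have "card B1 \<le> Suc (card (w ` {1..<11}))" unfolding B1_def by (rule card_insert_le_m1) auto
  also have "card (w ` {1..<11}) \<le> 10" using card_image_le[of "{1..<11}" w] by simp
  finally have cB1: "card B1 \<le> 11" by simp
  have "x ` {..<11} \<subseteq> alg_hull k B1"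
    by (rule permuted_subset_alg_hull[of "{\<tau>}"]) (use \<tau> \<tau>_perm w(4) in \<open>auto simp: B1_def E_def\<close>)
  then have B1: "alg_free k B1" "card B1 = 11"
    using alg_free_exchange[OF x_free, of B1] cB1 card_x by (auto simp: B1_def)
  have winj: "inj_on w {1..<11}"
  proof (rule eq_card_imp_inj_on)
    have "card B1 \<le> Suc (card (w ` {1..<11}))" unfolding B1_def by (rule card_insert_le_m1) auto
    then show "card (w ` {1..<11}) = card {1..<11::nat}"
      using B1(2) card_image_le[of "{1..<11}" w] by simp
  qed simp
  \<comment> \<open>The powers of 4 are the squares modulo 11; 10 = -1 is a non-square, so v runs
    through the other coset, ordered in parallel to u.\<close>
  define u where "u i = w (4 ^ i mod 11)" for i :: nat
  define v where "v i = w (10 * 4 ^ i mod 11)" for i :: nat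
  have u5: "u 0 = w 1" "u 1 = w 4" "u 2 = w 5" "u 3 = w 9" "u 4 = w 3"
    and v5: "v 0 = w 10" "v 1 = w 7" "v 2 = w 6" "v 3 = w 2" "v 4 = w 8"
    by (simp_all add: u_def v_def)
  have lt5: "{..<5::nat} = {0, 1, 2, 3, 4}" by auto
  have uv: "u ` {..<5} \<union> v ` {..<5} = w ` {1..<11}"
    unfolding lt5 interval_11_nat image_insert image_empty u5 v5 by auto
  have B1_uv: "insert y (u ` {..<5} \<union> v ` {..<5}) = B1" unfolding B1_def uv ..
  have indices: "4 ^ i mod 11 \<in> {1..<11::nat}" "10 * 4 ^ i mod 11 \<in> {1..<11::nat}" for i :: nat
  proof -
    have "\<not> 11 dvd (4 :: nat) ^ i" using prime_dvd_power[of "11 :: nat" 4 i] by auto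
    moreover from this have "\<not> 11 dvd 10 * (4 :: nat) ^ i" using prime_dvd_mult_iff[of "11 :: nat" 10] by auto
    ultimately show "4 ^ i mod 11 \<in> {1..<11::nat}" "10 * 4 ^ i mod 11 \<in> {1..<11::nat}"
      by (auto simp: dvd_eq_mod_eq_0 Suc_le_eq)
  qed
  have uE: "u i \<in> E" "v i \<in> E" "\<tau> (u i) = u i" "\<tau> (v i) = v i" for i
    using w(1,2) indices by (auto simp: u_def v_def)
  have w_cong: "[s = t] (mod 11) \<Longrightarrow> w (s mod 11) = w (t mod 11)" for s t by (simp add: cong_def)
  \<comment> \<open>Since 4^5 = 1 modulo 11, the exponent of 4 counts modulo 5.\<close>
  have Suc4: "w (c * 4 ^ Suc i mod 11) = w (c * 4 ^ (Suc i mod 5) mod 11)" if "i < 5" for i c :: nat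
  proof (rule w_cong, intro cong_mult cong_refl)
    have "i \<in> {0, 1, 2, 3, 4}" using that by auto
    then show "[4 ^ Suc i = 4 ^ (Suc i mod 5)] (mod (11 :: nat))" by (auto simp: cong_def)
  qed
  have shift: "(\<kappa> ^^ j) (u i) = u (Suc i mod 5)" "(\<kappa> ^^ j) (v i) = v (Suc i mod 5)"
    if "[r ^ j = 4] (mod 11)" "i < 5" for i j
  proof -
    have "[r ^ j * (c * 4 ^ i) = 4 * (c * 4 ^ i)] (mod 11)" for c :: nat
      by (intro cong_mult cong_refl that)
    then have "w (r ^ j * (c * 4 ^ i) mod 11) = w (c * 4 ^ Suc i mod 11)" for c :: nat
      using w_cong[of "r ^ j * (c * 4 ^ i)" "c * 4 ^ Suc i"] by (simp add: mult_ac)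
    then have *: "w (r ^ j * (c * 4 ^ i) mod 11) = w (c * 4 ^ (Suc i mod 5) mod 11)" for c :: nat
      using Suc4[OF that(2)] by simp
    show "(\<kappa> ^^ j) (u i) = u (Suc i mod 5)"
      using *[of 1] \<kappa>w[OF indices(1)] by (simp add: u_def mod_mult_right_eq)
    show "(\<kappa> ^^ j) (v i) = v (Suc i mod 5)"
      using *[of 10] \<kappa>w[OF indices(2)] by (simp add: v_def mod_mult_right_eq)
  qed
  have swap: "(\<kappa> ^^ j) (u i) = v i" "(\<kappa> ^^ j) (v i) = u i"
    if "[r ^ j = 10] (mod 11)" for i j
  proof -
    have "[r ^ j * 4 ^ i = 10 * 4 ^ i] (mod 11)" by (intro cong_mult cong_refl that)
    then show "(\<kappa> ^^ j) (u i) = v i"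
      using \<kappa>w[OF indices(1)] w_cong by (simp add: u_def v_def mod_mult_right_eq)
    have "[r ^ j * (10 * 4 ^ i) = 10 * (10 * 4 ^ i)] (mod 11)" by (intro cong_mult cong_refl that)
    moreover have "[(10 * 10) * 4 ^ i = 1 * 4 ^ i] (mod (11::nat))" by (intro cong_mult cong_refl) (simp add: cong_def)
    ultimately have "[r ^ j * (10 * 4 ^ i) = 4 ^ i] (mod 11)" by (simp add: cong_def)
    then show "(\<kappa> ^^ j) (v i) = u i"
      using \<kappa>w[OF indices(2)] w_cong by (simp add: u_def v_def mod_mult_right_eq)
  qed
  define U where "U = (\<Sum>i<5. u i)"
  define V where "V = (\<Sum>i<5. v i)"
  define a where "a i = u i + v i" for i
  define b where "b i = u i * U + v i * V + (u i + v i) * (U * V)" for i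
  define B2 where "B2 = insert y (a ` {..<5} \<union> b ` {..<5})"
  have uvU: "U \<in> E" "V \<in> E" "\<tau> U = U" "\<tau> V = V"
    unfolding U_def V_def hom_sum[OF \<tau>(1)] using uE by (auto intro!: sfield_closed E)
  have abE: "a i \<in> E" "b i \<in> E" "\<tau> (a i) = a i" "\<tau> (b i) = b i" for i
    using uE uvU by (auto simp: a_def b_def hom_simps[OF \<tau>(1)] intro!: sfield_closed E)
  have B2E: "B2 \<subseteq> E" "\<And>z. z \<in> B2 \<Longrightarrow> \<tau> z = z"
    using yE abE w(3) by (auto simp: B2_def)
  have "card B2 \<le> Suc (card (a ` {..<5} \<union> b ` {..<5}))" unfolding B2_def by (rule card_insert_le_m1) auto
  also have "card (a ` {..<5} \<union> b ` {..<5}) \<le> card (a ` {..<5}) + card (b ` {..<5})" by (rule card_Un_le)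
  also have "\<dots> \<le> 10" using card_image_le[of "{..<5}" a] card_image_le[of "{..<5}" b] by simp
  finally have cB2: "card B2 \<le> 11" by simp
  have B1_rest: "w s \<in> field_adjoin k (B1 - {w 1})" if "s \<in> {2..<11}" for s
  proof -
    have "w s \<noteq> w 1" using inj_onD[OF winj, of s 1] that by auto
    then show ?thesis using that adjoin_gens[of "B1 - {w 1}" k] by (auto simp: B1_def)
  qed
  have V_rest: "V \<in> field_adjoin k (B1 - {w 1})"
    and U_rest: "U - w 1 \<in> field_adjoin k (B1 - {w 1})"
  proof -
    note cl = sfield_closed(3)[OF sfield_adjoin]
    have V: "V = w 10 + w 7 + w 6 + w 2 + w 8" and U: "U - w 1 = w 4 + w 5 + w 9 + w 3"
      unfolding U_def V_def lt5 using u5 v5 by (simp_all add: algebra_simps)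
    show "V \<in> field_adjoin k (B1 - {w 1})" unfolding V by (intro cl B1_rest) simp_all
    show "U - w 1 \<in> field_adjoin k (B1 - {w 1})" unfolding U by (intro cl B1_rest) simp_all
  qed
  have w1B: "w 1 \<in> B1" by (auto simp: B1_def)
  \<comment> \<open>\<open>w 1\<close> occurs once in U and not in V, so either equation would
    express it through the other members of the free set B1.\<close>
  have nz: "U \<noteq> V" "U + V \<noteq> 2"
  proof -
    note cl = sfield_closed[OF sfield_adjoin[of k "B1 - {w 1}"]]
    have mem: "V - (U - w 1) \<in> field_adjoin k (B1 - {w 1})" "1 + 1 - V - (U - w 1) \<in> field_adjoin k (B1 - {w 1})"
      using sring_diff[OF sfield_sring[OF sfield_adjoin] V_rest U_rest]
        sring_diff[OF sfield_sring[OF sfield_adjoin] sring_diff[OF sfield_sring[OF sfield_adjoin] cl(3)[OF cl(2) cl(2)] V_rest] U_rest] by auto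
    show "U \<noteq> V" using adjoin_insert_not_mem[OF B1(1) w1B _ mem(1)] by auto
    show "U + V \<noteq> 2" using adjoin_insert_not_mem[OF B1(1) w1B _ mem(2)] by (auto simp: algebra_simps)
  qed
  \<comment> \<open>Here j is 1 for r = 10 and 5 for r = 7. The invariant y joins the base field,
    which leaves the ten paired variables.\<close>
  have pairs: "f \<in> field_adjoin k B2"
    if "[r ^ j = 10] (mod 11)" "f \<in> E" "\<tau> f = f" "(\<kappa> ^^ j) f = f" for f j
  proof -
    have "f \<in> field_adjoin (field_adjoin k {y}) (u ` {..<5} \<union> v ` {..<5})"
      unfolding adjoin_insert B1_uv using w(4) that unfolding B1_def by blast
    then have "f \<in> field_adjoin (field_adjoin k {y}) (a ` {..<5} \<union> b ` {..<5})"
      unfolding a_def b_def U_def V_def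
    proof (rule pair_invariants[OF hom_funpow[OF \<kappa>(1), of j], rotated 5])
      show "(\<kappa> ^^ j) z = z" if "z \<in> field_adjoin k {y}" for z
        by (rule hom_fixes_adjoin[OF hom_funpow[OF \<kappa>(1)] _ _ that]) (auto simp: \<kappa>k \<kappa>jy)
    qed (use swap[OF that(1)] nz that in \<open>auto simp: U_def V_def\<close>)
    then show ?thesis unfolding adjoin_insert B2_def .
  qed
  have ab_fixed: "(\<kappa> ^^ j) (a i) = a i" "(\<kappa> ^^ j) (b i) = b i" if "[r ^ j = 10] (mod 11)" for i j
  proof -
    have "(\<kappa> ^^ j) U = V" "(\<kappa> ^^ j) V = U"
      unfolding U_def V_def hom_sum[OF hom_funpow[OF \<kappa>(1)]] using swap[OF that] by auto
    then show "(\<kappa> ^^ j) (a i) = a i" "(\<kappa> ^^ j) (b i) = b i"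
      using swap[OF that] by (simp_all add: a_def b_def hom_simps[OF hom_funpow[OF \<kappa>(1)]] algebra_simps)
  qed
  consider "r = 1" | "r = 10" | "r = 4" | "r = 7" using r by auto
  then show ?thesis
  proof cases
    case 1
    have "\<kappa> (w s) = w s" if "s \<in> {1..<11}" for s using \<kappa>w[OF that, of 1] that 1 by simp
    then have "good B1"
      unfolding good_def using cB1 yE w \<kappa>y by (auto simp: B1_def)
    then show ?thesis by blast
  next
    case 2
    have r: "[r ^ 1 = 10] (mod 11)" using 2 by simp
    have "good B2"
      unfolding good_def using cB2 B2E pairs[OF r] ab_fixed[OF r] \<kappa>y by (auto simp: B2_def)
    then show ?thesis by blast
  next
    case 3
    have r: "[r ^ 1 = 4] (mod 11)" using 3 by simp
    have "\<exists>B. finite B \<and> card B \<le> 11 \<and> B \<subseteq> field_adjoin k B1 \<and> (\<forall>z\<in>B. \<kappa> z = z) \<and>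
        (\<forall>f\<in>field_adjoin k B1. \<kappa> f = f \<longrightarrow> f \<in> field_adjoin k B)"
      unfolding B1_uv[symmetric] using B1 shift[OF r] \<kappa>(1,2) \<kappa>y
      by (intro cyclic_pair_invariants) (auto simp: B1_uv)
    then obtain B where B': "finite B" "card B \<le> 11" "B \<subseteq> field_adjoin k B1" "\<forall>z\<in>B. \<kappa> z = z"
        "\<forall>f\<in>field_adjoin k B1. \<kappa> f = f \<longrightarrow> f \<in> field_adjoin k B"
      by (elim exE conjE) (rule that)
    note B = B'(1-3) B'(4,5)[rule_format]
    have "field_adjoin k B1 \<subseteq> E"
      using yE w(1) adjoin_base[of k] by (intro adjoin_least E) (auto simp: B1_def E_def)
    moreover have "\<tau> z = z" if "z \<in> field_adjoin k B1" for z
      by (rule hom_fixes_adjoin[OF \<tau>(1,2) _ that]) (use w(2,3) in \<open>auto simp: B1_def\<close>)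
    ultimately have "good B"
      unfolding good_def using B w(4) unfolding B1_def by blast
    then show ?thesis by blast
  next
    case 4
    \<comment> \<open>The swap \<kappa>^5 is divided out first. On what it fixes, \<kappa>^6 agrees
      with \<kappa>, and it rotates the new generators.\<close>
    have r5: "[r ^ 5 = 10] (mod 11)" and r6: "[r ^ 6 = 4] (mod 11)" using 4 by (simp_all add: cong_def)
    \<comment> \<open>The lemma on two 5-cycles needs free variables; the new ones are free because
      the invariants of \<tau> and \<kappa>^5 are generated by these eleven.\<close>
    have "x ` {..<11} \<subseteq> alg_hull k B2"
      by (rule permuted_subset_alg_hull[of "{\<tau>, \<kappa> ^^ 5}"])
        (use \<tau> \<tau>_perm \<kappa>_pow_perm[of 5] pairs[OF r5] hom_funpow[OF \<kappa>(1), of 5] in \<open>auto simp: E_def\<close>)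
    then have B2: "alg_free k B2" "card B2 = 11"
      using alg_free_exchange[OF x_free, of B2] cB2 card_x by (auto simp: B2_def)
    have \<kappa>6: "field_hom (\<kappa> ^^ 6)" by (rule hom_funpow[OF \<kappa>(1)])
    have UV6: "(\<kappa> ^^ 6) U = U" "(\<kappa> ^^ 6) V = V"
      unfolding U_def V_def hom_sum[OF \<kappa>6]
      using shift[OF r6] sum.reindex_bij_betw[OF bij_betw_Suc_mod[of 5], of u] sum.reindex_bij_betw[OF bij_betw_Suc_mod[of 5], of v]
      by simp_all
    have ab6: "(\<kappa> ^^ 6) (a i) = a (Suc i mod 5)" "(\<kappa> ^^ 6) (b i) = b (Suc i mod 5)" if "i < 5" for i
      using shift[OF r6 that] UV6 by (simp_all add: a_def b_def hom_simps[OF \<kappa>6])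
    have "\<exists>B. finite B \<and> card B \<le> 11 \<and> B \<subseteq> field_adjoin k B2 \<and> (\<forall>z\<in>B. (\<kappa> ^^ 6) z = z) \<and>
        (\<forall>f\<in>field_adjoin k B2. (\<kappa> ^^ 6) f = f \<longrightarrow> f \<in> field_adjoin k B)"
      using B2 ab6 \<kappa>6 \<kappa>k \<kappa>jy unfolding B2_def by (intro cyclic_pair_invariants) auto
    then obtain B where B': "finite B" "card B \<le> 11" "B \<subseteq> field_adjoin k B2" "\<forall>z\<in>B. (\<kappa> ^^ 6) z = z"
        "\<forall>f\<in>field_adjoin k B2. (\<kappa> ^^ 6) f = f \<longrightarrow> f \<in> field_adjoin k B"
      by (elim exE conjE) (rule that)
    note B = B'(1-3) B'(4,5)[rule_format]
    have B2sub: "field_adjoin k B2 \<subseteq> E"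
      using B2E(1) adjoin_base[of k] by (intro adjoin_least E) (auto simp: E_def)
    have \<tau>B2: "\<tau> z = z" if "z \<in> field_adjoin k B2" for z
      by (rule hom_fixes_adjoin[OF \<tau>(1,2) B2E(2) that])
    have \<kappa>5: "(\<kappa> ^^ 5) z = z" if "z \<in> field_adjoin k B2" for z
      by (rule hom_fixes_adjoin[OF hom_funpow[OF \<kappa>(1)] _ _ that]) (auto simp: B2_def \<kappa>k \<kappa>jy ab_fixed[OF r5])
    have \<kappa>B: "\<kappa> z = z" if "z \<in> B" for z
    proof -
      have "(\<kappa> ^^ 6) z = \<kappa> ((\<kappa> ^^ 5) z)" by (simp add: numeral_eq_Suc)
      moreover have "(\<kappa> ^^ 5) z = z" using \<kappa>5 B(3) that by blast
      ultimately show ?thesis using B(4)[OF that] by simp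
    qed
    have "f \<in> field_adjoin k B" if f: "f \<in> E" "\<tau> f = f" "\<kappa> f = f" for f
      using pairs[OF r5 f(1,2)] B(5) funpow_fixes[of \<kappa> f] f(3) by metis
    then have "good B"
      unfolding good_def using B(1,2,3) B2sub \<tau>B2 \<kappa>B by blast
    then show ?thesis by blast
  qed
qed

theorem generators:
  "\<exists>B. finite B \<and> B \<subseteq> E \<and> (\<forall>b\<in>B. \<tau> b = b \<and> \<kappa> b = b) \<and>
    (\<forall>f\<in>E. \<tau> f = f \<and> \<kappa> f = f \<longrightarrow> f \<in> field_adjoin k B) \<and> algebraically_independent k B"
proof -
  obtain B where B: "good B" using good_char_11 good_not_char_11 by blast
  have "x ` {..<11} \<subseteq> alg_hull k B"
    by (rule permuted_subset_alg_hull[of "{\<tau>, \<kappa>}"])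
      (use \<tau>(1) \<kappa>(1) \<tau>_perm \<kappa>_pow_perm[of 1] B in \<open>auto simp: good_def E_def\<close>)
  then have "alg_free k B"
    using alg_free_exchange(1)[OF x_free, of B] B card_x by (auto simp: good_def)
  then show ?thesis
    using alg_free_imp_algebraically_independent B unfolding good_def by blast
qed

end

section \<open>Transitive solvable groups of degree eleven\<close>

text \<open>The last nontrivial term of the derived series: its commutators lie in the next term,
  which is trivial.\<close>

lemma (in group) exists_normal_abelian_subgroup:
  assumes "solvable G" "carrier G \<noteq> {\<one>}"
  shows "\<exists>A. A \<lhd> G \<and> A \<noteq> {\<one>} \<and> (\<forall>a\<in>A. \<forall>b\<in>A. a \<otimes> b = b \<otimes> a)"
proof -
  define D where "D n = (derived G ^^ n) (carrier G)" for n :: nat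
  have normal: "D n \<lhd> G" for n
    by (induction n) (auto simp: D_def normal_self derived_is_normal)
  have ex: "\<exists>n. D n = {\<one>}" using assms(1) solvable_iff_trivial_derived_seq unfolding D_def by blast
  define n where "n = (LEAST n. D n = {\<one>})"
  have n: "D n = {\<one>}" unfolding n_def using ex by (rule LeastI_ex)
  have "D 0 \<noteq> {\<one>}" using assms(2) by (simp add: D_def)
  then have "n \<noteq> 0" using n by metis
  then obtain m where m: "n = Suc m" using not0_implies_Suc by blast
  have "D m \<noteq> {\<one>}" using not_less_Least[of m "\<lambda>n. D n = {\<one>}", folded n_def] m by simp
  moreover have "a \<otimes> b = b \<otimes> a" if ab: "a \<in> D m" "b \<in> D m" for a b
  proof -
    have c: "a \<in> carrier G" "b \<in> carrier G"
      using ab subgroup.subset[OF normal_imp_subgroup[OF normal]] by blast+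
    have "a \<otimes> b \<otimes> inv a \<otimes> inv b \<in> derived_set G (D m)" using ab by blast
    then have "a \<otimes> b \<otimes> inv a \<otimes> inv b \<in> D n"
      unfolding m D_def by (simp add: derived_def generate.incl)
    then have "a \<otimes> b \<otimes> inv a \<otimes> inv b = \<one>" using n by simp
    then have "a \<otimes> b \<otimes> inv a = b" using c inv_equality inv_inv by (metis inv_closed m_closed)
    then show ?thesis using c by (metis inv_closed inv_solve_right m_closed)
  qed
  ultimately show ?thesis using normal by blast
qed

text \<open>The orbits of \<open>N\<close> have equal size because \<open>H\<close> permutes them transitively.\<close>

lemma transitive_of_normalized:
  fixes H N :: "('a \<Rightarrow> 'a) set"
  assumes card: "prime (card D)"
    and N: "\<And>n. n \<in> N \<Longrightarrow> bij_betw n D D" "id \<in> N" "\<And>m n. m \<in> N \<Longrightarrow> n \<in> N \<Longrightarrow> m \<circ> n \<in> N"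
      "\<And>n. n \<in> N \<Longrightarrow> \<exists>m\<in>N. m \<circ> n = id"
    and H: "\<And>h. h \<in> H \<Longrightarrow> inj h" "\<And>i j. i \<in> D \<Longrightarrow> j \<in> D \<Longrightarrow> \<exists>h\<in>H. h i = j"
      "\<And>h n. h \<in> H \<Longrightarrow> n \<in> N \<Longrightarrow> \<exists>m\<in>N. h \<circ> n = m \<circ> h"
    and moved: "n0 \<in> N" "i0 \<in> D" "n0 i0 \<noteq> i0" and i: "i \<in> D" and j: "j \<in> D"
  shows "\<exists>n\<in>N. n i = j"
proof -
  define Or where "Or i = (\<lambda>n. n i) ` N" for i
  have fin: "finite D" using card by (metis card.infinite not_prime_0)
  have OrD: "Or i \<subseteq> D" if "i \<in> D" for i
    using N(1) that by (auto simp: Or_def bij_betw_def)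
  have mem: "i \<in> Or i" for i unfolding Or_def using N(2) by (intro image_eqI[of _ _ id]) auto
  have sub: "Or x \<subseteq> Or i" if "x \<in> Or i" for x i
    using that N(3) unfolding Or_def by (auto simp: image_iff) (metis comp_apply)
  have sym: "i \<in> Or x" if x: "x \<in> Or i" for x i
  proof -
    obtain n where n: "n \<in> N" "x = n i" using x by (auto simp: Or_def)
    obtain m where "m \<in> N" "m \<circ> n = id" using N(4) n(1) by blast
    then have "m x = i" using n(2) by (metis comp_apply id_apply)
    then show ?thesis using \<open>m \<in> N\<close> by (auto simp: Or_def)
  qed
  have le: "card (Or i) \<le> card (Or j)" if "i \<in> D" "j \<in> D" for i j
  proof -
    obtain h where h: "h \<in> H" "h i = j" using H(2) \<open>i \<in> D\<close> \<open>j \<in> D\<close> by blast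
    have "h ` Or i \<subseteq> Or j"
    proof
      fix y assume "y \<in> h ` Or i"
      then obtain n where n: "n \<in> N" "y = h (n i)" by (auto simp: Or_def)
      obtain m where "m \<in> N" "h \<circ> n = m \<circ> h" using H(3) h(1) n(1) by blast
      then have "y = m j" using n(2) h(2) by (metis comp_apply)
      then show "y \<in> Or j" using \<open>m \<in> N\<close> by (auto simp: Or_def)
    qed
    then have "card (h ` Or i) \<le> card (Or j)"
      using OrD[OF \<open>j \<in> D\<close>] fin by (intro card_mono) (auto intro: finite_subset)
    then show ?thesis using H(1)[OF h(1)] by (simp add: card_image inj_on_subset)
  qed
  then have eq: "card (Or j) = card (Or i)" if "j \<in> D" for j using that i by (simp add: le_antisym)
  have "card (Or i) * card (Or ` D) = card (\<Union> (Or ` D))"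
  proof (rule card_partition)
    fix c1 c2 assume c: "c1 \<in> Or ` D" "c2 \<in> Or ` D" "c1 \<noteq> c2"
    show "c1 \<inter> c2 = {}"
    proof (rule ccontr)
      assume "c1 \<inter> c2 \<noteq> {}"
      then obtain x y z where "c1 = Or x" "c2 = Or y" "z \<in> Or x" "z \<in> Or y" using c by blast
      then show False using sub sym c(3) by (metis subset_antisym)
    qed
  qed (use fin OrD eq in \<open>auto intro: finite_subset\<close>)
  moreover have "\<Union> (Or ` D) = D" using OrD mem by blast
  ultimately have "card (Or i) dvd card D" by (metis dvd_triv_left)
  then have "card (Or i) = 1 \<or> card (Or i) = card D" using card by (simp add: prime_nat_iff)
  moreover have "card (Or i) \<noteq> 1"
  proof
    assume "card (Or i) = 1"
    then have "card (Or i0) = 1" using eq[OF moved(2)] by simp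
    then obtain z where "Or i0 = {z}" by (auto simp: card_1_singleton_iff)
    moreover have "n0 i0 \<in> Or i0" using moved(1) by (auto simp: Or_def)
    ultimately show False using mem[of i0] moved(3) by auto
  qed
  ultimately have "Or i = D" using card_subset_eq[OF fin OrD[OF i]] by simp
  then show ?thesis using j by (auto simp: Or_def)
qed

text \<open>A nontrivial abelian normal subgroup A is transitive because the degree is prime, and so
  are the powers of any \<sigma> in A other than the identity. Labelling points along \<sigma> turns
  A into translations; elements of G normalise A and are therefore affine in the labels.\<close>

lemma affine_enumeration:
  fixes G :: "(nat \<Rightarrow> nat) set"
  assumes G: "subgroup G (sym_group 11)" "solvable ((sym_group 11)\<lparr>carrier := G\<rparr>)"
    and trans: "\<forall>i\<in>{1..11}. \<forall>j\<in>{1..11}. \<exists>\<sigma>\<in>G. \<sigma> i = j"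
  shows "\<exists>e \<sigma>. \<sigma> \<in> G \<and> bij_betw e {..<11::nat} {1..11} \<and> (\<forall>j. \<sigma> (e (j mod 11)) = e (Suc j mod 11)) \<and>
    (\<forall>g\<in>G. \<exists>c b. c \<in> {1..<11} \<and> (\<forall>j<11. g (e j) = e ((c * j + b) mod 11)))"
proof -
  let ?G = "(sym_group 11)\<lparr>carrier := G\<rparr>"
  interpret G: group ?G using group.subgroup_imp_group[OF sym_group_is_group G(1)] .
  have mult: "x \<otimes>\<^bsub>?G\<^esub> y = x \<circ> y" and one: "\<one>\<^bsub>?G\<^esub> = id" for x y
    by (simp_all add: sym_group_mult sym_group_one)
  have perm: "g permutes {1..11}" if "g \<in> G" for g
    using subgroup.subset[OF G(1)] that sym_group_carrier by blast
  obtain g where g: "g \<in> G" "g 1 = 2" using trans by force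
  then have "carrier ?G \<noteq> {\<one>\<^bsub>?G\<^esub>}" using one by auto
  then obtain A where A: "A \<lhd> ?G" "A \<noteq> {id}" "\<And>a b. a \<in> A \<Longrightarrow> b \<in> A \<Longrightarrow> a \<circ> b = b \<circ> a"
    using G.exists_normal_abelian_subgroup[OF G(2)] unfolding mult one by blast
  interpret A: normal A ?G by (rule A(1))
  have AG: "a \<in> G" if "a \<in> A" for a using A.subset that by auto
  have idA: "id \<in> A" using A.one_closed one by simp
  have compA: "a \<circ> b \<in> A" if "a \<in> A" "b \<in> A" for a b using A.m_closed[OF that] mult by simp
  have invA: "\<exists>m\<in>A. m \<circ> a = id" if "a \<in> A" for a
    using A.m_inv_closed[OF that] G.l_inv[of a] AG[OF that] mult one by auto
  have normA: "\<exists>m\<in>A. h \<circ> a = m \<circ> h" if "h \<in> G" "a \<in> A" for h a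
  proof -
    let ?m = "h \<otimes>\<^bsub>?G\<^esub> a \<otimes>\<^bsub>?G\<^esub> inv\<^bsub>?G\<^esub> h"
    have "?m \<in> A" using A.inv_op_closed2 that by simp
    moreover have "h \<in> carrier ?G" "a \<in> carrier ?G" using that AG by simp_all
    then have "?m \<otimes>\<^bsub>?G\<^esub> h = h \<otimes>\<^bsub>?G\<^esub> a"
      by (simp only: G.m_assoc G.m_closed G.inv_closed G.l_inv G.r_one)
    ultimately show ?thesis unfolding mult by metis
  qed
  obtain \<sigma> where \<sigma>: "\<sigma> \<in> A" "\<sigma> \<noteq> id" using A(2) idA by blast
  then obtain i0 where i0: "\<sigma> i0 \<noteq> i0" using eq_id_iff by metis
  have i0D: "i0 \<in> {1..11}" using i0 perm[OF AG[OF \<sigma>(1)]] by (metis permutes_not_in)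
  have card: "prime (card {1..11::nat})" by simp
  have transA: "\<exists>a\<in>A. a i = j" if "i \<in> {1..11}" "j \<in> {1..11}" for i j
    by (rule transitive_of_normalized[where H = G and D = "{1..11}", OF card _ idA compA invA _ _ normA \<sigma>(1) i0D i0 that])
      (use perm AG trans in \<open>auto intro: permutes_imp_bij permutes_inj\<close>)
  have pow\<sigma>: "\<sigma> ^^ n \<in> A" for n by (induction n) (simp_all only: funpow.simps idA compA \<sigma>(1))
  obtain K where K: "\<sigma> ^^ K = id" "K > 0"
    using permutation_is_nilpotent[of \<sigma>] perm[OF AG[OF \<sigma>(1)]] permutation_permutes[of \<sigma>] by blast
  \<comment> \<open>The orbit lemma a second time, now with A as the transitive group: it commutes
    with the powers of \<sigma> and so normalises them.\<close>
  have trans\<sigma>: "\<exists>n\<in>range (\<lambda>n. \<sigma> ^^ n). n i = j" if "i \<in> {1..11}" "j \<in> {1..11}" for i j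
  proof (rule transitive_of_normalized[where H = A and D = "{1..11}", OF card _ _ _ _ _ _ _ _ i0D _ that])
    show "bij_betw n {1..11} {1..11}" if "n \<in> range (\<lambda>n. \<sigma> ^^ n)" for n
      using that pow\<sigma> AG perm by (auto intro: permutes_imp_bij)
    show "id \<in> range (\<lambda>n. \<sigma> ^^ n)" by (rule image_eqI[of _ _ 0]) auto
    show "m \<circ> n \<in> range (\<lambda>n. \<sigma> ^^ n)" if "m \<in> range (\<lambda>n. \<sigma> ^^ n)" "n \<in> range (\<lambda>n. \<sigma> ^^ n)" for m n
      using that by (auto simp: funpow_add[symmetric])
    show "\<exists>m\<in>range (\<lambda>n. \<sigma> ^^ n). m \<circ> n = id" if n: "n \<in> range (\<lambda>n. \<sigma> ^^ n)" for n
    proof -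
      obtain j where j: "n = \<sigma> ^^ j" using n by auto
      \<comment> \<open>Only natural exponents are available, so the inverse of the j-th power is
        the power with exponent K j - j.\<close>
      have "\<sigma> ^^ (K * j) = id" unfolding funpow_mult[symmetric] K(1) by (induction j) auto
      moreover have "K * j = (K * j - j) + j" using K(2) by simp
      ultimately have "\<sigma> ^^ (K * j - j) \<circ> n = id" unfolding j by (metis funpow_add)
      then show ?thesis by blast
    qed
    show "\<exists>m\<in>range (\<lambda>n. \<sigma> ^^ n). h \<circ> n = m \<circ> h" if "h \<in> A" "n \<in> range (\<lambda>n. \<sigma> ^^ n)" for h n
      using that A(3) pow\<sigma> by blast
    show "\<sigma> \<in> range (\<lambda>n. \<sigma> ^^ n)" by (rule image_eqI[of _ _ 1]) auto
    show "\<sigma> i0 \<noteq> i0" by (rule i0)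
    show "inj h" if "h \<in> A" for h using perm[OF AG[OF that]] by (rule permutes_inj)
    show "\<exists>h\<in>A. h i = j" if "i \<in> {1..11}" "j \<in> {1..11}" for i j using transA that .
  qed
  define e where "e j = (\<sigma> ^^ j) 1" for j
  have e_range: "range e = {1..11}"
  proof
    have "e j \<in> {1..11}" for j
      unfolding e_def permutes_in_image[OF perm[OF AG[OF pow\<sigma>]]] by simp
    then show "range e \<subseteq> {1..11}" by blast
    show "{1..11} \<subseteq> range e" using trans\<sigma>[of 1] by (fastforce simp: e_def)
  qed
  have e_add: "e (i + j) = (\<sigma> ^^ i) (e j)" for i j by (simp add: e_def funpow_add)
  have inj\<sigma>: "inj (\<sigma> ^^ i)" for i using perm[OF AG[OF pow\<sigma>]] by (rule permutes_inj)
  \<comment> \<open>The length of the cycle through 1. By minimality e is injective on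
    \<open>{..<d}\<close>, and it reaches all eleven points, so d = 11.\<close>
  define d where "d = (LEAST d. d > 0 \<and> e d = 1)"
  have "K > 0 \<and> e K = 1" using K by (simp add: e_def)
  then have d: "d > 0" "e d = 1" unfolding d_def by (metis (mono_tags, lifting) LeastI)+
  have d_min: "d \<le> m" if "m > 0" "e m = 1" for m unfolding d_def using that by (intro Least_le) auto
  have "e (j + d * m) = e j" for j m
  proof (induction m)
    case (Suc m)
    have "e (j + d * Suc m) = (\<sigma> ^^ (j + d * m)) (e d)" using e_add[of "j + d * m" d] by (simp add: add_ac)
    then show ?case using Suc d(2) by (simp add: e_def)
  qed simp
  then have e_mod_d: "e j = e (j mod d)" for j by (metis mod_mult_div_eq)
  have "inj_on e {..<d}"
  proof (rule linorder_inj_onI)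
    fix i j assume ij: "i < j" "i \<in> {..<d}" "j \<in> {..<d}"
    show "e i \<noteq> e j"
    proof
      assume "e i = e j"
      then have "(\<sigma> ^^ i) 1 = (\<sigma> ^^ i) (e (j - i))" using e_add[of i "j - i"] ij(1) by (simp add: e_def)
      then have "e (j - i) = 1" using injD[OF inj\<sigma>] by metis
      then show False using d_min[of "j - i"] ij by auto
    qed
  qed auto
  moreover have img: "e ` {..<d} = {1..11}"
    using e_range e_mod_d d(1) by (metis (no_types, lifting) image_subset_iff lessThan_iff mod_less_divisor rangeI subset_antisym subset_iff image_eqI imageE)
  ultimately have bij: "bij_betw e {..<d} {1..11}" by (simp add: bij_betw_def)
  then have "d = 11" using bij_betw_same_card by fastforce
  then have bij: "bij_betw e {..<11} {1..11}" and e_mod: "e j = e (j mod 11)" for j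
    using bij e_mod_d by simp_all
  have aff: "\<exists>c b. c \<in> {1..<11} \<and> (\<forall>j<11. g (e j) = e ((c * j + b) mod 11))" if g: "g \<in> G" for g
  proof -
    obtain a where a: "a \<in> A" "g \<circ> \<sigma> = a \<circ> g" using normA[OF g \<sigma>(1)] by blast
    have mem: "a 1 \<in> {1..11}" "g 1 \<in> {1..11}"
      using permutes_in_image[OF perm[OF AG[OF a(1)]]] permutes_in_image[OF perm[OF g]] by auto
    obtain c where c: "a 1 = e c" "c < 11" using mem(1) bij unfolding bij_betw_def by (metis imageE lessThan_iff)
    obtain b where b: "g 1 = e b" using mem(2) e_range by (metis imageE)
    \<comment> \<open>Commuting with \<sigma>, the permutation a is determined by its value at 1 and
      translates labels by c. Then g \<sigma> = a g makes g affine with slope c.\<close>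
    have ae: "a (e j) = e (c + j)" for j
    proof -
      have "a (e j) = (a \<circ> \<sigma> ^^ j) 1" by (simp add: e_def)
      also have "\<dots> = (\<sigma> ^^ j) (a 1)" using A(3)[OF a(1) pow\<sigma>] by simp
      finally show ?thesis using c(1) e_add[of j c] by (simp add: add.commute)
    qed
    have ge: "g (e j) = e (c * j + b)" for j
    proof (induction j)
      case 0
      show ?case using b by (simp add: e_def)
    next
      case (Suc j)
      have "g (e (Suc j)) = (g \<circ> \<sigma>) (e j)" by (simp add: e_def)
      also have "\<dots> = a (g (e j))" using a(2) by simp
      finally show ?case using Suc ae by (simp add: add_ac)
    qed
    have "c \<noteq> 0"
    proof
      assume "c = 0"
      then have "g (e 0) = g (e 1)" using ge by simp
      then have "e 0 = e 1" using permutes_inj[OF perm[OF g]] injD by metis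
      then show False using inj_onD[OF bij_betw_imp_inj_on[OF bij], of 0 1] by simp
    qed
    then show ?thesis using c(2) ge e_mod by (intro exI[of _ c] exI[of _ b]) auto
  qed
  have "\<sigma> (e (j mod 11)) = e (Suc j mod 11)" for j
    using e_mod[of j] e_mod[of "Suc j"] by (simp add: e_def)
  then show ?thesis using AG[OF \<sigma>(1)] bij aff by blast
qed

text \<open>H is a subgroup of a cyclic group of order 10, so it is determined by whether it
  contains the element 10 of order 2 and the element 4 of order 5.\<close>

lemma generator_mod_11:
  fixes H :: "nat set"
  assumes H: "H \<subseteq> {1..<11}" "1 \<in> H" "\<And>a b. a \<in> H \<Longrightarrow> b \<in> H \<Longrightarrow> a * b mod 11 \<in> H"
  shows "\<exists>r\<in>H. r \<in> {1, 4, 7, 10} \<and> (\<forall>c\<in>H. \<exists>i. c = r ^ i mod 11)"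
proof -
  have pow: "c ^ i mod 11 \<in> H" if "c \<in> H" for c i
  proof (induction i)
    case (Suc i)
    then have "c * (c ^ i mod 11) mod 11 \<in> H" using H(3) that by blast
    then show ?case by (simp add: mod_mult_right_eq)
  qed (use H(2) in simp)
  \<comment> \<open>The listed residues are the non-squares, whose fifth power is -1.\<close>
  have ten: "10 \<in> H" if "c \<in> H" "c \<in> {2, 6, 7, 8, 10}" for c
    using pow[OF that(1), of 5] that(2) by auto
  \<comment> \<open>The residues other than 1 and 10 have order divisible by 5, and one of the
    powers 2, 3, 4, 6, 8 equals 4.\<close>
  have four: "4 \<in> H" if "c \<in> H" "c \<in> {2, 3, 4, 5, 6, 7, 8, 9}" for c
    using pow[OF that(1), of 2] pow[OF that(1), of 8] pow[OF that(1), of 4] pow[OF that(1), of 3] pow[OF that(1), of 6] that by auto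
  have cases: "c \<in> {1, 2, 3, 4, 5, 6, 7, 8, 9, 10}" if "c \<in> H" for c
    using H(1) that unfolding interval_11_nat by blast
  consider "4 \<in> H" "10 \<in> H" | "4 \<in> H" "10 \<notin> H" | "4 \<notin> H" "10 \<in> H" | "4 \<notin> H" "10 \<notin> H" by blast
  then show ?thesis
  proof cases
    case 1
    have "4 * 10 mod 11 \<in> H" using H(3)[OF 1] .
    then have "7 \<in> H" by simp
    moreover have "c \<in> (\<lambda>i. 7 ^ i mod 11) ` {..<10}" if "c \<in> H" for c
      using cases[OF that] unfolding lessThan_10_nat by auto
    ultimately show ?thesis by (intro bexI[of _ 7]) auto
  next
    case 2
    have "c \<in> (\<lambda>i. 4 ^ i mod 11) ` {..<10}" if "c \<in> H" for c
    proof -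
      have "c \<in> {1, 3, 4, 5, 9}" using cases[OF that] ten[OF that] 2 by auto
      then show ?thesis unfolding lessThan_10_nat by auto
    qed
    then show ?thesis using 2 by (intro bexI[of _ 4]) auto
  next
    case 3
    have "c \<in> (\<lambda>i. 10 ^ i mod 11) ` {..<10}" if "c \<in> H" for c
    proof -
      have "c \<in> {1, 10}" using cases[OF that] four[OF that] 3 by auto
      then show ?thesis unfolding lessThan_10_nat by auto
    qed
    then show ?thesis using 3 by (intro bexI[of _ 10]) auto
  next
    case 4
    have one: "c = 1" if "c \<in> H" for c using cases[OF that] four[OF that] ten[OF that] 4 by auto
    have "\<exists>i. c = 1 ^ i mod 11" if "c \<in> H" for c using one[OF that] by simp
    then show ?thesis using H(2) by blast
  qed
qed

text \<open>Composing g with a power of \<sigma> removes its translation part, and the slopes left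
  over form a subgroup of the units modulo 11. That subgroup is cyclic, so one multiplication
  \<kappa> accounts for all slopes.\<close>

lemma metacyclic_enumeration:
  fixes G :: "(nat \<Rightarrow> nat) set"
  assumes G: "subgroup G (sym_group 11)" "solvable ((sym_group 11)\<lparr>carrier := G\<rparr>)"
    and trans: "\<forall>i\<in>{1..11}. \<forall>j\<in>{1..11}. \<exists>\<sigma>\<in>G. \<sigma> i = j"
  shows "\<exists>e \<sigma> \<kappa> r. \<sigma> \<in> G \<and> \<kappa> \<in> G \<and> r \<in> {1, 4, 7, 10} \<and> bij_betw e {..<11::nat} {1..11} \<and>
    (\<forall>i<11. \<sigma> (e i) = e (Suc i mod 11)) \<and> (\<forall>i<11. \<kappa> (e i) = e (r * i mod 11)) \<and>
    (\<forall>g\<in>G. \<exists>b i. g = \<sigma> ^^ b \<circ> \<kappa> ^^ i)"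
proof -
  obtain e \<sigma> where \<sigma>: "\<sigma> \<in> G" and e: "bij_betw e {..<11::nat} {1..11}"
    and \<sigma>e: "\<And>j. \<sigma> (e (j mod 11)) = e (Suc j mod 11)"
    and aff: "\<And>g. g \<in> G \<Longrightarrow> \<exists>c b. c \<in> {1..<11} \<and> (\<forall>j<11. g (e j) = e ((c * j + b) mod 11))"
    using affine_enumeration[OF assms] by blast
  have perm: "g permutes {1..11}" if "g \<in> G" for g
    using subgroup.subset[OF G(1)] that sym_group_carrier by blast
  have comp: "f \<circ> g \<in> G" if "f \<in> G" "g \<in> G" for f g
    using subgroup.m_closed[OF G(1) that] by (simp add: sym_group_mult)
  have id: "id \<in> G" using subgroup.one_closed[OF G(1)] by (simp add: sym_group_one)
  have pow: "g ^^ n \<in> G" if "g \<in> G" for g n by (induction n) (simp_all only: funpow.simps id comp that)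
  have eqI: "f = g" if fg: "f \<in> G" "g \<in> G" "\<And>j. j < 11 \<Longrightarrow> f (e j) = g (e j)" for f g
  proof
    fix z show "f z = g z"
    proof (cases "z \<in> {1..11}")
      case True
      then obtain j where "j < 11" "z = e j" using e unfolding bij_betw_def by (metis imageE lessThan_iff)
      then show ?thesis using fg(3) by simp
    next
      case False
      then show ?thesis using perm[OF fg(1)] perm[OF fg(2)] by (simp add: permutes_not_in)
    qed
  qed
  have \<sigma>pow: "(\<sigma> ^^ b) (e (j mod 11)) = e ((j + b) mod 11)" for b j
  proof (induction b)
    case (Suc b)
    then show ?case using \<sigma>e[of "j + b"] by simp
  qed simp
  \<comment> \<open>The slopes of those members of G that fix the point with label 0.\<close>
  define H where "H = {c \<in> {1..<11}. \<exists>g\<in>G. \<forall>j. g (e (j mod 11)) = e (c * j mod 11)}"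
  have Hmult: "a * b mod 11 \<in> H" if ab: "a \<in> H" "b \<in> H" for a b
  proof -
    obtain f g where fg: "f \<in> G" "g \<in> G" "\<And>j. f (e (j mod 11)) = e (a * j mod 11)" "\<And>j. g (e (j mod 11)) = e (b * j mod 11)"
      using ab unfolding H_def by blast
    have "(f \<circ> g) (e (j mod 11)) = e ((a * b mod 11) * j mod 11)" for j
      using fg(3)[of "b * j"] fg(4)[of j] by (simp add: mod_mult_left_eq mult.assoc)
    moreover have "\<not> 11 dvd a * b"
      using ab prime_dvd_mult_iff[of "11 :: nat" a b] by (auto simp: H_def dest: dvd_imp_le)
    then have "a * b mod 11 \<in> {1..<11}" by (auto simp: dvd_eq_mod_eq_0 Suc_le_eq)
    ultimately show ?thesis unfolding H_def using comp[OF fg(1,2)] by blast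
  qed
  have "1 \<in> H" unfolding H_def using id by (auto intro!: bexI[of _ id])
  then obtain r where r: "r \<in> H" "r \<in> {1, 4, 7, 10}" "\<And>c. c \<in> H \<Longrightarrow> \<exists>i. c = r ^ i mod 11"
    using generator_mod_11[of H] Hmult unfolding H_def by blast
  obtain \<kappa> where \<kappa>: "\<kappa> \<in> G" "\<And>j. \<kappa> (e (j mod 11)) = e (r * j mod 11)" using r(1) unfolding H_def by blast
  have \<kappa>pow: "(\<kappa> ^^ i) (e (j mod 11)) = e (r ^ i * j mod 11)" for i j
  proof (induction i)
    case (Suc i)
    then show ?case using \<kappa>(2)[of "r ^ i * j"] by (simp add: mult.assoc)
  qed simp
  have "\<exists>b i. g = \<sigma> ^^ b \<circ> \<kappa> ^^ i" if g: "g \<in> G" for g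
  proof -
    obtain c b where cb: "c \<in> {1..<11}" "\<And>j. j < 11 \<Longrightarrow> g (e j) = e ((c * j + b) mod 11)" using aff[OF g] by blast
    have gm: "g (e (j mod 11)) = e ((c * j + b) mod 11)" for j
    proof -
      have "[c * (j mod 11) + b = c * j + b] (mod 11)" by (intro cong_add cong_mult cong_refl) (simp add: cong_def)
      then show ?thesis using cb(2)[of "j mod 11"] by (simp add: cong_def)
    qed
    \<comment> \<open>\<open>10 * b\<close> represents -b modulo 11, which undoes the translation
      part of g.\<close>
    have "(\<sigma> ^^ (10 * b) \<circ> g) (e (j mod 11)) = e (c * j mod 11)" for j
    proof -
      have "(c * j + b + 10 * b) mod 11 = (c * j + 11 * b) mod 11" by (simp add: algebra_simps)
      then show ?thesis using \<sigma>pow[of "10 * b" "c * j + b"] gm[of j] by simp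
    qed
    then have "c \<in> H" unfolding H_def using cb(1) comp[OF pow[OF \<sigma>] g] by blast
    then obtain i where i: "c = r ^ i mod 11" using r(3) by blast
    have "g = \<sigma> ^^ b \<circ> \<kappa> ^^ i"
    proof (rule eqI[OF g comp[OF pow[OF \<sigma>] pow[OF \<kappa>(1)]]])
      fix j :: nat assume j: "j < 11"
      have "(c * j + b) mod 11 = (r ^ i * j + b) mod 11"
      proof -
        have "[c * j + b = r ^ i * j + b] (mod 11)" by (intro cong_add cong_mult cong_refl) (simp add: i cong_def)
        then show ?thesis by (simp add: cong_def)
      qed
      then show "g (e j) = (\<sigma> ^^ b \<circ> \<kappa> ^^ i) (e j)"
        using gm[of j] \<kappa>pow[of i j] \<sigma>pow[of b "r ^ i * j"] j by simp
    qed
    then show ?thesis by blast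
  qed
  moreover have "\<forall>i<11. \<sigma> (e i) = e (Suc i mod 11)" "\<forall>i<11. \<kappa> (e i) = e (r * i mod 11)"
    using \<sigma>e \<kappa>(2) by (metis mod_less)+
  ultimately show ?thesis using \<sigma> \<kappa>(1) r(2) e by blast
qed

section \<open>Transfer to the permutation action on rational functions\<close>

lemma field_hom_rf_act: "bij \<sigma> \<Longrightarrow> field_hom (rf_act \<sigma> :: 'k::field ratfun \<Rightarrow> 'k ratfun)"
  unfolding field_hom_def
  by (auto simp: rf_act_add rf_act_mult One_fract_def rf_act_Fract mvperm_one)

lemma rf_act_funpow: "bij \<sigma> \<Longrightarrow> rf_act (\<sigma> ^^ n) f = (rf_act \<sigma> ^^ n) f"
proof (induction n)
  case 0
  then show ?case using rf_act_id[of f] by (simp add: id_def)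
next
  case (Suc n)
  have "rf_act (\<sigma> ^^ Suc n) f = rf_act \<sigma> (rf_act (\<sigma> ^^ n) f)"
    unfolding funpow.simps(2) using Suc.prems by (intro rf_act_comp[symmetric] bij_fn)
  also have "\<dots> = (rf_act \<sigma> ^^ Suc n) f" using Suc by simp
  finally show ?case .
qed

lemma inj_rf_var: "inj (rf_var :: nat \<Rightarrow> 'k::field ratfun)"
proof (rule injI)
  fix i j assume "(rf_var i :: 'k ratfun) = rf_var j"
  then have "(mvvar i :: (nat, 'k) mvpoly) = mvvar j" by (simp add: rf_var_def)
  then have "Poly_Mapping.keys (mvvar i :: (nat, 'k) mvpoly) = Poly_Mapping.keys (mvvar j :: (nat, 'k) mvpoly)" by simp
  then have "Poly_Mapping.single i (1 :: nat) = Poly_Mapping.single j 1" by (simp add: mvvar_def)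
  then have "Poly_Mapping.keys (Poly_Mapping.single i (1 :: nat)) = Poly_Mapping.keys (Poly_Mapping.single j (1 :: nat))" by simp
  then show "i = j" by simp
qed

theorem theorem1p5:
  fixes G :: "(nat \<Rightarrow> nat) set"
  assumes "subgroup G (sym_group 11)"
    and "solvable ((sym_group 11)\<lparr>carrier := G\<rparr>)"
    and "\<forall>i\<in>{1..11}. \<forall>j\<in>{1..11}. \<exists>\<sigma>\<in>G. \<sigma> i = j"
  shows "rational_extension (rf_constants :: 'k::field ratfun set)
           (fixed_field rf_act G (rf_field 11))"
proof -
  obtain e \<sigma> \<kappa> r where \<sigma>: "\<sigma> \<in> G" "\<And>i. i < 11 \<Longrightarrow> \<sigma> (e i) = e (Suc i mod 11)"
    and \<kappa>: "\<kappa> \<in> G" "\<And>i. i < 11 \<Longrightarrow> \<kappa> (e i) = e (r * i mod 11)"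
    and r: "r \<in> {1, 4, 7, 10}" and e: "bij_betw e {..<11::nat} {1..11}"
    and G: "\<And>g. g \<in> G \<Longrightarrow> \<exists>b i. g = \<sigma> ^^ b \<circ> \<kappa> ^^ i"
    using metacyclic_enumeration[OF assms] by blast
  have bij: "bij g" if "g \<in> G" for g
    using subgroup.subset[OF assms(1)] that sym_group_carrier permutes_bij by blast
  let ?x = "\<lambda>i. rf_var (e i) :: 'k ratfun"
  have img: "?x ` {..<11} = rf_var ` {1..11}"
    using e by (auto simp: bij_betw_def image_comp[symmetric, of rf_var e, unfolded o_def])
  have const: "rf_act g a = a" if "g \<in> G" "a \<in> rf_constants" for g and a :: "'k ratfun"
    using that bij rf_act_const by (auto simp: rf_constants_def)
  interpret metacyclic_action "rf_constants :: 'k ratfun set" ?x "rf_act \<sigma>" "rf_act \<kappa>" r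
  proof
    show "alg_free rf_constants (?x ` {..<11})" unfolding img by (rule alg_free_rf_var)
    show "inj_on ?x {..<11}"
      using e inj_rf_var by (auto simp: bij_betw_def inj_on_def)
    show "field_hom (rf_act \<sigma> :: 'k ratfun \<Rightarrow> 'k ratfun)" "field_hom (rf_act \<kappa> :: 'k ratfun \<Rightarrow> 'k ratfun)"
      by (intro field_hom_rf_act bij \<sigma>(1) \<kappa>(1))+
    show "rf_act \<sigma> (?x i) = ?x (Suc i mod 11)" "rf_act \<kappa> (?x i) = ?x (r * i mod 11)" if "i < 11" for i
      using \<sigma>(2) \<kappa>(2) that by (simp_all add: rf_act_var bij \<sigma>(1) \<kappa>(1))
  qed (fact r | rule const \<sigma>(1) \<kappa>(1) | assumption)+
  have E: "E = rf_field 11" unfolding E_def rf_field_def img ..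
  obtain B where B': "finite B" "B \<subseteq> E" "\<forall>b\<in>B. rf_act \<sigma> b = b \<and> rf_act \<kappa> b = b"
    "\<forall>f\<in>E. rf_act \<sigma> f = f \<and> rf_act \<kappa> f = f \<longrightarrow> f \<in> field_adjoin rf_constants B"
    "algebraically_independent rf_constants B"
    using generators by (elim exE conjE) (rule that)
  have \<sigma>B: "rf_act \<sigma> b = b" and \<kappa>B: "rf_act \<kappa> b = b" if "b \<in> B" for b using B'(3) that by auto
  have "fixed_field rf_act G (rf_field 11) = field_adjoin rf_constants B"
  proof
    show "fixed_field rf_act G (rf_field 11) \<subseteq> field_adjoin rf_constants B"
    proof
      fix f :: "'k ratfun" assume "f \<in> fixed_field rf_act G (rf_field 11)"
      then have "f \<in> E" "rf_act \<sigma> f = f" "rf_act \<kappa> f = f"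
        using \<open>\<sigma> \<in> G\<close> \<open>\<kappa> \<in> G\<close> by (simp_all add: fixed_field_def E)
      then show "f \<in> field_adjoin rf_constants B" using B'(4) by simp
    qed
    show "field_adjoin rf_constants B \<subseteq> fixed_field rf_act G (rf_field 11)"
    proof
      fix f assume f: "f \<in> field_adjoin rf_constants B"
      have "field_adjoin rf_constants B \<subseteq> E"
        using B'(2) adjoin_base[of rf_constants "?x ` {..<11}"] unfolding E_def
        by (intro adjoin_least sfield_adjoin)
      moreover have "rf_act g f = f" if g: "g \<in> G" for g
      proof -
        obtain b i where "g = \<sigma> ^^ b \<circ> \<kappa> ^^ i" using G[OF g] by blast
        moreover have "rf_act \<sigma> f = f" by (rule hom_fixes_adjoin[OF \<tau>(1,2) \<sigma>B f])
        moreover have "rf_act \<kappa> f = f" by (rule hom_fixes_adjoin[OF \<kappa>(1,2) \<kappa>B f])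
        ultimately show ?thesis
          using bij[OF \<open>\<sigma> \<in> G\<close>] bij[OF \<open>\<kappa> \<in> G\<close>]
          by (simp add: rf_act_comp[symmetric] bij_fn rf_act_funpow funpow_fixes)
      qed
      ultimately show "f \<in> fixed_field rf_act G (rf_field 11)"
        unfolding fixed_field_def E[symmetric] using f by blast
    qed
  qed
  then show ?thesis
    using B'(1,5) unfolding rational_extension_def finitely_generated_extension_def purely_transcendental_def
    by blast
qed

end
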